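(* Let $n,m\ge1$ and for $0\le s\le\min(m,n)$ let $\rho_s:\mathsf Q^{(m)}\mathsf P^{(n)}\to\mathsf P^{(n-s)}\mathsf Q^{(m-s)}$ be the morphism in $\mathcal H$ obtained by including $\mathsf Q^{(m)}\mathsf P^{(n)}$ in $\mathsf Q^{\otimes m}\mathsf P^{\otimes n}$, joining the $s$ rightmost $\mathsf Q$-strands to the $s$ leftmost $\mathsf P$-strands by $s$ nested caps, crossing the remaining $m-s$ downward strands with the remaining $n-s$ upward strands, and projecting to $\mathsf P^{(n-s)}\mathsf Q^{(m-s)}$. Let $\iota_s:\mathsf P^{(n-s)}\mathsf Q^{(m-s)}\to\mathsf Q^{(m)}\mathsf P^{(n)}$ be $\binom ns\binom ms s!$ times the morphism given by the vertically reflected diagram (cross the strands, insert $s$ nested cups $\mathsf 1\to\mathsf Q\mathsf P$ in the middle, and project to $\mathsf Q^{(m)}\mathsf P^{(n)}$). Then $$\rho_s\circ\iota_t=\delta_{s,t}\,\mathsf 1_{\mathsf P^{(n-t)}\mathsf Q^{(m-t)}}\qquad\text{and}\qquad\mathsf 1_{\mathsf Q^{(m)}\mathsf P^{(n)}}=\sum_{s}\iota_s\circ\rho_s .$$ Consequently the following isomorphisms hold in $\mathcal H$: $$\mathsf Q^{(m)}\mathsf P^{(n)}\cong\bigoplus_{s=0}^{\min(m,n)}\mathsf P^{(n-s)}\mathsf Q^{(m-s)}\qquad\text{and}\qquad\mathsf Q^{(m)}\mathsf P^{(n)}\cong\mathsf P^{(n)}\mathsf Q^{(m)}\oplus\mathsf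 Q^{(m-1)}\mathsf P^{(n-1)}.$$
   Context: Let $k$ be a field of characteristic zero. Khovanov's Heisenberg category: $\mathcal H'$ is the additive $k$-linear monoidal category generated by two objects $Q_+,Q_-$. Its morphisms are $k$-linear combinations of oriented planar string diagrams up to isotopy rel boundary (read bottom to top; $Q_+$ is an upward strand, $Q_-$ a downward strand), generated by the crossing of two upward strands and the four oriented cups and caps (so $Q_+,Q_-$ are biadjoint), modulo: (i) the double crossing of two upward strands is the identity; (ii) the braid relation for three upward strands; (iii) the double crossing $Q_+Q_-\to Q_-Q_+\to Q_+Q_-$ is the identity; (iv) the double crossing $Q_-Q_+\to Q_+Q_-\to Q_-Q_+$ is the identity minus the composite of the cap $Q_-Q_+\to\mathsf 1$ followed by the cup $\mathsf 1\to Q_-Q_+$; (v) a counterclockwise circle equals $1$; (vi) an upward strand with a curl on its left is zero. $\mathcal H$ is the Karoubi envelope of $\mathcal H'$. Write $\mathsf P=Q_+$, $\mathsf Q=Q_-$, juxtaposition for $\otimes$, $\mathsf 1$ for the unit, and $\mathsf 1_{\mathsf X}$ for the identity of $\mathsf X$. Relations (i),(ii) give algebra maps $k[S_r]\to\mathrm{End}(\mathsf P^{\otimes r})$ and $k[S_r]\to\mathrm{End}(\mathsf Q^{\otimes r})$. $\mathsf P^{(r)},\mathsf Q^{(r)}$ are the images of the complete symmetrizer in $\mathsf P^{\otimes r},\mathsf Q^{\otimes r}$ ($\mathsf P^{(0)}=\mathsf Q^{(0)}=\mathsf 1$). *)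

theory Defs
  imports "Jordan_Normal_Form.Matrix" "HOL-Combinatorics.Permutations"
begin

section \<open>String diagrams modulo isotopy and local relations\<close>

text \<open>
  Objects of the strict monoidal category generated by \<open>Q_+\<close> and \<open>Q_-\<close> are words in the letters
  \<open>Up\<close> (an upward strand, \<open>P\<close>) and \<open>Dn\<close> (a downward strand, \<open>Q\<close>), read from left to right; the
  tensor product of objects is concatenation.

  A formal expression of type \<open>'k dgm\<close> denotes a linear combination of string diagrams, read from
  bottom to top: \<open>f \<cdot> g\<close> is \<open>f\<close> on top of \<open>g\<close>, and \<open>f \<diamond> g\<close> is \<open>f\<close> to the left of \<open>g\<close>.  The
  generators are \<open>X : PP \<rightarrow> PP\<close>, \<open>CupQP : 1 \<rightarrow> QP\<close>, \<open>CapQP : QP \<rightarrow> 1\<close>, \<open>CupPQ : 1 \<rightarrow> PQ\<close> and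
  \<open>CapPQ : PQ \<rightarrow> 1\<close>.  One symbol \<open>Zero\<close> serves as the zero of every hom-space.
\<close>

datatype sgn = Up | Dn

type_synonym word = "sgn list"

datatype 'k dgm =
    Idn word
  | X
  | CupQP | CapQP | CupPQ | CapPQ
  | Comp "'k dgm" "'k dgm"  (infixl "\<cdot>" 65)
  | Tens "'k dgm" "'k dgm"  (infixr "\<diamond>" 70)
  | Zero
  | Plus "'k dgm" "'k dgm"
  | Scale 'k "'k dgm"

inductive typed :: "word \<Rightarrow> word \<Rightarrow> 'k dgm \<Rightarrow> bool" where
  "typed V V (Idn V)"
| "typed [Up, Up] [Up, Up] X"
| "typed [] [Dn, Up] CupQP"
| "typed [Dn, Up] [] CapQP"
| "typed [] [Up, Dn] CupPQ"
| "typed [Up, Dn] [] CapPQ"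
| "typed V W g \<Longrightarrow> typed U V f \<Longrightarrow> typed U W (g \<cdot> f)"
| "typed V W f \<Longrightarrow> typed V' W' g \<Longrightarrow> typed (V @ V') (W @ W') (f \<diamond> g)"
| "typed V W Zero"
| "typed V W f \<Longrightarrow> typed V W g \<Longrightarrow> typed V W (Plus f g)"
| "typed V W f \<Longrightarrow> typed V W (Scale c f)"

text \<open>
  Sideways and downward crossings are rotations of the upward one.  \<open>dnX_r\<close> and \<open>dnX_l\<close> are the
  two half-turns of \<open>X\<close>, through nested cups on the left and caps on the right, respectively
  the other way round.
\<close>

definition rXPQ :: "'k dgm" \<comment> \<open>\<open>PQ \<rightarrow> QP\<close>\<close> where
  "rXPQ = (Idn [Dn, Up] \<diamond> CapPQ) \<cdot> (Idn [Dn] \<diamond> X \<diamond> Idn [Dn]) \<cdot> (CupQP \<diamond> Idn [Up, Dn])"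

definition rXQP :: "'k dgm" \<comment> \<open>\<open>QP \<rightarrow> PQ\<close>\<close> where
  "rXQP = (CapQP \<diamond> Idn [Up, Dn]) \<cdot> (Idn [Dn] \<diamond> X \<diamond> Idn [Dn]) \<cdot> (Idn [Dn, Up] \<diamond> CupPQ)"

definition dnX_r :: "'k dgm" where
  "dnX_r =
     (Idn [Dn, Dn] \<diamond> (CapPQ \<cdot> (Idn [Up] \<diamond> CapPQ \<diamond> Idn [Dn])))
   \<cdot> (Idn [Dn, Dn] \<diamond> X \<diamond> Idn [Dn, Dn])
   \<cdot> (((Idn [Dn] \<diamond> CupQP \<diamond> Idn [Up]) \<cdot> CupQP) \<diamond> Idn [Dn, Dn])"

definition dnX_l :: "'k dgm" where
  "dnX_l =
     ((CapQP \<cdot> (Idn [Dn] \<diamond> CapQP \<diamond> Idn [Up])) \<diamond> Idn [Dn, Dn])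
   \<cdot> (Idn [Dn, Dn] \<diamond> X \<diamond> Idn [Dn, Dn])
   \<cdot> (Idn [Dn, Dn] \<diamond> ((Idn [Up] \<diamond> CupPQ \<diamond> Idn [Dn]) \<cdot> CupPQ))"

text \<open>
  The congruence generated by the axioms of a linear strict monoidal category, planar isotopy and
  the local relations.  Isotopy rel boundary amounts to the interchange law, the four zigzag
  identities for the biadjunction, and the cyclicity of the crossing.

  Composites with non-matching ends are identified with zero, so that expressions modulo
  \<open>\<simeq>\<close> form the direct sum of all hom-spaces, with composition extended by zero.
\<close>

inductive dgm_eq :: "'k::field dgm \<Rightarrow> 'k dgm \<Rightarrow> bool" (infix "\<simeq>" 50) where
  refl: "f \<simeq> f"
| sym: "f \<simeq> g \<Longrightarrow> g \<simeq> f"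
| trans: "f \<simeq> g \<Longrightarrow> g \<simeq> h \<Longrightarrow> f \<simeq> h"
| cong_comp: "f \<simeq> f' \<Longrightarrow> g \<simeq> g' \<Longrightarrow> f \<cdot> g \<simeq> f' \<cdot> g'"
| cong_tens: "f \<simeq> f' \<Longrightarrow> g \<simeq> g' \<Longrightarrow> f \<diamond> g \<simeq> f' \<diamond> g'"
| cong_plus: "f \<simeq> f' \<Longrightarrow> g \<simeq> g' \<Longrightarrow> Plus f g \<simeq> Plus f' g'"
| cong_scale: "f \<simeq> f' \<Longrightarrow> Scale c f \<simeq> Scale c f'"
  \<comment> \<open>vector space structure\<close>
| plus_assoc: "Plus (Plus f g) h \<simeq> Plus f (Plus g h)"
| plus_comm: "Plus f g \<simeq> Plus g f"
| plus_zero: "Plus Zero f \<simeq> f"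
| plus_neg: "Plus (Scale (- 1) f) f \<simeq> Zero"
| scale_one: "Scale 1 f \<simeq> f"
| scale_scale: "Scale a (Scale b f) \<simeq> Scale (a * b) f"
| scale_plus_left: "Scale (a + b) f \<simeq> Plus (Scale a f) (Scale b f)"
| scale_plus_right: "Scale a (Plus f g) \<simeq> Plus (Scale a f) (Scale a g)"
  \<comment> \<open>bilinearity\<close>
| comp_plus_left: "Plus f g \<cdot> h \<simeq> Plus (f \<cdot> h) (g \<cdot> h)"
| comp_plus_right: "h \<cdot> Plus f g \<simeq> Plus (h \<cdot> f) (h \<cdot> g)"
| comp_scale_left: "Scale c f \<cdot> g \<simeq> Scale c (f \<cdot> g)"
| comp_scale_right: "f \<cdot> Scale c g \<simeq> Scale c (f \<cdot> g)"
| tens_plus_left: "Plus f g \<diamond> h \<simeq> Plus (f \<diamond> h) (g \<diamond> h)"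
| tens_plus_right: "h \<diamond> Plus f g \<simeq> Plus (h \<diamond> f) (h \<diamond> g)"
| tens_scale_left: "Scale c f \<diamond> g \<simeq> Scale c (f \<diamond> g)"
| tens_scale_right: "f \<diamond> Scale c g \<simeq> Scale c (f \<diamond> g)"
  \<comment> \<open>strict monoidal category\<close>
| comp_assoc: "(f \<cdot> g) \<cdot> h \<simeq> f \<cdot> (g \<cdot> h)"
| comp_id_left: "typed V W f \<Longrightarrow> Idn W \<cdot> f \<simeq> f"
| comp_id_right: "typed V W f \<Longrightarrow> f \<cdot> Idn V \<simeq> f"
| comp_mismatch: "typed U V f \<Longrightarrow> typed V' W g \<Longrightarrow> V \<noteq> V' \<Longrightarrow> g \<cdot> f \<simeq> Zero"
| tens_assoc: "(f \<diamond> g) \<diamond> h \<simeq> f \<diamond> (g \<diamond> h)"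
| tens_unit_left: "Idn [] \<diamond> f \<simeq> f"
| tens_unit_right: "f \<diamond> Idn [] \<simeq> f"
| tens_id: "Idn V \<diamond> Idn W \<simeq> Idn (V @ W)"
| interchange: "typed V W f \<Longrightarrow> typed U V g \<Longrightarrow> typed V' W' f' \<Longrightarrow> typed U' V' g' \<Longrightarrow>
    (f \<cdot> g) \<diamond> (f' \<cdot> g') \<simeq> (f \<diamond> f') \<cdot> (g \<diamond> g')"
  \<comment> \<open>isotopy\<close>
| zigzag1: "(Idn [Up] \<diamond> CapQP) \<cdot> (CupPQ \<diamond> Idn [Up]) \<simeq> Idn [Up]"
| zigzag2: "(CapPQ \<diamond> Idn [Up]) \<cdot> (Idn [Up] \<diamond> CupQP) \<simeq> Idn [Up]"
| zigzag3: "(Idn [Dn] \<diamond> CapPQ) \<cdot> (CupQP \<diamond> Idn [Dn]) \<simeq> Idn [Dn]"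
| zigzag4: "(CapQP \<diamond> Idn [Dn]) \<cdot> (Idn [Dn] \<diamond> CupPQ) \<simeq> Idn [Dn]"
| cyclic: "dnX_r \<simeq> dnX_l"
  \<comment> \<open>local relations\<close>
| double_up: "X \<cdot> X \<simeq> Idn [Up, Up]"
| braid: "(X \<diamond> Idn [Up]) \<cdot> (Idn [Up] \<diamond> X) \<cdot> (X \<diamond> Idn [Up])
        \<simeq> (Idn [Up] \<diamond> X) \<cdot> (X \<diamond> Idn [Up]) \<cdot> (Idn [Up] \<diamond> X)"
| double_PQ: "rXQP \<cdot> rXPQ \<simeq> Idn [Up, Dn]"
| double_QP: "rXPQ \<cdot> rXQP \<simeq> Plus (Idn [Dn, Up]) (Scale (- 1) (CupQP \<cdot> CapQP))"
| circle: "CapQP \<cdot> CupQP \<simeq> Idn []"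
| left_curl: "(CapQP \<diamond> Idn [Up]) \<cdot> (Idn [Dn] \<diamond> X) \<cdot> (CupQP \<diamond> Idn [Up]) \<simeq> Zero"

quotient_type (overloaded) 'k mor = "'k::field dgm" / "dgm_eq"
  by (rule equivpI) (auto intro!: reflpI sympI transpI intro: dgm_eq.refl dgm_eq.sym dgm_eq.trans)

definition Mor :: "word \<Rightarrow> word \<Rightarrow> 'k::field mor set" where
  "Mor V W = abs_mor ` {f. typed V W f}"

text \<open>The product \<open>f * g\<close> of morphisms is the composite, with \<open>g\<close> applied first.\<close>

instantiation mor :: (field) ring
begin

lift_definition zero_mor :: "'a mor" is Zero .
lift_definition plus_mor :: "'a mor \<Rightarrow> 'a mor \<Rightarrow> 'a mor" is Plus by (rule dgm_eq.cong_plus)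
lift_definition uminus_mor :: "'a mor \<Rightarrow> 'a mor" is "Scale (- 1)" by (rule dgm_eq.cong_scale)
lift_definition minus_mor :: "'a mor \<Rightarrow> 'a mor \<Rightarrow> 'a mor" is "\<lambda>f g. Plus f (Scale (- 1) g)"
  by (intro dgm_eq.cong_plus dgm_eq.cong_scale)
lift_definition times_mor :: "'a mor \<Rightarrow> 'a mor \<Rightarrow> 'a mor" is Comp by (rule dgm_eq.cong_comp)

instance
proof
  fix a b c :: "'a mor"
  show "a + b + c = a + (b + c)" by transfer (rule dgm_eq.plus_assoc)
  show "a + b = b + a" by transfer (rule dgm_eq.plus_comm)
  show "0 + a = a" by transfer (rule dgm_eq.plus_zero)
  show "- a + a = 0" by transfer (rule dgm_eq.plus_neg)
  show "a - b = a + - b" by transfer (rule dgm_eq.refl)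
  show "a * b * c = a * (b * c)" by transfer (rule dgm_eq.comp_assoc)
  show "(a + b) * c = a * c + b * c" by transfer (rule dgm_eq.comp_plus_left)
  show "a * (b + c) = a * b + a * c" by transfer (rule dgm_eq.comp_plus_right)
qed

end

lift_definition idm :: "word \<Rightarrow> 'k::field mor" is Idn .
lift_definition tens :: "'k::field mor \<Rightarrow> 'k mor \<Rightarrow> 'k mor" (infixr "\<boxtimes>" 75) is Tens
  by (rule dgm_eq.cong_tens)
lift_definition scl :: "'k::field \<Rightarrow> 'k mor \<Rightarrow> 'k mor" is Scale by (rule dgm_eq.cong_scale)
lift_definition upX :: "'k::field mor" is X .
lift_definition cupQP :: "'k::field mor" is CupQP .
lift_definition capQP :: "'k::field mor" is CapQP .
lift_definition XPQ :: "'k::field mor" is rXPQ .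
lift_definition XQP :: "'k::field mor" is rXQP .
lift_definition dnX :: "'k::field mor" is dnX_r .


section \<open>Additive envelope\<close>

text \<open>
  An object of \<open>H'\<close> is a list of words (their formal direct sum); a morphism is a matrix of
  morphisms whose \<open>(i, j)\<close> entry goes from the \<open>j\<close>-th summand of the source to the \<open>i\<close>-th
  summand of the target.  Composition is matrix multiplication.
\<close>

definition AMor :: "word list \<Rightarrow> word list \<Rightarrow> 'k::field mor mat set" where
  "AMor Vs Ws = {f \<in> carrier_mat (length Ws) (length Vs).
     \<forall>i < length Ws. \<forall>j < length Vs. f $$ (i, j) \<in> Mor (Vs ! j) (Ws ! i)}"

definition atens :: "word list \<Rightarrow> word list \<Rightarrow> word list" where
  "atens Vs Ws = concat (map (\<lambda>V. map (\<lambda>W. V @ W) Ws) Vs)"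

definition kron :: "'k::field mor mat \<Rightarrow> 'k mor mat \<Rightarrow> 'k mor mat" where
  "kron f g = mat (dim_row f * dim_row g) (dim_col f * dim_col g)
     (\<lambda>(i, j). f $$ (i div dim_row g, j div dim_col g) \<boxtimes> g $$ (i mod dim_row g, j mod dim_col g))"

abbreviation single :: "'k::field mor \<Rightarrow> 'k mor mat" where
  "single f \<equiv> mat 1 1 (\<lambda>_. f)"


section \<open>Karoubi envelope\<close>

text \<open>
  An object is a pair \<open>(Vs, e)\<close> with \<open>e\<close> an idempotent endomorphism of \<open>Vs\<close>.  The identity of
  \<open>(Vs, e)\<close>, the inclusion \<open>(Vs, e) \<rightarrow> Vs\<close> and the projection \<open>Vs \<rightarrow> (Vs, e)\<close> are all given by
  the matrix \<open>e\<close>.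
\<close>

type_synonym 'k hobj = "word list \<times> 'k mor mat"

definition HOb :: "'k::field hobj set" where
  "HOb = {(Vs, e). e \<in> AMor Vs Vs \<and> e * e = e}"

definition HMor :: "'k::field hobj \<Rightarrow> 'k hobj \<Rightarrow> 'k mor mat set" where
  "HMor A B = {f \<in> AMor (fst A) (fst B). snd B * f * snd A = f}"

abbreviation hid :: "'k::field hobj \<Rightarrow> 'k mor mat" where
  "hid A \<equiv> snd A"

definition hzero :: "'k::field hobj \<Rightarrow> 'k hobj \<Rightarrow> 'k mor mat" where
  "hzero A B = 0\<^sub>m (length (fst B)) (length (fst A))"

definition hsum :: "'k::field hobj \<Rightarrow> 'k hobj \<Rightarrow> 'i set \<Rightarrow> ('i \<Rightarrow> 'k mor mat) \<Rightarrow> 'k mor mat" where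
  "hsum A B S f = mat (length (fst B)) (length (fst A)) (\<lambda>ij. \<Sum>s\<in>S. f s $$ ij)"

definition htens :: "'k::field hobj \<Rightarrow> 'k hobj \<Rightarrow> 'k hobj" (infixr "\<otimes>\<^sub>H" 75) where
  "A \<otimes>\<^sub>H B = (atens (fst A) (fst B), kron (snd A) (snd B))"

definition hdsum :: "'k::field hobj list \<Rightarrow> 'k hobj" where
  "hdsum As = (concat (map fst As), diag_block_mat (map snd As))"

definition hiso :: "'k::field hobj \<Rightarrow> 'k hobj \<Rightarrow> bool" (infix "\<cong>\<^sub>H" 50) where
  "A \<cong>\<^sub>H B \<longleftrightarrow> A \<in> HOb \<and> B \<in> HOb \<and>
     (\<exists>f \<in> HMor A B. \<exists>g \<in> HMor B A. g * f = hid A \<and> f * g = hid B)"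


section \<open>Symmetrizers\<close>

abbreviation Ups :: "nat \<Rightarrow> word" where "Ups r \<equiv> replicate r Up"
abbreviation Dns :: "nat \<Rightarrow> word" where "Dns r \<equiv> replicate r Dn"

text \<open>
  The algebra maps \<open>k[S_r] \<rightarrow> End (P^r)\<close> and \<open>k[S_r] \<rightarrow> End (Q^r)\<close> send the simple transposition
  \<open>(i i+1)\<close> to the crossing of strands \<open>i\<close> and \<open>i+1\<close>.  A permutation \<open>w\<close> is therefore sent to the
  composite of crossings along any expression of \<open>w\<close> as a product of simple transpositions; by
  \<open>double_up\<close> and \<open>braid\<close> this does not depend on the expression.
\<close>

definition word_perm :: "nat list \<Rightarrow> nat \<Rightarrow> nat" where
  "word_perm is = foldr (\<lambda>i p. transpose i (Suc i) \<circ> p) is id"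

definition perm_word :: "nat \<Rightarrow> (nat \<Rightarrow> nat) \<Rightarrow> nat list" where
  "perm_word r w = (SOME is. (\<forall>i \<in> set is. Suc i < r) \<and> word_perm is = w)"

definition crossP :: "nat \<Rightarrow> nat \<Rightarrow> 'k::field mor" where
  "crossP r i = idm (Ups i) \<boxtimes> upX \<boxtimes> idm (Ups (r - i - 2))"

definition crossQ :: "nat \<Rightarrow> nat \<Rightarrow> 'k::field mor" where
  "crossQ r i = idm (Dns i) \<boxtimes> dnX \<boxtimes> idm (Dns (r - i - 2))"

definition permP :: "nat \<Rightarrow> (nat \<Rightarrow> nat) \<Rightarrow> 'k::field mor" where
  "permP r w = foldr (\<lambda>i f. crossP r i * f) (perm_word r w) (idm (Ups r))"

definition permQ :: "nat \<Rightarrow> (nat \<Rightarrow> nat) \<Rightarrow> 'k::field mor" where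
  "permQ r w = foldr (\<lambda>i f. crossQ r i * f) (perm_word r w) (idm (Dns r))"

definition symP :: "nat \<Rightarrow> 'k::field_char_0 mor" where
  "symP r = scl (1 / of_nat (fact r)) (\<Sum>w | w permutes {..<r}. permP r w)"

definition symQ :: "nat \<Rightarrow> 'k::field_char_0 mor" where
  "symQ r = scl (1 / of_nat (fact r)) (\<Sum>w | w permutes {..<r}. permQ r w)"

definition PP :: "nat \<Rightarrow> 'k::field_char_0 hobj" where
  "PP r = ([Ups r], single (symP r))"

definition QQ :: "nat \<Rightarrow> 'k::field_char_0 hobj" where
  "QQ r = ([Dns r], single (symQ r))"


section \<open>The morphisms \<open>rho\<close> and \<open>iota\<close>\<close>

text \<open>Nested caps \<open>Q^s P^s \<rightarrow> 1\<close> and cups \<open>1 \<rightarrow> Q^s P^s\<close>.\<close>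

primrec caps :: "nat \<Rightarrow> 'k::field mor" where
  "caps 0 = idm []"
| "caps (Suc s) = caps s * (idm (Dns s) \<boxtimes> capQP \<boxtimes> idm (Ups s))"

primrec cups :: "nat \<Rightarrow> 'k::field mor" where
  "cups 0 = idm []"
| "cups (Suc s) = (idm (Dns s) \<boxtimes> cupQP \<boxtimes> idm (Ups s)) * cups s"

text \<open>
  All \<open>a\<close> downward strands cross all \<open>b\<close> upward strands: \<open>XQ1P b : Q P^b \<rightarrow> P^b Q\<close>,
  \<open>XQsPs a b : Q^a P^b \<rightarrow> P^b Q^a\<close>, and their vertical reflections
  \<open>XPQ1 b : P^b Q \<rightarrow> Q P^b\<close>, \<open>XPsQs b a : P^b Q^a \<rightarrow> Q^a P^b\<close>.
\<close>

primrec XQ1P :: "nat \<Rightarrow> 'k::field mor" where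
  "XQ1P 0 = idm [Dn]"
| "XQ1P (Suc b) = (idm (Ups b) \<boxtimes> XQP) * (XQ1P b \<boxtimes> idm [Up])"

primrec XQsPs :: "nat \<Rightarrow> nat \<Rightarrow> 'k::field mor" where
  "XQsPs 0 b = idm (Ups b)"
| "XQsPs (Suc a) b = (XQsPs a b \<boxtimes> idm [Dn]) * (idm (Dns a) \<boxtimes> XQ1P b)"

primrec XPQ1 :: "nat \<Rightarrow> 'k::field mor" where
  "XPQ1 0 = idm [Dn]"
| "XPQ1 (Suc b) = (XPQ1 b \<boxtimes> idm [Up]) * (idm (Ups b) \<boxtimes> XPQ)"

primrec XPsQs :: "nat \<Rightarrow> nat \<Rightarrow> 'k::field mor" where
  "XPsQs b 0 = idm (Ups b)"
| "XPsQs b (Suc a) = (idm (Dns a) \<boxtimes> XPQ1 b) * (XPsQs b a \<boxtimes> idm [Dn])"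

definition rho :: "nat \<Rightarrow> nat \<Rightarrow> nat \<Rightarrow> 'k::field_char_0 mor mat" where
  "rho m n s =
     snd (PP (n - s) \<otimes>\<^sub>H QQ (m - s))
   * single (XQsPs (m - s) (n - s) * (idm (Dns (m - s)) \<boxtimes> caps s \<boxtimes> idm (Ups (n - s))))
   * snd (QQ m \<otimes>\<^sub>H PP n)"

definition iota :: "nat \<Rightarrow> nat \<Rightarrow> nat \<Rightarrow> 'k::field_char_0 mor mat" where
  "iota m n s = map_mat (scl (of_nat ((n choose s) * (m choose s) * fact s)))
    (snd (QQ m \<otimes>\<^sub>H PP n)
   * single ((idm (Dns (m - s)) \<boxtimes> cups s \<boxtimes> idm (Ups (n - s))) * XPsQs (n - s) (m - s))
   * snd (PP (n - s) \<otimes>\<^sub>H QQ (m - s)))"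

end

theory Submission
  imports Defs
begin

text \<open>
  Everything is expressed through the thick cap \<open>c : Q^(m+1) P^(n+1) \<rightarrow> Q^(m) P^(n)\<close>,
  its reflection \<open>d\<close>, and the thick crossings \<open>x : Q^(m) P^(n) \<rightarrow> P^(n) Q^(m)\<close> and \<open>y\<close> back, because
  \<open>s\<close> nested caps between symmetrizers are \<open>s\<close> successive thick caps.  One has \<open>x y = 1\<close>,
  \<open>c y = 0\<close> and \<open>x d = 0\<close>.  Writing a symmetrizer on \<open>r + 1\<close> strands through two symmetrizers on
  \<open>r\<close> strands and one crossing, and removing curls, gives \<open>(m+1)(n+1) c d = 1 + m n d c\<close>, so that
  \<open>c d^(s+1) y\<close> is a known multiple of \<open>d^s y\<close>; this is orthonormality of \<open>\<rho>\<close> and \<open>\<iota>\<close>.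
  For completeness, \<open>1 - y x\<close> factors through \<open>d\<close> on the left, while the idempotent
  \<open>Z = 1 - \<Sum> \<iota> \<rho>\<close> kills \<open>y\<close> and, by induction on \<open>m\<close> and \<open>n\<close>, also \<open>d\<close>; hence \<open>Z = 0\<close>.
\<close>

section \<open>Calculus of morphisms\<close>

text \<open>The relation between c and d comes from the two joined ends: the downward symmetrizer is
  expanded at its last crossing, the upward one at its first. Of the four products, the one without
  crossings closes to a circle, each one with a single crossing contains a curl and vanishes, and
  the one with both crossings unwinds to d c. Together with c y = 0 this gives c d^(s+1) y = a_s d^s
  y with (m+s+1)(n+s+1) a_s = s + 1, and a_0 ... a_(s-1) is the inverse of the normalizing factor of
  iota_s. Two facts must be prepared. The local relations give the square and braid relations for
  upward crossings only, while the symmetrizer on Q needs them for downward ones; these are obtained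
  by bending strands. And a permutation acts through a chosen word, so independence of that word
  needs the Coxeter relations to present the symmetric group. The second isomorphism needs no new
  diagrams: summand s of Q^(m-1) P^(n-1) is summand s + 1 of Q^(m) P^(n).\<close>

lemma MorE:
  assumes "f \<in> Mor V W"
  obtains a where "typed V W a" "f = abs_mor a"
  using assms unfolding Mor_def by auto

lemma MorI: "typed V W a \<Longrightarrow> abs_mor a \<in> Mor V W"
  unfolding Mor_def by auto

lemma Mor_idm: "idm V \<in> Mor V V"
  unfolding idm_def by (simp add: MorI typed.intros)

lemma Mor_upX: "upX \<in> Mor [Up, Up] [Up, Up]"
  unfolding upX_def by (simp add: MorI typed.intros)

lemma Mor_cupQP: "cupQP \<in> Mor [] [Dn, Up]"
  unfolding cupQP_def by (simp add: MorI typed.intros)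

lemma Mor_capQP: "capQP \<in> Mor [Dn, Up] []"
  unfolding capQP_def by (simp add: MorI typed.intros)

lift_definition cupPQ :: "'k::field mor" is CupPQ .
lift_definition capPQ :: "'k::field mor" is CapPQ .

lemma Mor_cupPQ: "cupPQ \<in> Mor [] [Up, Dn]"
  unfolding cupPQ_def by (simp add: MorI typed.intros)

lemma Mor_capPQ: "capPQ \<in> Mor [Up, Dn] []"
  unfolding capPQ_def by (simp add: MorI typed.intros)

lemma Mor_comp: "f \<in> Mor V W \<Longrightarrow> g \<in> Mor U V \<Longrightarrow> f * g \<in> Mor U W"
  by (elim MorE) (auto simp: times_mor.abs_eq intro!: MorI typed.intros)

lemma Mor_tens: "f \<in> Mor V W \<Longrightarrow> g \<in> Mor V' W' \<Longrightarrow> f \<boxtimes> g \<in> Mor (V @ V') (W @ W')"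
  by (elim MorE) (auto simp: tens.abs_eq intro!: MorI typed.intros)

lemma Mor_zero: "0 \<in> Mor V W"
  unfolding zero_mor_def by (simp add: MorI typed.intros)

lemma Mor_plus: "f \<in> Mor V W \<Longrightarrow> g \<in> Mor V W \<Longrightarrow> f + g \<in> Mor V W"
  by (elim MorE) (auto simp: plus_mor.abs_eq intro!: MorI typed.intros)

lemma Mor_scl: "f \<in> Mor V W \<Longrightarrow> scl c f \<in> Mor V W"
  by (elim MorE) (auto simp: scl.abs_eq intro!: MorI typed.intros)

lemma Mor_sum: "(\<And>i. i \<in> I \<Longrightarrow> f i \<in> Mor V W) \<Longrightarrow> sum f I \<in> Mor V W"
  by (induction I rule: infinite_finite_induct) (auto simp: Mor_zero Mor_plus)

lemma uminus_mor_scl: "- f = scl (- 1) f" for f :: "'k::field mor"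
  by transfer (rule dgm_eq.refl)

lemma scl_one [simp]: "scl 1 f = f"
  by transfer (rule dgm_eq.scale_one)

lemma scl_scl [simp]: "scl a (scl b f) = scl (a * b) f"
  by transfer (rule dgm_eq.scale_scale)

lemma scl_add_left: "scl (a + b) f = scl a f + scl b f"
  by transfer (rule dgm_eq.scale_plus_left)

lemma scl_add_right: "scl a (f + g) = scl a f + scl a g"
  by transfer (rule dgm_eq.scale_plus_right)

lemma scl_zero_right [simp]: "scl a 0 = 0"
  using scl_add_right[of a 0 0] by simp

lemma scl_zero_left [simp]: "scl 0 f = 0"
  using scl_add_left[of 0 0 f] by simp

lemma scl_comp_left [simp]: "scl c f * g = scl c (f * g)"
  by transfer (rule dgm_eq.comp_scale_left)

lemma scl_comp_right [simp]: "f * scl c g = scl c (f * g)"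
  by transfer (rule dgm_eq.comp_scale_right)

lemma tens_add_left: "(f + g) \<boxtimes> h = f \<boxtimes> h + g \<boxtimes> h"
  by transfer (rule dgm_eq.tens_plus_left)

lemma tens_add_right: "h \<boxtimes> (f + g) = h \<boxtimes> f + h \<boxtimes> g"
  by transfer (rule dgm_eq.tens_plus_right)

lemma tens_scl_left [simp]: "scl c f \<boxtimes> g = scl c (f \<boxtimes> g)"
  by transfer (rule dgm_eq.tens_scale_left)

lemma tens_scl_right [simp]: "f \<boxtimes> scl c g = scl c (f \<boxtimes> g)"
  by transfer (rule dgm_eq.tens_scale_right)

lemma tens_zero_left [simp]: "0 \<boxtimes> f = 0"
  using tens_add_left[of 0 0 f] by simp

lemma tens_zero_right [simp]: "f \<boxtimes> 0 = 0"
  using tens_add_right[of f 0 0] by simp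

lemma tens_sum_left: "sum f I \<boxtimes> g = (\<Sum>i\<in>I. f i \<boxtimes> g)"
  by (induction I rule: infinite_finite_induct) (auto simp: tens_add_left)

lemma tens_sum_right: "g \<boxtimes> sum f I = (\<Sum>i\<in>I. g \<boxtimes> f i)"
  by (induction I rule: infinite_finite_induct) (auto simp: tens_add_right)

lemma tens_assoc [simp]: "(f \<boxtimes> g) \<boxtimes> h = f \<boxtimes> g \<boxtimes> h"
  by transfer (rule dgm_eq.tens_assoc)

lemma tens_unit_left [simp]: "idm [] \<boxtimes> f = f"
  by transfer (rule dgm_eq.tens_unit_left)

lemma tens_unit_right [simp]: "f \<boxtimes> idm [] = f"
  by transfer (rule dgm_eq.tens_unit_right)

lemma tens_idm [simp]: "idm V \<boxtimes> idm W = idm (V @ W)"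
  by transfer (rule dgm_eq.tens_id)

lemma tens_idm_assoc [simp]: "idm V \<boxtimes> idm W \<boxtimes> f = idm (V @ W) \<boxtimes> f"
  by (metis tens_assoc tens_idm)

lemma comp_idm_left: "f \<in> Mor V W \<Longrightarrow> idm W * f = f"
  by (elim MorE) (auto simp: times_mor.abs_eq idm.abs_eq mor.abs_eq_iff intro: dgm_eq.comp_id_left)

lemma comp_idm_right: "f \<in> Mor V W \<Longrightarrow> f * idm V = f"
  by (elim MorE) (auto simp: times_mor.abs_eq idm.abs_eq mor.abs_eq_iff intro: dgm_eq.comp_id_right)

lemma comp_mor_mismatch: "f \<in> Mor U V \<Longrightarrow> g \<in> Mor V' W \<Longrightarrow> V \<noteq> V' \<Longrightarrow> g * f = 0"
  by (elim MorE)
    (auto simp: times_mor.abs_eq zero_mor.abs_eq mor.abs_eq_iff intro: dgm_eq.comp_mismatch)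

lemma interchange_mor:
  assumes "f \<in> Mor V W" "g \<in> Mor U V" "f' \<in> Mor V' W'" "g' \<in> Mor U' V'"
  shows "(f * g) \<boxtimes> (f' * g') = (f \<boxtimes> f') * (g \<boxtimes> g')"
  using assms by (elim MorE)
    (auto simp: times_mor.abs_eq tens.abs_eq mor.abs_eq_iff intro: dgm_eq.interchange)

lemma idm_comp [simp]: "idm V * idm V = idm V"
  by (rule comp_idm_left[OF Mor_idm])

text \<open>Composites with non-matching ends vanish, so every morphism is a sum of homogeneous ones.  Hence
  whiskering by an identity is multiplicative without any typing assumption.\<close>

inductive_set homsums :: "'k::field mor set" where
  zero: "0 \<in> homsums"
| add: "f \<in> Mor V W \<Longrightarrow> g \<in> homsums \<Longrightarrow> f + g \<in> homsums"

lemma homsums_Mor: "f \<in> Mor V W \<Longrightarrow> f \<in> homsums"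
  using homsums.add[OF _ homsums.zero] by force

lemma homsums_add: "f \<in> homsums \<Longrightarrow> g \<in> homsums \<Longrightarrow> f + g \<in> homsums"
  by (induction rule: homsums.induct) (auto simp: add.assoc intro: homsums.intros)

lemma homsums_map:
  assumes "f \<in> homsums" "h 0 = 0" "\<And>f g. h (f + g) = h f + h g"
    and "\<And>V W f. f \<in> Mor V W \<Longrightarrow> h f \<in> homsums"
  shows "h f \<in> homsums"
  using assms(1) by induction (auto simp: assms homsums.zero homsums_add)

lemma homsums_scl: "f \<in> homsums \<Longrightarrow> scl c f \<in> homsums"
  by (rule homsums_map[where h = "scl c"]) (auto simp: scl_add_right intro: homsums_Mor Mor_scl)

lemma homsums_tens:
  assumes "f \<in> homsums" "g \<in> homsums"
  shows "f \<boxtimes> g \<in> homsums"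
proof -
  have "f \<boxtimes> g \<in> homsums" if "f \<in> Mor V W" for f :: "'a mor" and V W
    by (rule homsums_map[where h = "\<lambda>g. f \<boxtimes> g"])
      (auto simp: tens_add_right assms intro: homsums_Mor[OF Mor_tens[OF that]])
  from assms(1) _ _ this show ?thesis
    by (rule homsums_map[where h = "\<lambda>f. f \<boxtimes> g"]) (auto simp: tens_add_left)
qed

lemma homsums_comp:
  assumes "f \<in> homsums" "g \<in> homsums"
  shows "f * g \<in> homsums"
proof -
  have "f * g \<in> homsums" if f: "f \<in> Mor V W" for f :: "'a mor" and V W
  proof (rule homsums_map[where h = "\<lambda>g. f * g"])
    fix V' W' and g :: "'a mor" assume "g \<in> Mor V' W'"
    with f show "f * g \<in> homsums"
      by (cases "W' = V") (auto simp: comp_mor_mismatch homsums.zero intro: homsums_Mor[OF Mor_comp])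
  qed (auto simp: distrib_left assms)
  from assms(1) _ _ this show ?thesis
    by (rule homsums_map[where h = "\<lambda>f. f * g"]) (auto simp: distrib_right)
qed

lemma mor_homsums: "f \<in> homsums"
proof -
  have "abs_mor a \<in> homsums" for a :: "'a dgm"
    by (induction a)
      (auto simp: plus_mor.abs_eq[symmetric] times_mor.abs_eq[symmetric] tens.abs_eq[symmetric]
          scl.abs_eq[symmetric] zero_mor.abs_eq[symmetric] homsums.zero
        intro: homsums_add homsums_comp homsums_tens homsums_scl homsums_Mor MorI typed.intros)
  then show ?thesis by (metis Quotient3_abs_rep Quotient3_mor)
qed

lemma additive_eqI:
  assumes "\<And>f g. h (f + g) = h f + h g" "\<And>f g. k (f + g) = k f + k g"
    and "\<And>V W f. f \<in> Mor V W \<Longrightarrow> h f = k f"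
  shows "h f = (k f :: 'k::field mor)"
  using mor_homsums[of f]
proof induction
  case zero
  then show ?case using Mor_zero assms(3) by blast
qed (use assms in auto)

lemma tens_comp_idm_left: "idm U \<boxtimes> (f * g) = (idm U \<boxtimes> f) * (idm U \<boxtimes> g)"
proof (rule additive_eqI[where h = "\<lambda>f. idm U \<boxtimes> (f * g)" and k = "\<lambda>f. (idm U \<boxtimes> f) * (idm U \<boxtimes> g)"])
  fix V W and f :: "'a mor" assume f: "f \<in> Mor V W"
  show "idm U \<boxtimes> (f * g) = (idm U \<boxtimes> f) * (idm U \<boxtimes> g)"
  proof (rule additive_eqI[where h = "\<lambda>g. idm U \<boxtimes> (f * g)" and k = "\<lambda>g. (idm U \<boxtimes> f) * (idm U \<boxtimes> g)"])
    fix V' W' and g :: "'a mor" assume g: "g \<in> Mor V' W'"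
    show "idm U \<boxtimes> (f * g) = (idm U \<boxtimes> f) * (idm U \<boxtimes> g)"
    proof (cases "W' = V")
      case True
      with g have "g \<in> Mor V' V" by simp
      from interchange_mor[OF Mor_idm Mor_idm f this] show ?thesis by simp
    next
      case False
      \<comment> \<open>Adding the same strands to both ends preserves a mismatch, so both sides
        vanish.\<close>
      then have "U @ W' \<noteq> U @ V" by simp
      then show ?thesis
        using comp_mor_mismatch[OF Mor_tens[OF Mor_idm g] Mor_tens[OF Mor_idm f]] False
        by (simp add: comp_mor_mismatch[OF g f])
    qed
  qed (auto simp: distrib_left tens_add_right)
qed (auto simp: distrib_right tens_add_right)

lemma tens_comp_idm_right: "(f * g) \<boxtimes> idm U = (f \<boxtimes> idm U) * (g \<boxtimes> idm U)"
proof (rule additive_eqI[where h = "\<lambda>f. (f * g) \<boxtimes> idm U" and k = "\<lambda>f. (f \<boxtimes> idm U) * (g \<boxtimes> idm U)"])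
  fix V W and f :: "'a mor" assume f: "f \<in> Mor V W"
  show "(f * g) \<boxtimes> idm U = (f \<boxtimes> idm U) * (g \<boxtimes> idm U)"
  proof (rule additive_eqI[where h = "\<lambda>g. (f * g) \<boxtimes> idm U" and k = "\<lambda>g. (f \<boxtimes> idm U) * (g \<boxtimes> idm U)"])
    fix V' W' and g :: "'a mor" assume g: "g \<in> Mor V' W'"
    show "(f * g) \<boxtimes> idm U = (f \<boxtimes> idm U) * (g \<boxtimes> idm U)"
    proof (cases "W' = V")
      case True
      with g have "g \<in> Mor V' V" by simp
      from interchange_mor[OF f this Mor_idm Mor_idm] show ?thesis by simp
    next
      case False
      then have "W' @ U \<noteq> V @ U" by simp
      then show ?thesis
        using comp_mor_mismatch[OF Mor_tens[OF g Mor_idm] Mor_tens[OF f Mor_idm]] False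
        by (simp add: comp_mor_mismatch[OF g f])
    qed
  qed (auto simp: distrib_left tens_add_left)
qed (auto simp: distrib_right tens_add_left)

text \<open>One layer of a string diagram: a piece with identity strands on both sides. Diagrams
  become products of layers, and since \<open>wh_comp\<close> has no typing assumption they can be
  manipulated as words in a semigroup.\<close>

definition wh :: "word \<Rightarrow> 'k::field mor \<Rightarrow> word \<Rightarrow> 'k mor" where
  "wh V f W = idm V \<boxtimes> f \<boxtimes> idm W"

lemma wh_comp: "wh V (f * g) W = wh V f W * wh V g W"
  by (simp add: wh_def tens_comp_idm_left tens_comp_idm_right)

lemma wh_wh [simp]: "wh V (wh V' f W') W = wh (V @ V') f (W' @ W)"
  by (simp add: wh_def)

lemma wh_idm [simp]: "wh V (idm U) W = idm (V @ U @ W)"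
  by (simp add: wh_def)

lemma wh_zero [simp]: "wh V 0 W = 0"
  by (simp add: wh_def)

lemma wh_Nil [simp]: "wh [] f [] = f"
  by (simp add: wh_def)

lemma wh_add: "wh V (f + g) W = wh V f W + wh V g W"
  by (simp add: wh_def tens_add_left tens_add_right)

lemma wh_uminus: "wh V (- f) W = - wh V f W"
  by (simp add: wh_def uminus_mor_scl)

lemma wh_diff: "wh V (f - g) W = wh V f W - wh V g W"
  using wh_add[of V f "- g" W] by (simp add: wh_uminus)

lemma wh_scl [simp]: "wh V (scl c f) W = scl c (wh V f W)"
  by (simp add: wh_def)

lemma wh_sum: "wh V (sum f I) W = (\<Sum>i\<in>I. wh V (f i) W)"
  by (simp add: wh_def tens_sum_left tens_sum_right)

lemma Mor_wh: "f \<in> Mor A B \<Longrightarrow> wh V f W \<in> Mor (V @ A @ W) (V @ B @ W)"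
  unfolding wh_def by (intro Mor_tens Mor_idm)

lemma Mor_cast: "f \<in> Mor A B \<Longrightarrow> A = A' \<Longrightarrow> B = B' \<Longrightarrow> f \<in> Mor A' B'"
  by simp

lemma Mor_comp': "f \<in> Mor V W \<Longrightarrow> g \<in> Mor U V' \<Longrightarrow> V = V' \<Longrightarrow> f * g \<in> Mor U W"
  by (auto intro: Mor_comp)

lemma tens_eq_comp:
  assumes "f \<in> Mor A B" "g \<in> Mor C D"
  shows "f \<boxtimes> g = wh [] f D * wh A g []" "f \<boxtimes> g = wh B g [] * wh [] f C"
  using interchange_mor[OF assms(1) Mor_idm Mor_idm assms(2)]
    interchange_mor[OF Mor_idm assms(1) assms(2) Mor_idm] assms
  by (simp_all add: wh_def comp_idm_left comp_idm_right)

text \<open>Height exchange of two disjoint pieces separated by the strands \<open>M\<close>. Both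
  sides are the tensor product of \<open>f\<close>, the identity of \<open>M\<close>, and
  \<open>g\<close>, with \<open>V\<close> and \<open>W\<close> around it.\<close>

lemma wh_exchange:
  assumes "f \<in> Mor A B" "g \<in> Mor C D"
  shows "wh V f (M @ D @ W) * wh (V @ A @ M) g W = wh (V @ B @ M) g W * wh V f (M @ C @ W)"
proof -
  have "wh [] f (M @ D) * wh (A @ M) g [] = wh (B @ M) g [] * wh [] f (M @ C)"
    using tens_eq_comp[OF assms(1) Mor_tens[OF Mor_idm[of M] assms(2)]] by (simp add: wh_def)
  from arg_cong[where f = "\<lambda>h. wh V h W", OF this] show ?thesis
    by (simp add: wh_comp)
qed

section \<open>Relations between few strands\<close>

lemma XPQ_wh: "XPQ = wh [Dn, Up] capPQ [] * wh [Dn] upX [Dn] * wh [] cupQP [Up, Dn]"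
  unfolding wh_def tens_unit_left tens_unit_right
  by transfer (simp add: rXPQ_def dgm_eq.refl)

lemma XQP_wh: "XQP = wh [] capQP [Up, Dn] * wh [Dn] upX [Dn] * wh [Dn, Up] cupPQ []"
  unfolding wh_def tens_unit_left tens_unit_right
  by transfer (simp add: rXQP_def dgm_eq.refl)

lemma dnX_wh: "dnX = wh [Dn, Dn] (capPQ * wh [Up] capPQ [Dn]) [] * wh [Dn, Dn] upX [Dn, Dn]
    * wh [] (wh [Dn] cupQP [Up] * cupQP) [Dn, Dn]"
  unfolding wh_def tens_unit_left tens_unit_right
  by transfer (simp add: dnX_r_def dgm_eq.refl)

text \<open>Cyclicity of the crossing enters the calculus here. Reflection exchanges the two
  half-turns, so having both expressions for \<open>dnX\<close> is what makes it invariant under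
  reflection.\<close>

lemma dnX_wh': "dnX = wh [] (capQP * wh [Dn] capQP [Up]) [Dn, Dn] * wh [Dn, Dn] upX [Dn, Dn]
    * wh [Dn, Dn] (wh [Up] cupPQ [Dn] * cupPQ) []"
  unfolding wh_def tens_unit_left tens_unit_right
  by transfer (rule dgm_eq.trans[OF dgm_eq.cyclic], simp add: dnX_l_def dgm_eq.refl)

lemma Mor_XPQ: "XPQ \<in> Mor [Up, Dn] [Dn, Up]"
  unfolding XPQ_wh by (rule Mor_cast, (rule Mor_comp' Mor_wh Mor_capPQ Mor_upX Mor_cupQP | (simp; fail))+)

lemma Mor_XQP: "XQP \<in> Mor [Dn, Up] [Up, Dn]"
  unfolding XQP_wh by (rule Mor_cast, (rule Mor_comp' Mor_wh Mor_capQP Mor_upX Mor_cupPQ | (simp; fail))+)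

lemma Mor_dnX: "dnX \<in> Mor [Dn, Dn] [Dn, Dn]"
  unfolding dnX_wh by (rule Mor_cast, (rule Mor_comp' Mor_wh Mor_capPQ Mor_upX Mor_cupQP | (simp; fail))+)

lemmas Mor_gens = Mor_upX Mor_cupQP Mor_capQP Mor_cupPQ Mor_capPQ Mor_XPQ Mor_XQP Mor_dnX

lemma zigzags:
  "wh [Up] capQP [] * wh [] cupPQ [Up] = idm [Up]"
  "wh [] capPQ [Up] * wh [Up] cupQP [] = idm [Up]"
  "wh [Dn] capPQ [] * wh [] cupQP [Dn] = idm [Dn]"
  "wh [] capQP [Dn] * wh [Dn] cupPQ [] = idm [Dn]"
  unfolding wh_def tens_unit_left tens_unit_right
  by (transfer, rule dgm_eq.zigzag1 dgm_eq.zigzag2 dgm_eq.zigzag3 dgm_eq.zigzag4)+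

lemma upX_upX: "upX * upX = idm [Up, Up]"
  by transfer (rule dgm_eq.double_up)

lemma upX_braid: "wh [] upX [Up] * wh [Up] upX [] * wh [] upX [Up]
    = wh [Up] upX [] * wh [] upX [Up] * wh [Up] upX []"
  unfolding wh_def tens_unit_left tens_unit_right
  by transfer (rule dgm_eq.braid)

lemma XQP_XPQ: "XQP * XPQ = idm [Up, Dn]"
  by transfer (rule dgm_eq.double_PQ)

lemma XPQ_XQP: "XPQ * XQP = idm [Dn, Up] - cupQP * capQP"
  by transfer (rule dgm_eq.double_QP)

lemma capQP_cupQP: "capQP * cupQP = idm []"
  by transfer (rule dgm_eq.circle)

lemma left_curl_mor: "wh [] capQP [Up] * wh [Dn] upX [] * wh [] cupQP [Up] = 0"
  unfolding wh_def tens_unit_left tens_unit_right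
  by transfer (rule dgm_eq.left_curl)

text \<open>Reflection of diagrams in a horizontal line, followed by reversal of all orientations.\<close>

primrec refl_dgm :: "'k::field dgm \<Rightarrow> 'k mor" where
  "refl_dgm (Idn V) = idm V"
| "refl_dgm X = upX"
| "refl_dgm CupQP = capQP"
| "refl_dgm CapQP = cupQP"
| "refl_dgm CupPQ = capPQ"
| "refl_dgm CapPQ = cupPQ"
| "refl_dgm (f \<cdot> g) = refl_dgm g * refl_dgm f"
| "refl_dgm (f \<diamond> g) = refl_dgm f \<boxtimes> refl_dgm g"
| "refl_dgm Zero = 0"
| "refl_dgm (Plus f g) = refl_dgm f + refl_dgm g"
| "refl_dgm (Scale c f) = scl c (refl_dgm f)"

lemma typed_refl_dgm: "typed V W f \<Longrightarrow> refl_dgm f \<in> Mor W V"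
  by (induction rule: typed.induct)
    (auto intro: Mor_idm Mor_gens Mor_comp Mor_tens Mor_zero Mor_plus Mor_scl)

lemma refl_dgm_aux:
  "refl_dgm rXPQ = XQP" "refl_dgm rXQP = XPQ" "refl_dgm dnX_r = dnX" "refl_dgm dnX_l = dnX"
proof -
  show "refl_dgm rXPQ = XQP"
    by (simp add: rXPQ_def XQP_wh mult.assoc wh_def)
  show "refl_dgm rXQP = XPQ"
    by (simp add: rXQP_def XPQ_wh mult.assoc wh_def)
  show "refl_dgm dnX_r = dnX"
    by (simp add: dnX_r_def dnX_wh' mult.assoc wh_def)
  show "refl_dgm dnX_l = dnX"
    by (simp add: dnX_l_def dnX_wh mult.assoc wh_def)
qed

text \<open>The zigzag relations are exchanged in pairs, cyclicity exchanges the two half-turns, and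
  each of the remaining local relations is sent to itself. Reflection therefore descends to
  morphisms, and every identity proved below comes with its mirror image.\<close>

lemma refl_dgm_eq: "f \<simeq> g \<Longrightarrow> refl_dgm f = refl_dgm g"
proof (induction rule: dgm_eq.induct)
  case (interchange V W f U g V' W' f' U' g')
  then show ?case by (auto intro!: interchange_mor dest: typed_refl_dgm)
next
  case (comp_mismatch U V f V' W g)
  then show ?case by (auto intro!: comp_mor_mismatch dest: typed_refl_dgm)
next
  case (comp_id_left V W f)
  then show ?case by (auto intro!: comp_idm_right dest: typed_refl_dgm)
next
  case (comp_id_right V W f)
  then show ?case by (auto intro!: comp_idm_left dest: typed_refl_dgm)
next
  case (scale_plus_left a b f)
  then show ?case by (simp add: scl_add_left)
next
  case left_curl
  then show ?case using left_curl_mor by (simp add: wh_def mult.assoc)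
next
  case circle
  then show ?case by (simp add: capQP_cupQP)
next
  case braid
  then show ?case using upX_braid by (simp add: wh_def mult.assoc)
next
  case double_up
  then show ?case by (simp add: upX_upX)
next
  case (plus_neg f)
  then show ?case by (simp add: uminus_mor_scl[symmetric])
next
  case double_QP
  then show ?case by (simp add: refl_dgm_aux XPQ_XQP uminus_mor_scl[symmetric])
qed (use zigzags in \<open>auto simp: refl_dgm_aux mult.assoc add.assoc add.commute scl_add_left scl_add_right
   tens_add_left tens_add_right distrib_left distrib_right XQP_XPQ wh_def\<close>)

lift_definition vrefl :: "'k::field mor \<Rightarrow> 'k mor" is refl_dgm
  by (rule refl_dgm_eq)

lemma vrefl_idm [simp]: "vrefl (idm V) = idm V"
  using vrefl.abs_eq[of "Idn V"] by (simp add: idm.abs_eq)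

lemma vrefl_gens [simp]:
  "vrefl upX = upX" "vrefl cupQP = capQP" "vrefl capQP = cupQP"
  "vrefl 0 = 0" "vrefl XPQ = XQP" "vrefl XQP = XPQ" "vrefl dnX = dnX"
  by (simp_all add: idm.abs_eq upX_def cupQP_def capQP_def zero_mor_def XPQ_def XQP_def dnX_def
      vrefl.abs_eq refl_dgm_aux)

lemma vrefl_comp [simp]: "vrefl (f * g) = vrefl g * vrefl f"
  by (induction f rule: mor.abs_induct, induction g rule: mor.abs_induct)
    (simp add: times_mor.abs_eq vrefl.abs_eq)

lemma vrefl_tens [simp]: "vrefl (f \<boxtimes> g) = vrefl f \<boxtimes> vrefl g"
  by (induction f rule: mor.abs_induct, induction g rule: mor.abs_induct)
    (simp add: tens.abs_eq vrefl.abs_eq)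

lemma vrefl_add [simp]: "vrefl (f + g) = vrefl f + vrefl g"
  by (induction f rule: mor.abs_induct, induction g rule: mor.abs_induct)
    (simp add: plus_mor.abs_eq vrefl.abs_eq)

lemma vrefl_scl [simp]: "vrefl (scl c f) = scl c (vrefl f)"
  by (induction f rule: mor.abs_induct) (simp add: scl.abs_eq vrefl.abs_eq)

lemma vrefl_wh [simp]: "vrefl (wh V f W) = wh V (vrefl f) W"
  by (simp add: wh_def)

text \<open>Turns an identity between short composites into a rewriting rule inside a longer,
  right-nested one with tail \<open>z\<close>.\<close>

lemma comp_ext2: "a * b = c \<Longrightarrow> a * (b * z) = c * z" for a :: "'a::semigroup_mult"
  by (simp flip: mult.assoc)

lemma comp_ext3: "a * (b * c) = d \<Longrightarrow> a * (b * (c * z)) = d * z" for a :: "'a::semigroup_mult"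
  by (simp flip: mult.assoc)

lemma wh_cong: "a = b \<Longrightarrow> wh V a W = wh V b W"
  by simp

lemma comp_idm_wh:
  assumes "f \<in> Mor A B"
  shows "U = V @ B @ W \<Longrightarrow> idm U * wh V f W = wh V f W"
    and "U = V @ B @ W \<Longrightarrow> idm U * (wh V f W * z) = wh V f W * z"
    and "U = V @ A @ W \<Longrightarrow> wh V f W * idm U = wh V f W"
    and "U = V @ A @ W \<Longrightarrow> wh V f W * (idm U * z) = wh V f W * z"
  by (simp_all add: comp_idm_left[OF Mor_wh[OF assms]] comp_idm_right[OF Mor_wh[OF assms]]
      flip: mult.assoc)

lemmas unit_wh = comp_idm_wh[OF Mor_upX] comp_idm_wh[OF Mor_cupQP] comp_idm_wh[OF Mor_capQP]
  comp_idm_wh[OF Mor_cupPQ] comp_idm_wh[OF Mor_capPQ] comp_idm_wh[OF Mor_XPQ]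
  comp_idm_wh[OF Mor_XQP] comp_idm_wh[OF Mor_dnX]

lemmas zz2 = wh_cong[OF zigzags(2), unfolded wh_comp wh_wh wh_idm append.simps append_Nil2]
lemmas zz3 = wh_cong[OF zigzags(3), unfolded wh_comp wh_wh wh_idm append.simps append_Nil2]

text \<open>Pulling \<open>capQP\<close> below the \<open>capPQ\<close> inside the sideways crossing
  exposes a left curl on an upward strand.\<close>

lemma capQP_XPQ: "capQP * XPQ = 0"
proof -
  note e = wh_exchange[OF Mor_capQP Mor_capPQ, of "[]" "[]" "[]", simplified]
  note c = wh_cong[OF left_curl_mor, of "[]" "[Dn]", unfolded wh_comp wh_wh wh_zero append.simps mult.assoc]
  show ?thesis
    by (simp add: XPQ_wh mult.assoc e[THEN comp_ext2] c)
qed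

text \<open>Pitchfork move: a strand crossing one leg of a cup may cross the other leg instead.
  Unfolding the sideways crossing leaves a \<open>capPQ\<close> which a zigzag straightens against
  the cup.\<close>

lemma XPQ_cup: "wh [] XPQ [Up] * wh [Up] cupQP [] = wh [Dn] upX [] * wh [] cupQP [Up]"
proof -
  note e1 = wh_exchange[OF Mor_cupQP Mor_cupQP, of "[]" "[Up]" "[]", simplified]
  note e2 = wh_exchange[OF Mor_upX Mor_cupQP, of "[Dn]" "[]" "[]", simplified]
  note z = zz2[of "[Dn, Up]" "[]", simplified]
  show ?thesis
    by (simp add: XPQ_wh wh_comp mult.assoc e1 e2[THEN comp_ext2] z[THEN comp_ext2] unit_wh)
qed

lemma XPQ_cup': "wh [Dn] XPQ [] * wh [] cupQP [Dn] = wh [] dnX [Up] * wh [Dn] cupQP []"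
proof -
  note e1 = wh_exchange[OF Mor_cupQP Mor_cupQP, of "[]" "[Dn]" "[]", simplified]
  note e2 = wh_exchange[OF Mor_cupQP Mor_cupQP, of "[Dn]" "[Up, Dn]" "[]", simplified]
  note e3 = wh_exchange[OF Mor_upX Mor_cupQP, of "[Dn, Dn]" "[Dn]" "[]", simplified]
  note e4 = wh_exchange[OF Mor_capPQ Mor_cupQP, of "[Dn, Dn, Up]" "[]" "[]", simplified]
  note z = zz2[of "[Dn, Dn]" "[]", simplified]
  show ?thesis
    by (simp add: XPQ_wh dnX_wh wh_comp mult.assoc e1 e2[THEN comp_ext2] e3[THEN comp_ext2]
        e4[THEN comp_ext2] z[THEN comp_ext2] unit_wh)
qed


section \<open>Downward crossings as mates of upward crossings\<close>

text \<open>A zigzag recovers an endomorphism of \<open>B\<close> from its mate, so relations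
  between downward crossings can be checked after bending the strands over nested caps.\<close>

lemma mate_inject:
  assumes N: "N \<in> Mor (A @ B) []" and U: "U \<in> Mor [] (B @ A)"
    and zz: "wh B N [] * wh [] U B = idm B"
    and f: "f \<in> Mor B B" and g: "g \<in> Mor B B"
    and eq: "N * wh A f [] = N * wh A g []"
  shows "f = g"
proof -
  have "h = wh B (N * wh A h []) [] * wh [] U B" if h: "h \<in> Mor B B" for h
  proof -
    have "h = wh B N [] * (wh [] U B * h)"
      by (simp add: zz comp_idm_left[OF h] flip: mult.assoc)
    also have "wh [] U B * h = wh (B @ A) h [] * wh [] U B"
      using wh_exchange[OF U h, of "[]" "[]" "[]"] by simp
    finally show ?thesis by (simp add: wh_comp mult.assoc)
  qed
  with f g eq show ?thesis by metis
qed

definition capPQ2 :: "'k::field mor" where "capPQ2 = capPQ * wh [Up] capPQ [Dn]"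
definition cupQP2 :: "'k::field mor" where "cupQP2 = wh [Dn] cupQP [Up] * cupQP"
definition capPQ3 :: "'k::field mor" where "capPQ3 = capPQ2 * wh [Up, Up] capPQ [Dn, Dn]"
definition cupQP3 :: "'k::field mor" where "cupQP3 = wh [Dn, Dn] cupQP [Up, Up] * cupQP2"

lemmas Mor_intros = Mor_comp' Mor_wh Mor_gens

lemma Mor_capPQ2: "capPQ2 \<in> Mor [Up, Up, Dn, Dn] []"
  unfolding capPQ2_def by (rule Mor_cast, (rule Mor_intros | (simp; fail))+)

lemma Mor_cupQP2: "cupQP2 \<in> Mor [] [Dn, Dn, Up, Up]"
  unfolding cupQP2_def by (rule Mor_cast, (rule Mor_intros | (simp; fail))+)

lemma Mor_capPQ3: "capPQ3 \<in> Mor [Up, Up, Up, Dn, Dn, Dn] []"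
  unfolding capPQ3_def by (rule Mor_cast, (rule Mor_intros Mor_capPQ2 | (simp; fail))+)

lemma Mor_cupQP3: "cupQP3 \<in> Mor [] [Dn, Dn, Dn, Up, Up, Up]"
  unfolding cupQP3_def by (rule Mor_cast, (rule Mor_intros Mor_cupQP2 | (simp; fail))+)

lemma zigzag_P2: "wh [] capPQ2 [Up, Up] * wh [Up, Up] cupQP2 [] = idm [Up, Up]"
proof -
  note e = wh_exchange[OF Mor_capPQ Mor_cupQP, of "[Up]" "[]" "[Up]", simplified]
  note z1 = zz2[of "[]" "[Up]", simplified]
  note z2 = zz2[of "[Up]" "[]", simplified]
  show ?thesis
    by (simp add: capPQ2_def cupQP2_def wh_comp mult.assoc e[THEN comp_ext2]
        z1 z1[THEN comp_ext2] z2 unit_wh)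
qed

lemma zigzag_Q2: "wh [Dn, Dn] capPQ2 [] * wh [] cupQP2 [Dn, Dn] = idm [Dn, Dn]"
proof -
  note e = wh_exchange[OF Mor_cupQP Mor_capPQ, of "[Dn]" "[]" "[Dn]", simplified, symmetric]
  note z1 = zz3[of "[Dn]" "[]", simplified]
  note z2 = zz3[of "[]" "[Dn]", simplified]
  show ?thesis
    by (simp add: capPQ2_def cupQP2_def wh_comp mult.assoc e[THEN comp_ext2]
        z1 z1[THEN comp_ext2] z2 unit_wh)
qed

lemma zigzag_Q3: "wh [Dn, Dn, Dn] capPQ3 [] * wh [] cupQP3 [Dn, Dn, Dn] = idm [Dn, Dn, Dn]"
proof -
  note e1 = wh_exchange[OF Mor_cupQP Mor_capPQ, of "[Dn, Dn]" "[Up]" "[Dn, Dn]", simplified, symmetric]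
  note e2 = wh_exchange[OF Mor_cupQP Mor_capPQ, of "[Dn, Dn]" "[]" "[Dn]", simplified, symmetric]
  note e3 = wh_exchange[OF Mor_cupQP Mor_capPQ, of "[Dn]" "[]" "[Dn, Dn]", simplified, symmetric]
  note z1 = zz3[of "[Dn, Dn]" "[]", simplified]
  note z2 = zz3[of "[Dn]" "[Dn]", simplified]
  note z3 = zz3[of "[]" "[Dn, Dn]", simplified]
  show ?thesis
    by (simp add: capPQ3_def cupQP3_def capPQ2_def cupQP2_def wh_comp mult.assoc
        e1[THEN comp_ext2] e2[THEN comp_ext2] e3[THEN comp_ext2]
        z1 z2 z1[THEN comp_ext2] z2[THEN comp_ext2] z3 unit_wh)
qed

text \<open>As \<open>dnX\<close> is the half-turn of \<open>upX\<close>, it travels round the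
  nested caps: the outer and the inner pair of caps change height, \<open>upX\<close> slides free,
  and a zigzag removes the leftover bend.\<close>

lemma capPQ2_dnX: "capPQ2 * wh [Up, Up] dnX [] = capPQ2 * wh [] upX [Dn, Dn]"
proof -
  have d: "dnX = wh [Dn, Dn] capPQ2 [] * wh [Dn, Dn] upX [Dn, Dn] * wh [] cupQP2 [Dn, Dn]"
    by (simp add: dnX_wh capPQ2_def cupQP2_def)
  note e1 = wh_exchange[OF Mor_capPQ2 Mor_capPQ2, of "[]" "[]" "[]", simplified, symmetric]
  note e2 = wh_exchange[OF Mor_capPQ2 Mor_upX, of "[]" "[]" "[Dn, Dn]", simplified]
  note z = wh_cong[OF zigzag_P2, of "[]" "[Dn, Dn]", unfolded wh_comp wh_wh wh_idm append.simps append_Nil2]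
  have "capPQ2 * wh [Up, Up] dnX []
      = capPQ2 * (wh [Up, Up, Dn, Dn] capPQ2 [] * (wh [Up, Up, Dn, Dn] upX [Dn, Dn] * wh [Up, Up] cupQP2 [Dn, Dn]))"
    by (simp add: d wh_comp mult.assoc)
  also have "\<dots> = capPQ2 * (wh [] capPQ2 [Up, Up, Dn, Dn] * (wh [Up, Up, Dn, Dn] upX [Dn, Dn] * wh [Up, Up] cupQP2 [Dn, Dn]))"
    by (simp only: e1[THEN comp_ext2] mult.assoc)
  also have "\<dots> = capPQ2 * (wh [] upX [Dn, Dn] * (wh [] capPQ2 [Up, Up, Dn, Dn] * wh [Up, Up] cupQP2 [Dn, Dn]))"
    by (simp only: e2[THEN comp_ext2] mult.assoc)
  finally show ?thesis by (simp add: z unit_wh)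
qed

lemma dnX_dnX: "dnX * dnX = (idm [Dn, Dn] :: 'k::field mor)"
proof (rule mate_inject[of capPQ2 "[Up, Up]" "[Dn, Dn]" cupQP2])
  have "capPQ2 * wh [Up, Up] (dnX * dnX :: 'k mor) [] = capPQ2 * (wh [] upX [Dn, Dn] * wh [Up, Up] dnX [])"
    by (simp add: wh_comp capPQ2_dnX[THEN comp_ext2] mult.assoc)
  also have "\<dots> = (capPQ2 * wh [Up, Up] dnX []) * wh [] upX [Dn, Dn]"
    by (simp add: mult.assoc wh_exchange[OF Mor_upX Mor_dnX, of "[]" "[]" "[]", simplified])
  also have "\<dots> = capPQ2 * wh [] (upX * upX) [Dn, Dn]"
    by (simp add: capPQ2_dnX wh_comp mult.assoc)
  finally show "capPQ2 * wh [Up, Up] (dnX * dnX :: 'k mor) [] = capPQ2 * wh [Up, Up] (idm [Dn, Dn]) []"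
    by (simp add: upX_upX)
qed (auto intro: Mor_capPQ2 Mor_cupQP2 zigzag_Q2 Mor_comp Mor_dnX Mor_idm)

lemma capPQ3_dnX:
  "capPQ3 * wh [Up, Up, Up] dnX [Dn] = capPQ3 * wh [Up] upX [Dn, Dn, Dn]"
  "capPQ3 * wh [Up, Up, Up, Dn] dnX [] = capPQ3 * wh [] upX [Up, Dn, Dn, Dn]"
proof -
  have c: "capPQ3 = capPQ * wh [Up] capPQ2 [Dn]"
    by (simp add: capPQ3_def capPQ2_def wh_comp mult.assoc)
  show "capPQ3 * wh [Up, Up, Up] dnX [Dn] = capPQ3 * wh [Up] upX [Dn, Dn, Dn]"
    by (simp add: c mult.assoc wh_cong[OF capPQ2_dnX, of "[Up]" "[Dn]", unfolded wh_comp, simplified])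
  have "capPQ3 * wh [Up, Up, Up, Dn] dnX [] = capPQ2 * wh [Up, Up] dnX [] * wh [Up, Up] capPQ [Dn, Dn]"
    by (simp add: capPQ3_def mult.assoc
        wh_exchange[OF Mor_capPQ Mor_dnX, of "[Up, Up]" "[]" "[]", simplified])
  also have "\<dots> = capPQ3 * wh [] upX [Up, Dn, Dn, Dn]"
    by (simp add: capPQ3_def capPQ2_dnX mult.assoc
        wh_exchange[OF Mor_upX Mor_capPQ, of "[]" "[]" "[Dn, Dn]", simplified])
  finally show "capPQ3 * wh [Up, Up, Up, Dn] dnX [] = capPQ3 * wh [] upX [Up, Dn, Dn, Dn]" .
qed

text \<open>Carrying a composite round the caps reverses the order of its factors and mirrors their
  positions. The two sides of the braid relation are palindromes that the mirror exchanges, so the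
  upward braid relation is what remains.\<close>

lemma dnX_braid: "wh [] (dnX :: 'k::field mor) [Dn] * wh [Dn] dnX [] * wh [] dnX [Dn]
    = wh [Dn] dnX [] * wh [] dnX [Dn] * wh [Dn] dnX []"
proof (rule mate_inject[of capPQ3 "[Up, Up, Up]" "[Dn, Dn, Dn]" cupQP3])
  note e1 = wh_exchange[OF Mor_upX Mor_dnX, of "[]" "[Up]" "[Dn]", simplified]
  note e2 = wh_exchange[OF Mor_upX Mor_dnX, of "[]" "[Up, Dn]" "[]", simplified]
  note e3 = wh_exchange[OF Mor_upX Mor_dnX, of "[Up]" "[]" "[Dn]", simplified]
  note e4 = wh_exchange[OF Mor_upX Mor_dnX, of "[Up]" "[Dn]" "[]", simplified]
  note b = wh_cong[OF upX_braid, of "[]" "[Dn, Dn, Dn]", simplified wh_comp, simplified mult.assoc, simplified]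
  note c = capPQ3_dnX capPQ3_dnX[THEN comp_ext2]
  note e = e1 e2 e3 e4 e1[THEN comp_ext2] e2[THEN comp_ext2] e3[THEN comp_ext2] e4[THEN comp_ext2]
  have "capPQ3 * wh [Up, Up, Up] (wh [] (dnX :: 'k mor) [Dn] * wh [Dn] dnX [] * wh [] dnX [Dn]) []
      = capPQ3 * (wh [Up] upX [Dn, Dn, Dn] * (wh [] upX [Up, Dn, Dn, Dn] * wh [Up] upX [Dn, Dn, Dn]))"
    by (simp add: wh_comp c e mult.assoc)
  also have "\<dots> = capPQ3 * wh [Up, Up, Up] (wh [Dn] dnX [] * wh [] dnX [Dn] * wh [Dn] dnX []) []"
    by (simp add: wh_comp c e b mult.assoc)
  finally show "capPQ3 * wh [Up, Up, Up] (wh [] (dnX :: 'k mor) [Dn] * wh [Dn] dnX [] * wh [] dnX [Dn]) []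
    = capPQ3 * wh [Up, Up, Up] (wh [Dn] dnX [] * wh [] dnX [Dn] * wh [Dn] dnX []) []" .
next
  show "wh [] (dnX :: 'k mor) [Dn] * wh [Dn] dnX [] * wh [] dnX [Dn] \<in> Mor [Dn, Dn, Dn] [Dn, Dn, Dn]"
    by (rule Mor_cast, (rule Mor_intros | (simp; fail))+)
  show "wh [Dn] (dnX :: 'k mor) [] * wh [] dnX [Dn] * wh [Dn] dnX [] \<in> Mor [Dn, Dn, Dn] [Dn, Dn, Dn]"
    by (rule Mor_cast, (rule Mor_intros | (simp; fail))+)
qed (auto intro: Mor_capPQ3 Mor_cupQP3 zigzag_Q3)

section \<open>Braid relations with mixed orientations\<close>

lemma XPQ_XPQ_rot_P: "wh [] XPQ [Up] * wh [Up] XPQ []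
    = wh [Dn, Up, Up] capPQ [] * wh [Dn, Up] upX [Dn] * wh [Dn] upX [Up, Dn] * wh [] cupQP [Up, Up, Dn]"
proof -
  note e1 = wh_exchange[OF Mor_XPQ Mor_capPQ, of "[]" "[Up]" "[]", simplified]
  note e2 = wh_exchange[OF Mor_XPQ Mor_upX, of "[]" "[]" "[Dn]", simplified]
  note x = wh_cong[OF XPQ_cup, of "[]" "[Up, Dn]", unfolded wh_comp, simplified]
  show ?thesis
    by (subst (2) XPQ_wh) (simp add: wh_comp mult.assoc e1[THEN comp_ext2] e2[THEN comp_ext2] x)
qed

text \<open>The upward braid relation with one of its three strands bent down:
  \<open>XPQ_XPQ_rot_P\<close> replaces both sideways crossings by upward ones between a cup and a
  cap.\<close>

lemma braid_PPQ: "wh [Dn] upX [] * wh [] XPQ [Up] * wh [Up] XPQ []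
    = wh [] XPQ [Up] * wh [Up] XPQ [] * wh [] upX [Dn]"
proof -
  note e1 = wh_exchange[OF Mor_upX Mor_capPQ, of "[Dn]" "[]" "[]", simplified]
  note e2 = wh_exchange[OF Mor_cupQP Mor_upX, of "[]" "[]" "[Dn]", simplified]
  note b = wh_cong[OF upX_braid, of "[Dn]" "[Dn]", unfolded wh_comp, simplified]
  show ?thesis
    by (simp add: XPQ_XPQ_rot_P mult.assoc e1[THEN comp_ext2] e2 
         b[simplified mult.assoc, THEN comp_ext3])
qed

lemma XPQ_rot: "XPQ = wh [] capPQ [Dn, Up] * wh [Up] dnX [Up] * wh [Up, Dn] cupQP []"
proof -
  note x = wh_cong[OF XPQ_cup', of "[Up]" "[]", unfolded wh_comp, simplified, symmetric]
  note e = wh_exchange[OF Mor_capPQ Mor_XPQ, of "[]" "[]" "[]", simplified]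
  note z = zz2[of "[]" "[Dn]", simplified]
  show ?thesis
    by (simp add: mult.assoc x e[THEN comp_ext2] z comp_idm_right[OF Mor_XPQ])
qed

text \<open>Here the upward strand is the bent one, so that the downward braid relation yields
  \<open>braid_PQQ\<close>.\<close>

lemma XPQ_XPQ_rot_Q: "wh [Dn] XPQ [] * wh [] XPQ [Dn]
    = wh [] capPQ [Dn, Dn, Up] * wh [Up] dnX [Dn, Up] * wh [Up, Dn] dnX [Up] * wh [Up, Dn, Dn] cupQP []"
proof -
  note e1 = wh_exchange[OF Mor_capPQ Mor_XPQ, of "[]" "[Dn]" "[]", simplified, symmetric]
  note e2 = wh_exchange[OF Mor_dnX Mor_XPQ, of "[Up]" "[]" "[]", simplified, symmetric]
  note x = wh_cong[OF XPQ_cup', of "[Up, Dn]" "[]", unfolded wh_comp, simplified]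
  show ?thesis
    by (subst (2) XPQ_rot) (simp add: wh_comp mult.assoc e1[THEN comp_ext2] e2[THEN comp_ext2] x)
qed

lemma braid_PQQ: "wh [] dnX [Up] * wh [Dn] XPQ [] * wh [] XPQ [Dn]
    = wh [Dn] XPQ [] * wh [] XPQ [Dn] * wh [Up] dnX []"
proof -
  note e1 = wh_exchange[OF Mor_capPQ Mor_dnX, of "[]" "[]" "[Up]", simplified, symmetric]
  note e2 = wh_exchange[OF Mor_dnX Mor_cupQP, of "[Up]" "[]" "[]", simplified, symmetric]
  note b = wh_cong[OF dnX_braid, of "[Up]" "[Up]", unfolded wh_comp, simplified]
  show ?thesis
    by (simp add: XPQ_XPQ_rot_Q mult.assoc e1[THEN comp_ext2] e2
         b[simplified mult.assoc, THEN comp_ext3])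
qed

section \<open>Curls and double curls\<close>

lemma XQP_cupQP: "XQP * cupQP = 0"
  by (rule arg_cong[OF capQP_XPQ, of vrefl, simplified])

lemma capQP_XQP: "wh [] capQP [Dn] * wh [Dn] XQP [] = wh [Dn] capQP [] * wh [] dnX [Up]"
  by (rule arg_cong[OF XPQ_cup', of vrefl, simplified])

lemma dn_curl: "wh [Dn] capQP [] * (wh [] dnX [Up] * wh [Dn] cupQP []) = 0"
proof -
  have "wh [Dn] capQP [] * (wh [] dnX [Up] * wh [Dn] cupQP [])
      = wh [Dn] (capQP * XPQ) [] * wh [] cupQP [Dn]"
    by (simp add: wh_comp mult.assoc flip: XPQ_cup')
  then show ?thesis by (simp add: capQP_XPQ)
qed

text \<open>Pitchfork moves turn both crossings sideways. They then form the double crossing on an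
  upward and a downward strand, which is the identity, and the cap and the cup separate. This is the
  source of the term \<open>cupS * capS\<close> in \<open>capS_cupS\<close>.\<close>

lemma double_curl:
  "wh [Dn] capQP [Up] * (wh [] dnX [Up, Up] * (wh [Dn, Dn] upX [] * wh [Dn] cupQP [Up])) = cupQP * capQP"
proof -
  note x = wh_cong[OF XPQ_cup, of "[Dn]" "[]", unfolded wh_comp, simplified, symmetric]
  note y = wh_cong[OF capQP_XQP, of "[]" "[Up]", unfolded wh_comp, simplified, symmetric]
  note e = wh_exchange[OF Mor_capQP Mor_cupQP, of "[]" "[]" "[]", simplified]
  note d = wh_cong[OF XQP_XPQ, of "[Dn]" "[Up]", unfolded wh_comp, simplified]
  show ?thesis
    by (simp add: x y[THEN comp_ext2] d[THEN comp_ext2] e unit_wh mult.assoc)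
qed

section \<open>Coxeter presentation and symmetrizers\<close>

text \<open>The Coxeter congruence of the symmetric group on \<open>n + 1\<close> points, on words
  in the generators \<open>0, ..., n - 1\<close>. Other letters may occur in the context but take
  part in no relation.\<close>

inductive cox :: "nat \<Rightarrow> nat list \<Rightarrow> nat list \<Rightarrow> bool" for n where
  square: "i < n \<Longrightarrow> cox n (xs @ [i, i] @ ys) (xs @ ys)"
| braid: "Suc i < n \<Longrightarrow> cox n (xs @ [i, Suc i, i] @ ys) (xs @ [Suc i, i, Suc i] @ ys)"
| comm: "j < n \<Longrightarrow> Suc i < j \<Longrightarrow> cox n (xs @ [i, j] @ ys) (xs @ [j, i] @ ys)"
| refl: "cox n xs xs"
| sym: "cox n xs ys \<Longrightarrow> cox n ys xs"
| trans: "cox n xs ys \<Longrightarrow> cox n ys zs \<Longrightarrow> cox n xs zs"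

lemmas [trans] = cox.trans

lemma cox_append: "cox n xs ys \<Longrightarrow> cox n (us @ xs @ vs) (us @ ys @ vs)"
proof (induction rule: cox.induct)
  case (square i xs ys)
  then show ?case using cox.square[of i n "us @ xs" "ys @ vs"] by simp
next
  case (braid i xs ys)
  then show ?case using cox.braid[of i n "us @ xs" "ys @ vs"] by simp
next
  case (comm j i xs ys)
  then show ?case using cox.comm[of j n i "us @ xs" "ys @ vs"] by simp
qed (auto intro: cox.intros)

lemma cox_map_Suc: "cox n xs ys \<Longrightarrow> cox (Suc n) (map Suc xs) (map Suc ys)"
proof (induction rule: cox.induct)
  case (square i xs ys)
  then show ?case using cox.square[of "Suc i" "Suc n" "map Suc xs" "map Suc ys"] by simp
next
  case (braid i xs ys)
  then show ?case using cox.braid[of "Suc i" "Suc n" "map Suc xs" "map Suc ys"] by simp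
next
  case (comm j i xs ys)
  then show ?case using cox.comm[of "Suc j" "Suc n" "Suc i" "map Suc xs" "map Suc ys"] by simp
qed (auto intro: cox.intros)

lemma cox_commute:
  "i < n \<Longrightarrow> (\<And>k. k \<in> set xs \<Longrightarrow> k < n \<and> (Suc k < i \<or> Suc i < k)) \<Longrightarrow> cox n (i # xs) (xs @ [i])"
proof (induction xs)
  case (Cons k xs)
  then have k: "k < n" "Suc k < i \<or> Suc i < k" by auto
  have "cox n (i # k # xs) (k # i # xs)"
    using k Cons.prems(1) comm[of k n i "[]" xs] comm[of i n k "[]" xs] by (auto intro: cox.sym)
  moreover have "cox n (k # i # xs) (k # xs @ [i])"
    using cox_append[of n "i # xs" "xs @ [i]" "[k]" "[]"] Cons by simp
  ultimately show ?case by (auto intro: cox.trans)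
qed (auto intro: cox.intros)

definition desc :: "nat \<Rightarrow> nat list" where "desc j = rev [0..<j]"

lemma desc_simps [simp]: "desc 0 = []" "desc (Suc j) = j # desc j" "set (desc j) = {..<j}"
  by (auto simp: desc_def)

lemma desc_Suc: "desc (Suc j) = map Suc (desc j) @ [0]"
  unfolding desc_def rev_map[symmetric] map_Suc_upt by (subst upt_conv_Cons) auto

text \<open>The words \<open>desc j\<close> represent the cosets of the stabiliser of 0, which is generated by the
  shifted letters.\<close>

primrec nfs :: "nat \<Rightarrow> nat list set" where
  "nfs 0 = {[]}"
| "nfs (Suc n) = (\<lambda>(j, v). desc j @ map Suc v) ` ({..Suc n} \<times> nfs n)"

lemma nfs_SucI: "j \<le> Suc n \<Longrightarrow> v \<in> nfs n \<Longrightarrow> desc j @ map Suc v \<in> nfs (Suc n)"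
  by auto

lemma nfs_letters: "v \<in> nfs n \<Longrightarrow> set v \<subseteq> {..<n}"
proof (induction n arbitrary: v)
  case (Suc n)
  then show ?case by fastforce
qed auto

text \<open>A generator permutes the cosets represented by the words \<open>desc j\<close>, up to a
  factor in the stabiliser of 0. It lengthens or shortens the representative, or passes through it
  and leaves a shifted letter on the right.\<close>

lemma cox_Cons_desc:
  assumes "i \<le> n" "j \<le> Suc n"
  shows "\<exists>j' v. j' \<le> Suc n \<and> set v \<subseteq> {..<n} \<and> cox (Suc n) (i # desc j) (desc j' @ map Suc v)"
proof -
  consider "i = j" | "j = Suc i" | "j < i" | "Suc i < j" by linarith
  then show ?thesis
  proof cases
    case 1
    then show ?thesis using assms by (intro exI[of _ "Suc j"] exI[of _ "[]"]) (auto intro: cox.refl)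
  next
    case 2
    then show ?thesis using assms square[of i "Suc n" "[]" "desc i"]
      by (intro exI[of _ i] exI[of _ "[]"]) auto
  next
    case 3
    then have "cox (Suc n) (i # desc j) (desc j @ [i])"
      using assms by (intro cox_commute) auto
    then show ?thesis using assms 3 by (intro exI[of _ j] exI[of _ "[i - 1]"]) auto
  next
    case 4
    \<comment> \<open>The letter \<open>i\<close> commutes through \<open>r\<close>, the braid
      relation at \<open>[Suc i, i]\<close> trades it for \<open>Suc i\<close>, and that letter
      commutes past \<open>desc i\<close>.\<close>
    define r where "r = rev [Suc (Suc i)..<j]"
    have d: "desc j = r @ [Suc i, i] @ desc i"
      using 4 upt_add_eq_append[of 0 i "j - i"] unfolding r_def desc_def by (simp add: upt_conv_Cons)
    have "cox (Suc n) (i # r) (r @ [i])"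
      using 4 assms unfolding r_def by (intro cox_commute) auto
    from cox_append[OF this, of "[]" "[Suc i, i] @ desc i"]
    have "cox (Suc n) (i # desc j) (r @ [i, Suc i, i] @ desc i)"
      by (simp add: d)
    also have "cox (Suc n) (r @ [i, Suc i, i] @ desc i) (r @ [Suc i, i, Suc i] @ desc i)"
      using 4 assms by (intro braid) auto
    also have "cox (Suc n) (Suc i # desc i) (desc i @ [Suc i])"
      using 4 assms by (intro cox_commute) auto
    from cox_append[OF this, of "r @ [Suc i, i]" "[]"]
    have "cox (Suc n) (r @ [Suc i, i, Suc i] @ desc i) (desc j @ map Suc [i])"
      by (simp add: d)
    finally show ?thesis
      using assms 4 by (intro exI[of _ j] exI[of _ "[i]"]) auto
  qed
qed

text \<open>Letters are prepended one at a time. Each one pushes a factor into the stabiliser part,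
  where the induction hypothesis for fewer generators restores the normal form.\<close>

lemma cox_nfs: "set xs \<subseteq> {..<n} \<Longrightarrow> \<exists>v \<in> nfs n. cox n xs v"
proof (induction n arbitrary: xs)
  case 0
  then show ?case by (auto intro: cox.refl)
next
  case (Suc n)
  from Suc.prems show ?case
  proof (induction xs)
    case Nil
    obtain v where "v \<in> nfs n" "cox n [] v" using Suc.IH[of "[]"] by auto
    then show ?case
      using cox_map_Suc[of n "[]" v] nfs_SucI[of 0 n v] by force
  next
    case (Cons i xs)
    then obtain j v where v: "j \<le> Suc n" "v \<in> nfs n" "cox (Suc n) xs (desc j @ map Suc v)"
      by fastforce
    obtain j' v' where v': "j' \<le> Suc n" "set v' \<subseteq> {..<n}"
      "cox (Suc n) (i # desc j) (desc j' @ map Suc v')"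
      using cox_Cons_desc[of i n j] v Cons.prems by auto
    have "set (v' @ v) \<subseteq> {..<n}" using v' nfs_letters[OF v(2)] by auto
    then obtain w where w: "w \<in> nfs n" "cox n (v' @ v) w" using Suc.IH by blast
    have "cox (Suc n) (i # xs) (i # desc j @ map Suc v)"
      using cox_append[OF v(3), of "[i]" "[]"] by simp
    also have "cox (Suc n) (i # desc j @ map Suc v) (desc j' @ map Suc v' @ map Suc v)"
      using cox_append[OF v'(3), of "[]" "map Suc v"] by simp
    also have "cox (Suc n) (desc j' @ map Suc v' @ map Suc v) (desc j' @ map Suc w)"
      using cox_append[OF cox_map_Suc[OF w(2)], of "desc j'" "[]"] by simp
    finally show ?case using nfs_SucI[OF v'(1) w(1)] by blast
  qed
qed

lemma word_perm_simps [simp]: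
  "word_perm [] = id" "word_perm (i # xs) = transpose i (Suc i) \<circ> word_perm xs"
  by (simp_all add: word_perm_def)

lemma word_perm_append: "word_perm (xs @ ys) = word_perm xs \<circ> word_perm ys"
  by (induction xs) (auto simp: comp_assoc)

lemma word_perm_permutes: "set xs \<subseteq> {..<r - 1} \<Longrightarrow> word_perm xs permutes {..<r}"
proof (induction xs)
  case (Cons i xs)
  then show ?case
    unfolding word_perm_simps by (intro permutes_compose permutes_swap_id) auto
qed (auto simp: permutes_id)

lemma word_perm_cox: "cox n xs ys \<Longrightarrow> word_perm xs = word_perm ys"
proof (induction rule: cox.induct)
  case (square i xs ys)
  then show ?case by (auto simp: word_perm_append fun_eq_iff)
next
  case (braid i xs ys)
  have "word_perm [i, Suc i, i] = word_perm [Suc i, i, Suc i]"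
    by (auto simp: fun_eq_iff transpose_def)
  then show ?case by (simp only: word_perm_append)
next
  case (comm j i xs ys)
  then have "word_perm [i, j] = word_perm [j, i]"
    by (auto simp: fun_eq_iff transpose_def)
  then show ?case by (simp only: word_perm_append)
qed auto

lemma word_perm_desc: "word_perm (desc j) 0 = j"
  by (induction j) auto

lemma word_perm_map_Suc:
  "word_perm (map Suc v) 0 = 0" "word_perm (map Suc v) (Suc k) = Suc (word_perm v k)"
  by (induction v) (auto simp: transpose_def)

lemma word_perm_inj: "inj (word_perm xs)"
  by (induction xs) (auto intro!: inj_compose simp del: o_apply)

text \<open>The coset index is recovered as the image of 0, and the remaining factor is a
  permutation of the other points, shifted by one.\<close>

lemma inj_word_perm_nfs: "inj_on word_perm (nfs n)"
proof (induction n)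
  case (Suc n)
  show ?case
  proof (rule inj_onI)
    fix x y assume "x \<in> nfs (Suc n)" "y \<in> nfs (Suc n)" and eq: "word_perm x = word_perm y"
    then obtain i j v w where x: "x = desc i @ map Suc v" "v \<in> nfs n"
      and y: "y = desc j @ map Suc w" "w \<in> nfs n" by auto
    from fun_cong[OF eq, of 0] have ij: "i = j"
      by (simp add: x y word_perm_append word_perm_map_Suc word_perm_desc)
    have "word_perm (map Suc v) = word_perm (map Suc w)"
      using eq word_perm_inj[of "desc j"] unfolding x y ij word_perm_append
      by (auto simp: fun_eq_iff dest: injD)
    then have "word_perm v = word_perm w"
      by (metis word_perm_map_Suc(2) nat.inject ext)
    with Suc x y ij show "x = y" by (auto dest: inj_onD)
  qed
qed auto

lemma card_nfs: "finite (nfs n) \<and> card (nfs n) = fact (Suc n)"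
proof (induction n)
  case (Suc n)
  have "inj_on (\<lambda>(j, v). desc j @ map Suc v) ({..Suc n} \<times> nfs n)"
  proof (rule inj_onI, clarify)
    fix i j v w assume eq: "desc i @ map Suc v = desc j @ map Suc w" 
    from arg_cong[OF eq, of "\<lambda>x. word_perm x 0"] have "i = j"
      by (simp add: word_perm_append word_perm_map_Suc word_perm_desc)
    with eq show "i = j \<and> v = w" by (simp add: inj_map_eq_map)
  qed
  with Suc show ?case by (simp add: card_image card_cartesian_product del: fact_Suc) (simp add: algebra_simps)
qed auto

lemma bij_word_perm_nfs: "bij_betw word_perm (nfs (r - 1)) {w. w permutes {..<r}}"
proof -
  have sub: "word_perm ` nfs (r - 1) \<subseteq> {w. w permutes {..<r}}"
    using nfs_letters word_perm_permutes by blast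
  \<comment> \<open>Surjectivity follows by counting. For \<open>r = 0\<close>, truncated
    subtraction gives \<open>nfs 0\<close>, whose single word matches the one permutation of the
    empty set.\<close>
  have "card (word_perm ` nfs (r - 1)) = card {w. w permutes {..<r}}"
    using card_nfs[of "r - 1"] card_permutations[of "{..<r}" r]
    by (cases r) (simp_all add: card_image[OF inj_word_perm_nfs])
  then have "word_perm ` nfs (r - 1) = {w. w permutes {..<r}}"
    using sub by (intro card_subset_eq) (auto simp: finite_permutations)
  then show ?thesis by (simp add: bij_betw_def inj_word_perm_nfs)
qed

text \<open>The normal forms witness that the choice operator in \<open>perm_word\<close> has a word
  to choose.\<close>

lemma perm_word:
  assumes "w permutes {..<r}"
  shows "set (perm_word r w) \<subseteq> {..<r - 1}" "word_perm (perm_word r w) = w"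
proof -
  have "w \<in> word_perm ` nfs (r - 1)"
    using bij_word_perm_nfs[of r] assms by (simp add: bij_betw_def)
  then obtain v where v: "v \<in> nfs (r - 1)" "word_perm v = w" by blast
  then have "(\<forall>i \<in> set v. Suc i < r) \<and> word_perm v = w"
    using nfs_letters[OF v(1)] by auto
  then have "(\<forall>i \<in> set (perm_word r w). Suc i < r) \<and> word_perm (perm_word r w) = w"
    unfolding perm_word_def by (rule someI)
  then show "set (perm_word r w) \<subseteq> {..<r - 1}" "word_perm (perm_word r w) = w"
    by auto
qed

section \<open>Words evaluated at Coxeter generators\<close>

definition wprod :: "(nat \<Rightarrow> 'a::semigroup_mult) \<Rightarrow> 'a \<Rightarrow> nat list \<Rightarrow> 'a" where
  "wprod g u xs = foldr (\<lambda>i f. g i * f) xs u"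

lemma wprod_simps [simp]: "wprod g u [] = u" "wprod g u (i # xs) = g i * wprod g u xs"
  by (simp_all add: wprod_def)

lemma wprod_cong: "(\<And>i. i \<in> set xs \<Longrightarrow> g i = h i) \<Longrightarrow> wprod g u xs = wprod h u xs"
  by (induction xs) auto

lemma wprod_map: "wprod g u (map f xs) = wprod (\<lambda>i. g (f i)) u xs"
  by (induction xs) auto

text \<open>Morphisms of all types form one ring without a global unit, so the identity of the
  object in question enters as an idempotent \<open>u\<close> that is neutral for the generators
  only.\<close>

locale coxeter =
  fixes r :: nat and g :: "nat \<Rightarrow> 'a::semigroup_mult" and u :: 'a
  assumes unit: "u * u = u"
    and unit_left: "Suc i < r \<Longrightarrow> u * g i = g i"
    and unit_right: "Suc i < r \<Longrightarrow> g i * u = g i"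
    and square: "Suc i < r \<Longrightarrow> g i * g i = u"
    and braid: "Suc (Suc i) < r \<Longrightarrow> g i * (g (Suc i) * g i) = g (Suc i) * (g i * g (Suc i))"
    and comm: "Suc j < r \<Longrightarrow> Suc i < j \<Longrightarrow> g i * g j = g j * g i"
begin

lemma unit_wprod: "set xs \<subseteq> {..<r - 1} \<Longrightarrow> u * wprod g u xs = wprod g u xs"
  by (cases xs) (auto simp: unit unit_left simp flip: mult.assoc)

lemma wprod_unit: "set xs \<subseteq> {..<r - 1} \<Longrightarrow> wprod g u xs * u = wprod g u xs"
  by (induction xs) (auto simp: unit mult.assoc)

lemma wprod_append:
  "set xs \<subseteq> {..<r - 1} \<Longrightarrow> set ys \<subseteq> {..<r - 1} \<Longrightarrow> wprod g u (xs @ ys) = wprod g u xs * wprod g u ys"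
  by (induction xs) (auto simp: unit_wprod mult.assoc)

lemma wprod_single: "Suc i < r \<Longrightarrow> wprod g u [i] = g i"
  by (simp add: unit_right)

lemma wprod_cox:
  assumes "cox n xs ys" "n = r - 1"
  shows "(set xs \<subseteq> {..<n} \<longleftrightarrow> set ys \<subseteq> {..<n}) \<and> (set xs \<subseteq> {..<n} \<longrightarrow> wprod g u xs = wprod g u ys)"
  using assms
proof (induction rule: cox.induct)
  case (square i xs ys)
  then have "wprod g u [i, i] = u" by (auto simp: coxeter.square[OF coxeter_axioms] unit_right)
  with square show ?case
    by (auto simp: wprod_append unit_wprod simp del: wprod_simps(2) append_Cons)
next
  case (braid i xs ys)
  then have "wprod g u [i, Suc i, i] = wprod g u [Suc i, i, Suc i]"
    by (auto simp: coxeter.braid[OF coxeter_axioms] unit_right)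
  with braid show ?case
    by (auto simp: wprod_append simp del: wprod_simps(2) append_Cons)
next
  case (comm j i xs ys)
  then have "wprod g u [i, j] = wprod g u [j, i]"
    using coxeter.comm[OF coxeter_axioms, of j i] by (simp add: unit_right)
  with comm show ?case
    by (auto simp: wprod_append simp del: wprod_simps(2) append_Cons)
qed auto

text \<open>Independence of the expression: each word is congruent to a normal form, and a normal
  form is determined by its permutation.\<close>

lemma wprod_eqI:
  assumes "set xs \<subseteq> {..<r - 1}" "set ys \<subseteq> {..<r - 1}" "word_perm xs = word_perm ys"
  shows "wprod g u xs = wprod g u ys"
proof -
  obtain v w where v: "v \<in> nfs (r - 1)" "cox (r - 1) xs v" and w: "w \<in> nfs (r - 1)" "cox (r - 1) ys w"
    using cox_nfs assms by meson
  have "word_perm v = word_perm w"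
    using word_perm_cox[OF v(2)] word_perm_cox[OF w(2)] assms(3) by simp
  with v w have "v = w" using inj_word_perm_nfs by (auto dest: inj_onD)
  with v w show ?thesis using wprod_cox assms by metis
qed

end


section \<open>Symmetrizers of a Coxeter family and their recursion\<close>

text \<open>Keeping the generators as a parameter lets the same results serve upward and downward
  strands, whiskered symmetrizers, and shifted or reversed families of generators.\<close>

definition gsym :: "nat \<Rightarrow> (nat \<Rightarrow> 'k::field_char_0 mor) \<Rightarrow> 'k mor \<Rightarrow> 'k mor" where
  "gsym r g u = scl (1 / of_nat (fact r)) (\<Sum>w | w permutes {..<r}. wprod g u (perm_word r w))"

lemma gsym_cong:
  assumes "\<And>i. Suc i < r \<Longrightarrow> g i = h i"
  shows "gsym r g u = gsym r h u"
proof -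
  have "wprod g u (perm_word r w) = wprod h u (perm_word r w)" if "w permutes {..<r}" for w
    using perm_word(1)[OF that] by (intro wprod_cong assms) auto
  then show ?thesis unfolding gsym_def by (auto intro!: arg_cong[where f = "scl c" for c] sum.cong)
qed

lemma sum_const_mor: "finite A \<Longrightarrow> (\<Sum>w\<in>A. x) = scl (of_nat (card A)) x" for x :: "'k::field mor"
  by (induction A rule: finite_induct) (auto simp: scl_add_left)

lemma average_const:
  assumes "\<And>w. w permutes {..<r} \<Longrightarrow> f w = x"
  shows "scl (1 / of_nat (fact r)) (\<Sum>w | w permutes {..<r}. f w) = (x :: 'k::field_char_0 mor)"
proof -
  have "(\<Sum>w | w permutes {..<r}. f w) = (\<Sum>w | w permutes {..<r}. x)"
    using assms by (intro sum.cong) auto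
  also have "\<dots> = scl (of_nat (fact r)) x"
    using card_permutations[of "{..<r}" r] by (subst sum_const_mor) (auto simp: finite_permutations)
  finally show ?thesis by simp
qed

lemma absorb_gsym:
  assumes "x * u = x" "\<And>i. Suc i < r \<Longrightarrow> x * g i = x"
  shows "x * gsym r g u = x"
proof -
  have "x * wprod g u xs = x" if "set xs \<subseteq> {..<r - 1}" for xs
    using that by (induction xs) (auto simp: assms simp flip: mult.assoc)
  then show ?thesis
    unfolding gsym_def scl_comp_right sum_distrib_left
    by (intro average_const) (use perm_word in auto)
qed

lemma gsym_absorb:
  assumes "u * x = x" "\<And>i. Suc i < r \<Longrightarrow> g i * x = x"
  shows "gsym r g u * x = x"
proof -
  have "wprod g u xs * x = x" if "set xs \<subseteq> {..<r - 1}" for xs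
    using that by (induction xs) (auto simp: assms mult.assoc)
  then show ?thesis
    unfolding gsym_def scl_comp_left sum_distrib_right
    by (intro average_const) (use perm_word in auto)
qed

lemma gsym_intertwine:
  assumes "u * t = t * v" "\<And>i. Suc i < r \<Longrightarrow> g i * t = t * h i"
  shows "gsym r g u * t = t * gsym r h v"
proof -
  have *: "wprod g u xs * t = t * wprod h v xs" if "set xs \<subseteq> {..<r - 1}" for xs
    using that
  proof (induction xs)
    case (Cons i xs)
    then have "Suc i < r" by auto
    from assms(2)[OF this] Cons show ?case
      by (simp add: mult.assoc) (simp flip: mult.assoc)
  qed (simp add: assms)
  show ?thesis
    unfolding gsym_def scl_comp_left scl_comp_right sum_distrib_left sum_distrib_right
    by (rule arg_cong[where f = "scl c" for c], rule sum.cong) (use perm_word * in auto)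
qed

lemma wprod_wh: "wh V (wprod g u xs) W = wprod (\<lambda>i. wh V (g i) W) (wh V u W) xs"
  by (induction xs) (auto simp: wh_comp)

lemma gsym_wh: "wh V (gsym r g u) W = gsym r (\<lambda>i. wh V (g i) W) (wh V u W)"
  by (simp add: gsym_def wh_sum wprod_wh)

lemma Mor_gsym:
  assumes "u \<in> Mor V V" "\<And>i. Suc i < r \<Longrightarrow> g i \<in> Mor V V"
  shows "gsym r g u \<in> Mor V V"
proof -
  have "wprod g u xs \<in> Mor V V" if "set xs \<subseteq> {..<r - 1}" for xs
    using that by (induction xs) (auto intro!: Mor_comp assms)
  then show ?thesis unfolding gsym_def by (intro Mor_scl Mor_sum) (use perm_word in auto)
qed

locale mor_coxeter = coxeter r g u
  for r and g :: "nat \<Rightarrow> 'k::field_char_0 mor" and u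
begin

text \<open>The normal forms carry the coset decomposition on which \<open>gsym_Suc\<close> rests;
  the words picked by \<open>perm_word\<close> have no known shape.\<close>

lemma sum_wprod_nfs:
  "(\<Sum>w | w permutes {..<r}. wprod g u (perm_word r w)) = (\<Sum>v\<in>nfs (r - 1). wprod g u v)"
proof -
  have "(\<Sum>w | w permutes {..<r}. wprod g u (perm_word r w))
      = (\<Sum>v\<in>nfs (r - 1). wprod g u (perm_word r (word_perm v)))"
    by (rule sum.reindex_bij_betw[OF bij_word_perm_nfs, symmetric])
  also have "\<dots> = (\<Sum>v\<in>nfs (r - 1). wprod g u v)"
  proof (rule sum.cong)
    fix v assume "v \<in> nfs (r - 1)"
    from nfs_letters[OF this] show "wprod g u (perm_word r (word_perm v)) = wprod g u v"
      using perm_word[OF word_perm_permutes] by (intro wprod_eqI) auto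
  qed simp
  finally show ?thesis .
qed

lemma gen_gsym:
  assumes "Suc i < r"
  shows "g i * gsym r g u = gsym r g u"
proof -
  let ?t = "transpose i (Suc i)"
  have t: "?t permutes {..<r}" using assms by (intro permutes_swap_id) auto
  have "(\<Sum>w | w permutes {..<r}. g i * wprod g u (perm_word r w))
      = (\<Sum>w | w permutes {..<r}. wprod g u (perm_word r (?t \<circ> w)))"
  proof (rule sum.cong)
    fix w assume "w \<in> {w. w permutes {..<r}}"
    then have w: "w permutes {..<r}" by simp
    have "wprod g u (i # perm_word r w) = wprod g u (perm_word r (?t \<circ> w))"
      using assms perm_word[OF w] perm_word[OF permutes_compose[OF w t]]
      by (intro wprod_eqI) auto
    then show "g i * wprod g u (perm_word r w) = wprod g u (perm_word r (?t \<circ> w))" by simp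
  qed simp
  also have "\<dots> = (\<Sum>w | w permutes {..<r}. wprod g u (perm_word r w))"
    by (rule setum_permutations_compose_left[OF t, symmetric])
  finally show ?thesis by (simp add: gsym_def sum_distrib_left)
qed

lemma gsym_gen:
  assumes "Suc i < r"
  shows "gsym r g u * g i = gsym r g u"
proof -
  let ?t = "transpose i (Suc i)"
  have t: "?t permutes {..<r}" using assms by (intro permutes_swap_id) auto
  have "(\<Sum>w | w permutes {..<r}. wprod g u (perm_word r w) * g i)
      = (\<Sum>w | w permutes {..<r}. wprod g u (perm_word r (w \<circ> ?t)))"
  proof (rule sum.cong)
    fix w assume "w \<in> {w. w permutes {..<r}}"
    then have w: "w permutes {..<r}" by simp
    have "wprod g u (perm_word r w @ [i]) = wprod g u (perm_word r (w \<circ> ?t))"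
      using assms perm_word[OF w] perm_word[OF permutes_compose[OF t w]]
      by (intro wprod_eqI) (auto simp: word_perm_append)
    then show "wprod g u (perm_word r w) * g i = wprod g u (perm_word r (w \<circ> ?t))"
      using assms perm_word[OF w] by (simp add: wprod_append wprod_single del: wprod_simps(2))
  qed simp
  also have "\<dots> = (\<Sum>w | w permutes {..<r}. wprod g u (perm_word r w))"
    by (rule sum_permutations_compose_right[OF t, symmetric])
  finally show ?thesis by (simp add: gsym_def sum_distrib_right)
qed

lemma unit_gsym: "u * gsym r g u = gsym r g u"
  unfolding gsym_def scl_comp_right sum_distrib_left
  by (rule arg_cong[where f = "scl c" for c], rule sum.cong) (use unit_wprod perm_word in auto)

lemma gsym_unit: "gsym r g u * u = gsym r g u"
  unfolding gsym_def scl_comp_left sum_distrib_right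
  by (rule arg_cong[where f = "scl c" for c], rule sum.cong) (use wprod_unit perm_word in auto)

lemma gsym_idem: "gsym r g u * gsym r g u = gsym r g u"
  by (intro absorb_gsym gsym_unit gsym_gen)

end

text \<open>The symmetric group on \<open>r + 1\<close> points has two double cosets modulo the
  stabiliser of a point when \<open>r > 0\<close>. The trivial coset contributes \<open>e\<close>,
  and each of the other \<open>r\<close> left cosets contributes \<open>e * g 0 * e\<close>.\<close>

lemma gsym_Suc:
  fixes g :: "nat \<Rightarrow> 'k::field_char_0 mor"
  assumes "mor_coxeter (Suc r) g u"
  defines "e \<equiv> gsym r (\<lambda>i. g (Suc i)) u"
  shows "gsym (Suc r) g u = scl (1 / of_nat (Suc r)) (e + scl (of_nat r) (e * g 0 * e))"
proof -
  interpret S: mor_coxeter "Suc r" g u by fact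
  interpret E: mor_coxeter r "\<lambda>i. g (Suc i)" u
    by unfold_locales (auto simp: S.unit S.unit_left S.unit_right S.square S.braid S.comm)
  have eg: "e * g (Suc i) = e" if "Suc i < r" for i
    using E.gsym_gen that by (simp add: e_def)
  have eu: "e * u = e" "e * e = e" "u * e = e"
    using E.gsym_unit E.gsym_idem E.unit_gsym by (simp_all add: e_def)
  show ?thesis
  proof (cases r)
    case 0
    then show ?thesis
      using S.sum_wprod_nfs E.sum_wprod_nfs by (simp add: e_def gsym_def)
  next
    case (Suc n)
    have inj: "inj_on (\<lambda>(j, v). desc j @ map Suc v) ({..r} \<times> nfs n)"
    proof (rule inj_onI, clarify)
      fix i j v w assume eq: "desc i @ map Suc v = desc j @ map Suc w"
      from arg_cong[OF eq, of "\<lambda>x. word_perm x 0"] have "i = j"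
        by (simp add: word_perm_append word_perm_map_Suc word_perm_desc)
      with eq show "i = j \<and> v = w" by (simp add: inj_map_eq_map)
    qed
    have "(\<Sum>v\<in>nfs r. wprod g u v) = (\<Sum>(j, v)\<in>{..r} \<times> nfs n. wprod g u (desc j @ map Suc v))"
      using sum.reindex[OF inj, of "wprod g u"] by (simp add: Suc case_prod_unfold)
    also have "\<dots> = (\<Sum>(j, v)\<in>{..r} \<times> nfs n. wprod g u (desc j) * wprod (\<lambda>i. g (Suc i)) u v)"
    proof (rule sum.cong, simp, clarsimp)
      fix j v assume "j \<le> r" "v \<in> nfs n"
      then have "set (desc j) \<subseteq> {..<Suc r - 1}" "set (map Suc v) \<subseteq> {..<Suc r - 1}"
        using nfs_letters[of v n] Suc by auto
      from S.wprod_append[OF this]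
      show "wprod g u (desc j @ map Suc v) = wprod g u (desc j) * wprod (\<lambda>i. g (Suc i)) u v"
        by (simp add: wprod_map)
    qed
    also have "\<dots> = (\<Sum>j\<le>r. wprod g u (desc j)) * (\<Sum>v\<in>nfs n. wprod (\<lambda>i. g (Suc i)) u v)"
      by (simp add: sum_product sum.cartesian_product)
    also have "(\<Sum>v\<in>nfs n. wprod (\<lambda>i. g (Suc i)) u v) = scl (of_nat (fact r)) e"
      using E.sum_wprod_nfs by (simp add: e_def gsym_def Suc del: fact_Suc)
    finally have "(\<Sum>v\<in>nfs r. wprod g u v)
      = scl (fact r) ((\<Sum>j\<le>r. wprod g u (desc j)) * e)" by simp
    moreover have "(1 / fact (Suc r)) * fact r = 1 / (of_nat (Suc r) :: 'k)"
      by (simp del: of_nat_Suc)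
    ultimately have "gsym (Suc r) g u = scl (1 / of_nat (Suc r)) ((\<Sum>j\<le>r. wprod g u (desc j)) * e)"
      using S.sum_wprod_nfs by (simp add: gsym_def del: fact_Suc of_nat_Suc)
    \<comment> \<open>A second \<open>e\<close> on the left leaves the full symmetrizer unchanged
      but simplifies the coset representatives.\<close>
    moreover have "e * gsym (Suc r) g u = gsym (Suc r) g u"
      unfolding e_def by (intro gsym_absorb S.unit_gsym S.gen_gsym) auto
    ultimately have "gsym (Suc r) g u
        = scl (1 / of_nat (Suc r)) (e * ((\<Sum>j\<le>r. wprod g u (desc j)) * e))"
      by (metis scl_comp_right)
    also have "e * ((\<Sum>j\<le>r. wprod g u (desc j)) * e) = (\<Sum>j\<le>r. e * (wprod g u (desc j) * e))"
      by (simp add: sum_distrib_left sum_distrib_right)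
    also have "\<dots> = e * (u * e) + (\<Sum>j<r. e * (wprod g u (desc (Suc j)) * e))"
      by (simp add: sum.atMost_shift)
    \<comment> \<open>By \<open>desc_Suc\<close> the word consists of shifted letters followed by
      the letter 0. The left \<open>e\<close> absorbs the shifted letters, so the summand does not
      depend on \<open>j\<close>.\<close>
    also have "(\<Sum>j<r. e * (wprod g u (desc (Suc j)) * e)) = (\<Sum>j<r. e * g 0 * e)"
    proof (rule sum.cong)
      fix j assume "j \<in> {..<r}"
      then have j: "set (desc j) \<subseteq> {..<r - 1}" by auto
      then have "set (map Suc (desc j)) \<subseteq> {..<Suc r - 1}" "set [0] \<subseteq> {..<Suc r - 1}"
        using Suc by auto
      then have "wprod g u (desc (Suc j)) = wprod (\<lambda>i. g (Suc i)) u (desc j) * g 0"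
        unfolding desc_Suc using Suc
        by (subst S.wprod_append) (auto simp: wprod_map S.unit_right)
      moreover have "e * wprod (\<lambda>i. g (Suc i)) u xs = e" if "set xs \<subseteq> {..<r - 1}" for xs
        using that by (induction xs) (auto simp: eu eg simp flip: mult.assoc)
      ultimately show "e * (wprod g u (desc (Suc j)) * e) = e * g 0 * e"
        using j by (simp flip: mult.assoc)
    qed simp
    finally show ?thesis by (simp add: eu sum_const_mor)
  qed
qed

text \<open>The flip of the Coxeter diagram preserves the relations. Each of the two symmetrizers
  absorbs the generators of the other, so their product equals both.\<close>

lemma gsym_rev:
  assumes "mor_coxeter r g u"
  shows "mor_coxeter r (\<lambda>i. g (r - 2 - i)) u" "gsym r (\<lambda>i. g (r - 2 - i)) u = gsym r g u"
proof -
  interpret G: mor_coxeter r g u by fact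
  have b: "g (r - 2 - i) * (g (r - 2 - Suc i) * g (r - 2 - i))
      = g (r - 2 - Suc i) * (g (r - 2 - i) * g (r - 2 - Suc i))" if "Suc (Suc i) < r" for i
  proof -
    have "r - 2 - i = Suc (r - 2 - Suc i)" using that by simp
    then show ?thesis using G.braid[of "r - 2 - Suc i"] that by simp
  qed
  interpret H: mor_coxeter r "\<lambda>i. g (r - 2 - i)" u
  proof unfold_locales
    fix i j assume "Suc j < r" "Suc i < j"
    then show "g (r - 2 - i) * g (r - 2 - j) = g (r - 2 - j) * g (r - 2 - i)"
      using G.comm[of "r - 2 - i" "r - 2 - j"] by simp
  qed (use b in \<open>auto simp: G.unit G.unit_left G.unit_right G.square\<close>)
  show "mor_coxeter r (\<lambda>i. g (r - 2 - i)) u" by (rule H.mor_coxeter_axioms)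
  have "gsym r (\<lambda>i. g (r - 2 - i)) u * g i = gsym r (\<lambda>i. g (r - 2 - i)) u" if "Suc i < r" for i
  proof -
    have "Suc (r - 2 - i) < r" "r - 2 - (r - 2 - i) = i" using that by auto
    with H.gsym_gen[of "r - 2 - i"] show ?thesis by metis
  qed
  then have "gsym r (\<lambda>i. g (r - 2 - i)) u * gsym r g u = gsym r (\<lambda>i. g (r - 2 - i)) u"
    by (intro absorb_gsym H.gsym_unit)
  moreover have "gsym r (\<lambda>i. g (r - 2 - i)) u * gsym r g u = gsym r g u"
    by (intro gsym_absorb G.unit_gsym G.gen_gsym) simp
  ultimately show "gsym r (\<lambda>i. g (r - 2 - i)) u = gsym r g u" by simp
qed

text \<open>The recursion at the other end. A cap joins the last downward strand to the first upward
  one, so \<open>symQ\<close> is expanded at its last generator and \<open>symP\<close> at its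
  first.\<close>

lemma gsym_Suc':
  fixes g :: "nat \<Rightarrow> 'k::field_char_0 mor"
  assumes "mor_coxeter (Suc r) g u"
  defines "e \<equiv> gsym r g u"
  shows "gsym (Suc r) g u = scl (1 / of_nat (Suc r)) (e + scl (of_nat r) (e * g (r - 1) * e))"
proof -
  interpret G: mor_coxeter "Suc r" g u by fact
  interpret E: mor_coxeter r g u
    by unfold_locales (auto simp: G.unit G.unit_left G.unit_right G.square G.braid G.comm)
  have "gsym r (\<lambda>i. g (r - 1 - Suc i)) u = e"
    using gsym_rev(2)[OF E.mor_coxeter_axioms] by (simp add: e_def)
  then show ?thesis
    using gsym_Suc[OF gsym_rev(1)[OF assms(1)]] gsym_rev(2)[OF assms(1)] by simp
qed

lemma vrefl_vrefl [simp]: "vrefl (vrefl f) = f"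
proof (induction f rule: mor.abs_induct)
  case (1 a)
  have [simp]: "vrefl cupPQ = capPQ" "vrefl capPQ = cupPQ"
    by (simp_all add: cupPQ_def capPQ_def vrefl.abs_eq)
  have "vrefl (refl_dgm a) = abs_mor a"
    by (induction a) (simp_all add: idm.abs_eq upX_def cupQP_def capQP_def cupPQ_def capPQ_def
      times_mor.abs_eq tens.abs_eq zero_mor_def plus_mor.abs_eq scl.abs_eq vrefl.abs_eq)
  then show ?case by (simp add: vrefl.abs_eq)
qed

text \<open>The reflected symmetrizer still absorbs the generators on the left, so its product with
  the original equals it; reflecting this equation shows that the product also equals the
  original.\<close>

lemma (in mor_coxeter) vrefl_gsym:
  assumes "vrefl u = u" "\<And>i. vrefl (g i) = g i"
  shows "vrefl (gsym r g u) = gsym r g u"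
proof -
  let ?e = "gsym r g u"
  have ve: "?e * vrefl ?e = vrefl ?e"
  proof (rule gsym_absorb)
    show "u * vrefl ?e = vrefl ?e"
      using arg_cong[OF gsym_unit, of vrefl] assms by simp
    show "g i * vrefl ?e = vrefl ?e" if "Suc i < r" for i
      using arg_cong[OF gsym_gen[OF that], of vrefl] assms by simp
  qed
  have "?e * vrefl ?e = ?e" using arg_cong[OF ve, of vrefl] by simp
  with ve show ?thesis by simp
qed

section \<open>Bundles of parallel strands\<close>

lemma replicate_merge: "replicate i a @ replicate k a @ xs = replicate (i + k) a @ xs"
  by (simp add: replicate_add)

lemmas rep_simps = replicate_append_same replicate_app_Cons_same replicate_merge
  replicate_add[symmetric]

lemma replicate_split:
  assumes "Suc i < r"
  shows "replicate r a = replicate i a @ [a, a] @ replicate (r - i - 2) a"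
proof -
  from less_imp_Suc_add[OF assms] obtain k where "r = Suc (Suc i + k)" by blast
  then show ?thesis by (simp add: rep_simps)
qed

text \<open>Far commutativity is height exchange. The square and braid relations are those of a
  single crossing, with identity strands added on both sides.\<close>

lemma coxeter_strands:
  assumes x: "x \<in> Mor [a, a] [a, a]" and sq: "x * x = idm [a, a]"
    and br: "wh [] x [a] * wh [a] x [] * wh [] x [a] = wh [a] x [] * wh [] x [a] * wh [a] x []"
  shows "mor_coxeter r (\<lambda>i. wh (replicate i a) x (replicate (r - i - 2) a)) (idm (replicate r a))"
proof unfold_locales
  fix i assume i: "Suc i < r"
  show "idm (replicate r a) * wh (replicate i a) x (replicate (r - i - 2) a)
      = wh (replicate i a) x (replicate (r - i - 2) a)"
    by (rule comp_idm_wh(1)[OF x replicate_split[OF i]])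
  show "wh (replicate i a) x (replicate (r - i - 2) a) * idm (replicate r a)
      = wh (replicate i a) x (replicate (r - i - 2) a)"
    by (rule comp_idm_wh(3)[OF x replicate_split[OF i]])
  show "wh (replicate i a) x (replicate (r - i - 2) a) * wh (replicate i a) x (replicate (r - i - 2) a)
      = idm (replicate r a)"
    using replicate_split[OF i, of a] by (simp add: sq flip: wh_comp)
next
  fix i assume i: "Suc (Suc i) < r"
  from less_imp_Suc_add[OF this] obtain k where r: "r = Suc (Suc (Suc i) + k)" by blast
  note b = wh_cong[OF br, of "replicate i a" "replicate k a", unfolded wh_comp mult.assoc]
  show "wh (replicate i a) x (replicate (r - i - 2) a) *
      (wh (replicate (Suc i) a) x (replicate (r - Suc i - 2) a) * wh (replicate i a) x (replicate (r - i - 2) a))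
    = wh (replicate (Suc i) a) x (replicate (r - Suc i - 2) a) *
      (wh (replicate i a) x (replicate (r - i - 2) a) * wh (replicate (Suc i) a) x (replicate (r - Suc i - 2) a))"
    using b by (simp add: r rep_simps)
next
  fix i j assume j: "Suc j < r" "Suc i < j"
  from less_imp_Suc_add[OF j(2)] obtain k where k: "j = Suc (Suc i + k)" by blast
  from less_imp_Suc_add[OF j(1)] obtain l where r: "r = Suc (Suc j + l)" by blast
  show "wh (replicate i a) x (replicate (r - i - 2) a) * wh (replicate j a) x (replicate (r - j - 2) a)
    = wh (replicate j a) x (replicate (r - j - 2) a) * wh (replicate i a) x (replicate (r - i - 2) a)"
    using wh_exchange[OF x x, of "replicate i a" "replicate k a" "replicate l a"]
    by (simp add: r k rep_simps add.assoc)
qed simp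

lemma crossP_wh: "crossP r i = wh (Ups i) upX (Ups (r - i - 2))"
  by (simp add: crossP_def wh_def)

lemma crossQ_wh: "crossQ r i = wh (Dns i) dnX (Dns (r - i - 2))"
  by (simp add: crossQ_def wh_def)

interpretation P: mor_coxeter r "crossP r" "idm (Ups r)"
  unfolding crossP_wh by (rule coxeter_strands[OF Mor_upX upX_upX upX_braid])

interpretation Q: mor_coxeter r "crossQ r" "idm (Dns r)"
  unfolding crossQ_wh by (rule coxeter_strands[OF Mor_dnX dnX_dnX dnX_braid])

lemma symP_gsym: "symP r = gsym r (crossP r) (idm (Ups r))"
  by (simp add: symP_def gsym_def permP_def wprod_def)

lemma symQ_gsym: "symQ r = gsym r (crossQ r) (idm (Dns r))"
  by (simp add: symQ_def gsym_def permQ_def wprod_def)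

lemma Mor_crossP: "Suc i < r \<Longrightarrow> crossP r i \<in> Mor (Ups r) (Ups r)"
  unfolding crossP_wh using Mor_wh[OF Mor_upX] replicate_split[of i r Up] by metis

lemma Mor_crossQ: "Suc i < r \<Longrightarrow> crossQ r i \<in> Mor (Dns r) (Dns r)"
  unfolding crossQ_wh using Mor_wh[OF Mor_dnX] replicate_split[of i r Dn] by metis

lemma Mor_symP: "symP r \<in> Mor (Ups r) (Ups r)"
  unfolding symP_gsym by (intro Mor_gsym Mor_idm Mor_crossP)

lemma Mor_symQ: "symQ r \<in> Mor (Dns r) (Dns r)"
  unfolding symQ_gsym by (intro Mor_gsym Mor_idm Mor_crossQ)

lemma symP_idem: "symP r * symP r = symP r" and symQ_idem: "symQ r * symQ r = symQ r"
  unfolding symP_gsym symQ_gsym by (rule P.gsym_idem Q.gsym_idem)+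

lemma vrefl_symP [simp]: "vrefl (symP r) = symP r"
  unfolding symP_gsym by (rule P.vrefl_gsym) (simp_all add: crossP_wh)

lemma vrefl_symQ [simp]: "vrefl (symQ r) = symQ r"
  unfolding symQ_gsym by (rule Q.vrefl_gsym) (simp_all add: crossQ_wh)

lemma crossP_Suc: "crossP (Suc r) (Suc i) = wh [Up] (crossP r i) []"
  by (simp add: crossP_wh)

lemma crossP_last: "Suc i < r \<Longrightarrow> crossP (Suc r) i = wh [] (crossP r i) [Up]"
  by (simp add: crossP_wh rep_simps Suc_diff_Suc flip: replicate_Suc)

lemma crossQ_last: "Suc i < r \<Longrightarrow> crossQ (Suc r) i = wh [] (crossQ r i) [Dn]"
  by (simp add: crossQ_wh rep_simps Suc_diff_Suc flip: replicate_Suc)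

text \<open>For \<open>r = 0\<close> the crossing would be too wide, but its coefficient is then 0.
  The same convention is used in \<open>symQ_Suc\<close>.\<close>

lemma symP_Suc:
  "symP (Suc r) = scl (1 / of_nat (Suc r)) (wh [Up] (symP r) []
    + scl (of_nat r) (wh [Up] (symP r) [] * wh [] upX (Ups (r - 1)) * wh [Up] (symP r) []))"
  using gsym_Suc[OF P.mor_coxeter_axioms, of r]
  by (simp add: symP_gsym gsym_wh crossP_Suc crossP_wh[of "Suc r" 0] del: of_nat_Suc)

lemma symQ_Suc:
  "symQ (Suc r) = scl (1 / of_nat (Suc r)) (wh [] (symQ r) [Dn]
    + scl (of_nat r) (wh [] (symQ r) [Dn] * wh (Dns (r - 1)) dnX [] * wh [] (symQ r) [Dn]))"
proof -
  have "gsym r (crossQ (Suc r)) (idm (Dns (Suc r))) = gsym r (\<lambda>i. wh [] (crossQ r i) [Dn]) (idm (Dns (Suc r)))"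
    by (rule gsym_cong) (rule crossQ_last)
  then have e: "gsym r (crossQ (Suc r)) (idm (Dns (Suc r))) = wh [] (symQ r) [Dn]"
    unfolding symQ_gsym gsym_wh by (simp add: rep_simps)
  have d: "scl (of_nat r) (f * crossQ (Suc r) (r - 1) * f) = scl (of_nat r) (f * wh (Dns (r - 1)) dnX [] * f)" for f
    by (cases r) (simp_all add: crossQ_wh)
  then show ?thesis
    using gsym_Suc'[OF Q.mor_coxeter_axioms, of r] unfolding e d
    by (simp only: symQ_gsym[of "Suc r"])
qed

lemma symP_Suc_left: "symP (Suc r) * wh [Up] (symP r) [] = symP (Suc r)"
  unfolding symP_gsym gsym_wh
proof (rule absorb_gsym)
  show "gsym (Suc r) (crossP (Suc r)) (idm (Ups (Suc r))) * wh [Up] (idm (Ups r)) []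
    = gsym (Suc r) (crossP (Suc r)) (idm (Ups (Suc r)))"
    using P.gsym_unit[of "Suc r"] by simp
qed (simp only: crossP_Suc[symmetric], rule P.gsym_gen, simp)

lemma symP_Suc_right: "symP (Suc r) * wh [] (symP r) [Up] = symP (Suc r)"
  unfolding symP_gsym gsym_wh
proof (rule absorb_gsym)
  show "gsym (Suc r) (crossP (Suc r)) (idm (Ups (Suc r))) * wh [] (idm (Ups r)) [Up]
    = gsym (Suc r) (crossP (Suc r)) (idm (Ups (Suc r)))"
    using P.gsym_unit[of "Suc r"] by (simp add: rep_simps)
qed (simp only: crossP_last[symmetric], rule P.gsym_gen, simp)

lemma symQ_Suc_right: "symQ (Suc r) * wh [] (symQ r) [Dn] = symQ (Suc r)"
  unfolding symQ_gsym gsym_wh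
proof (rule absorb_gsym)
  show "gsym (Suc r) (crossQ (Suc r)) (idm (Dns (Suc r))) * wh [] (idm (Dns r)) [Dn]
    = gsym (Suc r) (crossQ (Suc r)) (idm (Dns (Suc r)))"
    using Q.gsym_unit[of "Suc r"] by (simp add: rep_simps)
qed (simp only: crossQ_last[symmetric], rule Q.gsym_gen, simp)

lemma symP_0 [simp]: "symP 0 = idm []" and symQ_0 [simp]: "symQ 0 = idm []"
  using P.sum_wprod_nfs[of 0] Q.sum_wprod_nfs[of 0] by (simp_all add: symP_gsym symQ_gsym gsym_def)

section \<open>Crossings of two bundles of strands\<close>

lemma XQ1P_Suc: "XQ1P (Suc b) = wh (Ups b) XQP [] * wh [] (XQ1P b) [Up]"
  by (simp add: wh_def)

lemma XQsPs_Suc: "XQsPs (Suc a) b = wh [] (XQsPs a b) [Dn] * wh (Dns a) (XQ1P b) []"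
  by (simp add: wh_def)

lemma XPQ1_Suc: "XPQ1 (Suc b) = wh [] (XPQ1 b) [Up] * wh (Ups b) XPQ []"
  by (simp add: wh_def)

lemma XPsQs_Suc: "XPsQs b (Suc a) = wh (Dns a) (XPQ1 b) [] * wh [] (XPsQs b a) [Dn]"
  by (simp add: wh_def)

declare XQ1P.simps(2) [simp del] XQsPs.simps(2) [simp del] XPQ1.simps(2) [simp del]
  XPsQs.simps(2) [simp del]

lemma Mor_XPQ1: "XPQ1 b \<in> Mor (Ups b @ [Dn]) (Dn # Ups b)"
proof (induction b)
  case (Suc b)
  show ?case unfolding XPQ1_Suc
    by (rule Mor_cast, (rule Mor_comp' Mor_wh Suc Mor_XPQ | (simp add: rep_simps; fail))+)
qed (simp add: Mor_idm)

lemma Mor_XPsQs: "XPsQs b a \<in> Mor (Ups b @ Dns a) (Dns a @ Ups b)"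
proof (induction a)
  case (Suc a)
  show ?case unfolding XPsQs_Suc
    by (rule Mor_cast, (rule Mor_comp' Mor_wh Suc Mor_XPQ1 | (simp add: rep_simps; fail))+)
qed (simp add: Mor_idm)

lemma vrefl_XPQ1 [simp]: "vrefl (XPQ1 b) = XQ1P b"
  by (induction b) (simp_all add: XPQ1_Suc XQ1P_Suc)

lemma vrefl_XPsQs [simp]: "vrefl (XPsQs b a) = XQsPs a b"
  by (induction a) (simp_all add: XPsQs_Suc XQsPs_Suc)

lemma vrefl_XQ1P [simp]: "vrefl (XQ1P b) = XPQ1 b" and vrefl_XQsPs [simp]: "vrefl (XQsPs a b) = XPsQs b a"
  by (metis vrefl_vrefl vrefl_XPQ1 vrefl_XPsQs)+

lemma Mor_vrefl: "f \<in> Mor V W \<Longrightarrow> vrefl f \<in> Mor W V"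
  by (elim MorE) (simp add: vrefl.abs_eq typed_refl_dgm)

lemma Mor_XQ1P: "XQ1P b \<in> Mor (Dn # Ups b) (Ups b @ [Dn])"
  using Mor_vrefl[OF Mor_XPQ1] by simp

lemma Mor_XQsPs: "XQsPs a b \<in> Mor (Dns a @ Ups b) (Ups b @ Dns a)"
  using Mor_vrefl[OF Mor_XPsQs] by simp

text \<open>Peels off the crossing with the leftmost upward strand, which is the one met by the
  inner caps and cups; the definition peels at the right.\<close>

lemma XPQ1_Suc': "(XPQ1 (Suc b) :: 'k::field mor) = wh [] XPQ (Ups b) * wh [Up] (XPQ1 b) []"
proof (induction b)
  case 0
  then show ?case by (simp add: XPQ1_Suc comp_idm_left[OF Mor_XPQ] comp_idm_right[OF Mor_XPQ])
next
  case (Suc b)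
  have "(XPQ1 (Suc (Suc b)) :: 'k mor) = wh [] (XPQ1 (Suc b)) [Up] * wh (Ups (Suc b)) XPQ []"
    by (rule XPQ1_Suc)
  also have "\<dots> = wh [] XPQ (Ups (Suc b)) * wh [Up] (wh [] (XPQ1 b) [Up] * wh (Ups b) XPQ []) []"
    unfolding Suc by (simp add: wh_comp mult.assoc rep_simps)
  finally show ?case by (simp only: XPQ1_Suc)
qed

text \<open>A crossing of two upward strands slides through a transverse downward strand. The
  \<open>k\<close> strands on its right are passed by height exchange, and the core is
  \<open>braid_PPQ\<close>.\<close>

lemma upX_XPQ1:
  "wh (Dn # Ups i) upX (Ups k) * XPQ1 (Suc (Suc i) + k)
    = XPQ1 (Suc (Suc i) + k) * wh (Ups i) upX (Ups k @ [Dn])"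
proof (induction k)
  case 0
  note e = wh_exchange[OF Mor_XPQ1 Mor_upX, of "[]" i "[]" "[]", simplified, symmetric]
  note b = wh_cong[OF braid_PPQ, of "Ups i" "[]", unfolded wh_comp mult.assoc, simplified, unfolded rep_simps append_Nil2 append_Nil]
  show ?case
    by (simp add: XPQ1_Suc wh_comp mult.assoc rep_simps e[THEN comp_ext2] b)
next
  case (Suc k)
  note e = wh_exchange[OF Mor_upX Mor_XPQ, of "Ups i" "Ups k" "[]", simplified, unfolded rep_simps append_Nil2 append_Nil]
  note ih = wh_cong[OF Suc, of "[]" "[Up]", unfolded wh_comp, simplified, unfolded rep_simps append_Nil2 append_Nil]
  show ?case
    by (simp add: XPQ1_Suc[of "Suc (Suc (i + k))"] wh_comp mult.assoc rep_simps e ih[THEN comp_ext2])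
qed

lemma symP_XPQ1: "wh [Dn] (symP b) [] * XPQ1 b = XPQ1 b * wh [] (symP b) [Dn]"
  unfolding symP_gsym gsym_wh
proof (rule gsym_intertwine)
  fix i assume "Suc i < b"
  from less_imp_Suc_add[OF this] obtain k where "b = Suc (Suc i) + k" by auto
  with upX_XPQ1[of i k] show "wh [Dn] (crossP b i) [] * XPQ1 b = XPQ1 b * wh [] (crossP b i) [Dn]"
    by (simp add: crossP_wh)
qed (simp add: comp_idm_left[OF Mor_XPQ1] comp_idm_right[OF Mor_XPQ1])

lemma dnX_XPQ1:
  "wh [] dnX (Ups b) * (wh [Dn] (XPQ1 b) [] * wh [] (XPQ1 b) [Dn])
    = wh [Dn] (XPQ1 b) [] * (wh [] (XPQ1 b) [Dn] * wh (Ups b) dnX [])"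
proof (induction b)
  case 0
  then show ?case by (simp add: comp_idm_left[OF Mor_dnX] comp_idm_right[OF Mor_dnX])
next
  case (Suc b)
  note e = wh_exchange[OF Mor_XPQ1 Mor_XPQ, of "[]" b "[]" "[]", simplified, symmetric]
  note ih = wh_cong[OF Suc, of "[]" "[Up]", unfolded wh_comp, simplified, unfolded rep_simps append_Nil2 append_Nil]
  note b = wh_cong[OF braid_PQQ, of "Ups b" "[]", unfolded wh_comp mult.assoc, simplified, unfolded rep_simps append_Nil2 append_Nil]
  show ?case
    by (simp add: XPQ1_Suc wh_comp mult.assoc rep_simps e[THEN comp_ext2] ih[THEN comp_ext3] b)
qed

lemma symP_XPsQs: "wh (Dns a) (symP b) [] * XPsQs b a = XPsQs b a * wh [] (symP b) (Dns a)"
proof (induction a)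
  case 0
  then show ?case by (simp add: comp_idm_left[OF Mor_symP] comp_idm_right[OF Mor_symP])
next
  case (Suc a)
  note ih = wh_cong[OF Suc, of "[]" "[Dn]", unfolded wh_comp, simplified, unfolded rep_simps append_Nil2 append_Nil]
  note s = wh_cong[OF symP_XPQ1, where V = "Dns a" and W = "[]", unfolded wh_comp, simplified, unfolded rep_simps append_Nil2 append_Nil]
  show ?case
    by (simp add: XPsQs_Suc mult.assoc ih s[THEN comp_ext2])
qed

lemma dnX_XPsQs:
  "wh (Dns i) dnX (Dns k @ Ups b) * XPsQs b (Suc (Suc i) + k)
    = XPsQs b (Suc (Suc i) + k) * wh (Ups b @ Dns i) dnX (Dns k)"
proof (induction k)
  case 0
  note e = wh_exchange[OF Mor_XPsQs Mor_dnX, of "[]" b i "[]" "[]", simplified, symmetric]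
  note d = wh_cong[OF dnX_XPQ1, where V = "Dns i" and W = "[]", unfolded wh_comp mult.assoc, simplified, unfolded rep_simps append_Nil2 append_Nil]
  show ?case
    by (simp add: XPsQs_Suc wh_comp mult.assoc rep_simps e d[THEN comp_ext3])
next
  case (Suc k)
  note e = wh_exchange[OF Mor_dnX Mor_XPQ1, where V = "Dns i" and M = "Dns k" and W = "[]", simplified, unfolded rep_simps append_Nil2 append_Nil]
  note ih = wh_cong[OF Suc, of "[]" "[Dn]", unfolded wh_comp, simplified, unfolded rep_simps append_Nil2 append_Nil]
  show ?case
    by (simp add: XPsQs_Suc[of _ "Suc (Suc (i + k))"] wh_comp mult.assoc rep_simps e[THEN comp_ext2] ih)
qed

lemma symQ_XPsQs: "wh [] (symQ a) (Ups b) * XPsQs b a = XPsQs b a * wh (Ups b) (symQ a) []"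
  unfolding symQ_gsym gsym_wh
proof (rule gsym_intertwine)
  fix i assume "Suc i < a"
  from less_imp_Suc_add[OF this] obtain k where "a = Suc (Suc i) + k" by auto
  with dnX_XPsQs[of i k b] show "wh [] (crossQ a i) (Ups b) * XPsQs b a = XPsQs b a * wh (Ups b) (crossQ a i) []"
    by (simp add: crossQ_wh)
qed (simp add: comp_idm_left[OF Mor_XPsQs] comp_idm_right[OF Mor_XPsQs])

lemma XQ1P_XPQ1: "XQ1P b * XPQ1 b = idm (Ups b @ [Dn])"
proof (induction b)
  case (Suc b)
  note ih = wh_cong[OF Suc, of "[]" "[Up]", unfolded wh_comp, simplified, unfolded rep_simps append_Nil2 append_Nil]
  note d = wh_cong[OF XQP_XPQ, of "Ups b" "[]", unfolded wh_comp, simplified, unfolded rep_simps append_Nil2 append_Nil]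
  show ?case by (simp add: XQ1P_Suc XPQ1_Suc mult.assoc ih[THEN comp_ext2] unit_wh d rep_simps)
qed simp

lemma XQsPs_XPsQs: "XQsPs a b * XPsQs b a = idm (Ups b @ Dns a)"
proof (induction a)
  case (Suc a)
  note ih = wh_cong[OF Suc, of "[]" "[Dn]", unfolded wh_comp, simplified, unfolded rep_simps append_Nil2 append_Nil]
  note d = wh_cong[OF XQ1P_XPQ1, where V = "Dns a" and W = "[]", unfolded wh_comp, simplified, unfolded rep_simps append_Nil2 append_Nil]
  note u = comp_idm_wh(2)[OF Mor_XPsQs, where V = "[]" and W = "[Dn]"] comp_idm_wh(1)[OF Mor_XPsQs, where V = "[]" and W = "[Dn]"]
  show ?case by (simp add: XQsPs_Suc XPsQs_Suc mult.assoc d[THEN comp_ext2] u ih rep_simps)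
qed simp

text \<open>The topmost crossing of the bundle involves exactly the two strands that the cap
  joins.\<close>

lemma capQP_XPsQs: "wh (Dns a) capQP (Ups b) * XPsQs (Suc b) (Suc a) = 0"
proof -
  note c = wh_cong[OF capQP_XPQ, of "Dns a" "Ups b", unfolded wh_comp wh_zero]
  show ?thesis
    by (simp add: XPsQs_Suc XPQ1_Suc' wh_comp mult.assoc c[THEN comp_ext2])
qed

text \<open>Pulls a cup to the left through \<open>b\<close> upward strands: by
  \<open>XPQ_cup\<close> every sideways crossing becomes a crossing of upward strands, and the
  symmetrizer absorbs it.\<close>

lemma symP_XPQ1_cup:
  "wh [Dn] (symP (Suc b)) [] * (wh [] (XPQ1 b) [Up] * wh (Ups b) cupQP [])
    = wh [Dn] (symP (Suc b) :: 'k::field_char_0 mor) [] * wh [] cupQP (Ups b)"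
proof (induction b)
  case (Suc b)
  note c = wh_cong[OF XPQ_cup, of "Ups b" "[]", unfolded wh_comp, simplified, unfolded rep_simps append_Nil2 append_Nil]
  note e = wh_exchange[OF Mor_XPQ1 Mor_upX, of "[]" b "[]" "[]", simplified]
  note ih = wh_cong[OF Suc, of "[]" "[Up]", unfolded wh_comp mult.assoc, simplified, unfolded rep_simps append_Nil2 append_Nil]
  have a: "wh [Dn] (symP (Suc (Suc b)) :: 'k mor) [] * wh (Dn # Ups b) upX [] = wh [Dn] (symP (Suc (Suc b))) []"
    using wh_cong[OF P.gsym_gen[of b "Suc (Suc b)"], of "[Dn]" "[]"]
    by (simp add: wh_comp crossP_wh[of "Suc (Suc b)" b] symP_gsym)
  have r: "wh [Dn] (symP (Suc (Suc b)) :: 'k mor) [] * wh [Dn] (symP (Suc b)) [Up] = wh [Dn] (symP (Suc (Suc b))) []"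
    using wh_cong[OF symP_Suc_right[of "Suc b"], of "[Dn]" "[]"] by (simp add: wh_comp)
  have "wh [Dn] (symP (Suc (Suc b)) :: 'k mor) [] * (wh [] (XPQ1 (Suc b)) [Up] * wh (Ups (Suc b)) cupQP [])
    = wh [Dn] (symP (Suc (Suc b))) [] * (wh [] (XPQ1 b) [Up, Up] * wh (Ups b) cupQP [Up])"
    by (simp add: XPQ1_Suc wh_comp mult.assoc rep_simps c e[THEN comp_ext2] a[THEN comp_ext2])
  also have "\<dots> = wh [Dn] (symP (Suc (Suc b))) [] * (wh [Dn] (symP (Suc b)) [Up] * (wh [] (XPQ1 b) [Up, Up] * wh (Ups b) cupQP [Up]))"
    by (simp only: r[THEN comp_ext2])
  also have "\<dots> = wh [Dn] (symP (Suc (Suc b))) [] * wh [] cupQP (Ups (Suc b))"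
    by (simp add: ih r[THEN comp_ext2])
  finally show ?case .
qed (simp add: comp_idm_left[OF Mor_cupQP])

lemma XPQ1_cup:
  "wh [Dn] (XPQ1 (Suc b)) [] * wh [] cupQP (Ups b @ [Dn])
    = wh [] dnX (Up # Ups b) * (wh [Dn] cupQP (Ups b) * XPQ1 b)"
proof -
  note e = wh_exchange[OF Mor_cupQP Mor_XPQ1, of "[]" "[]" b "[]", simplified, symmetric]
  note c = wh_cong[OF XPQ_cup', of "[]" "Ups b", unfolded wh_comp, simplified, unfolded rep_simps append_Nil2 append_Nil]
  show ?thesis by (simp add: XPQ1_Suc' wh_comp mult.assoc e c[THEN comp_ext2])
qed


section \<open>Symmetrizers on both bundles, and factoring through a cup\<close>

definition symQP :: "nat \<Rightarrow> nat \<Rightarrow> 'k::field_char_0 mor" where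
  "symQP m n = symQ m \<boxtimes> symP n"

definition symPQ :: "nat \<Rightarrow> nat \<Rightarrow> 'k::field_char_0 mor" where
  "symPQ m n = symP n \<boxtimes> symQ m"

lemma symQP_wh: "symQP m n = wh [] (symQ m) (Ups n) * wh (Dns m) (symP n) []"
  "symQP m n = wh (Dns m) (symP n) [] * wh [] (symQ m) (Ups n)"
  unfolding symQP_def using tens_eq_comp[OF Mor_symQ Mor_symP] by auto

lemma symPQ_wh: "symPQ m n = wh [] (symP n) (Dns m) * wh (Ups n) (symQ m) []"
  "symPQ m n = wh (Ups n) (symQ m) [] * wh [] (symP n) (Dns m)"
  unfolding symPQ_def using tens_eq_comp[OF Mor_symP Mor_symQ] by auto

lemma Mor_symQP: "symQP m n \<in> Mor (Dns m @ Ups n) (Dns m @ Ups n)"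
  unfolding symQP_def by (intro Mor_tens Mor_symP Mor_symQ)

lemma Mor_symPQ: "symPQ m n \<in> Mor (Ups n @ Dns m) (Ups n @ Dns m)"
  unfolding symPQ_def by (intro Mor_tens Mor_symP Mor_symQ)

lemma symQP_idem: "symQP m n * symQP m n = symQP m n"
  unfolding symQP_def
  by (simp add: symP_idem symQ_idem flip: interchange_mor[OF Mor_symQ Mor_symQ Mor_symP Mor_symP])

lemma symPQ_idem: "symPQ m n * symPQ m n = symPQ m n"
  unfolding symPQ_def
  by (simp add: symP_idem symQ_idem flip: interchange_mor[OF Mor_symP Mor_symP Mor_symQ Mor_symQ])

lemma vrefl_symQP [simp]: "vrefl (symQP m n) = symQP m n"
  and vrefl_symPQ [simp]: "vrefl (symPQ m n) = symPQ m n"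
  by (simp_all add: symQP_def symPQ_def)

lemma symQP_absorb_left:
  assumes "symQ m * x = symQ m"
  shows "symQP m n * wh [] x (Ups n) = symQP m n"
  using wh_cong[OF assms, of "[]" "Ups n"] by (simp add: symQP_wh(2) wh_comp mult.assoc)

lemma symQP_absorb_right:
  assumes "symP n * x = symP n"
  shows "symQP m n * wh (Dns m) x [] = symQP m n"
  using wh_cong[OF assms, of "Dns m" "[]"] by (simp add: symQP_wh(1) wh_comp mult.assoc)

lemma symQP_XPsQs: "symQP a b * XPsQs b a = XPsQs b a * symPQ a b"
  by (simp add: symQP_wh(1) symPQ_wh(2) mult.assoc symP_XPsQs)
    (simp add: symQ_XPsQs flip: mult.assoc)

lemma XQsPs_symQP: "XQsPs a b * symQP a b = symPQ a b * XQsPs a b"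
  using arg_cong[OF symQP_XPsQs, of vrefl a b] by simp

text \<open>Each double crossing of the downward strand with an upward one differs from the identity
  by a cup after a cap. Below the symmetrizer all these cups can be moved to the leftmost
  position.\<close>

lemma cup_factor_1:
  "\<exists>g. wh [Dn] (symP (Suc b)) [] * (idm (Dn # Ups (Suc b)) - XPQ1 (Suc b) * XQ1P (Suc b))
    = wh [Dn] (symP (Suc b) :: 'k::field_char_0 mor) [] * (wh [] cupQP (Ups b) * g)"
proof (induction b)
  case 0
  have "idm [Dn, Up] - XPQ1 (Suc 0) * XQ1P (Suc 0) = cupQP * (capQP :: 'k mor)"
    by (simp add: XPQ1_Suc XQ1P_Suc XPQ_XQP comp_idm_left[OF Mor_XPQ] comp_idm_right[OF Mor_XQP])
  then show ?case by (intro exI[of _ capQP]) simp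
next
  case (Suc b)
  let ?n = "Suc b"
  let ?E = "wh [Dn] (symP (Suc ?n)) [] :: 'k mor"
  obtain g where g: "wh [Dn] (symP ?n) [] * (idm (Dn # Ups ?n) - XPQ1 ?n * XQ1P ?n)
    = wh [Dn] (symP ?n :: 'k mor) [] * (wh [] cupQP (Ups b) * g)" using Suc by blast
  have r: "?E * wh [Dn] (symP ?n) [Up] = ?E"
    using wh_cong[OF symP_Suc_right[of ?n], of "[Dn]" "[]"] by (simp add: wh_comp)
  have x: "wh (Ups ?n) XPQ [] * wh (Ups ?n) XQP []
      = idm (Ups ?n @ [Dn, Up]) - wh (Ups ?n) cupQP [] * wh (Ups ?n) (capQP :: 'k mor) []"
    using wh_cong[OF XPQ_XQP, of "Ups ?n" "[]"] by (simp add: wh_comp wh_diff)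
  have u: "idm (Ups ?n @ [Dn, Up]) * wh [] (XQ1P ?n) [Up] = wh [] (XQ1P ?n :: 'k mor) [Up]"
    by (rule comp_idm_wh[OF Mor_XQ1P]) (simp add: rep_simps)
  \<comment> \<open>Telescoping: undoing the last double crossing gives the difference for
    \<open>?n\<close> upward strands plus one term containing a cup.\<close>
  have d: "idm (Dn # Ups (Suc ?n)) - XPQ1 (Suc ?n) * XQ1P (Suc ?n)
      = wh [] (idm (Dn # Ups ?n) - XPQ1 ?n * XQ1P ?n) [Up]
      + wh [] (XPQ1 ?n) [Up] * (wh (Ups ?n) cupQP [] * (wh (Ups ?n) (capQP :: 'k mor) [] * wh [] (XQ1P ?n) [Up]))"
    unfolding XPQ1_Suc[of ?n] XQ1P_Suc[of ?n] mult.assoc x[THEN comp_ext2] left_diff_distrib right_diff_distrib u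
    by (simp add: wh_diff wh_comp rep_simps mult.assoc)
  have s: "?E * (wh [] (XPQ1 ?n) [Up] * (wh (Ups ?n) cupQP [] * z)) = ?E * (wh [] cupQP (Ups ?n) * z)" for z
    using comp_ext3[OF symP_XPQ1_cup[of ?n]] by (simp add: mult.assoc)
  from d have "?E * (idm (Dn # Ups (Suc ?n)) - XPQ1 (Suc ?n) * XQ1P (Suc ?n))
    = ?E * (wh [Dn] (symP ?n) [Up] * wh [] (idm (Dn # Ups ?n) - XPQ1 ?n * XQ1P ?n) [Up])
      + ?E * (wh [] (XPQ1 ?n) [Up] * wh (Ups ?n) cupQP []) * (wh (Ups ?n) capQP [] * wh [] (XQ1P ?n) [Up])"
    by (simp add: distrib_left r mult.assoc flip: mult.assoc[of ?E "wh [Dn] (symP ?n) [Up]"])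
  also have "\<dots> = ?E * (wh [] cupQP (Ups ?n) * (wh [] g [Up] + wh (Ups ?n) capQP [] * wh [] (XQ1P ?n) [Up]))"
    using wh_cong[OF g, of "[]" "[Up]"] s
    by (simp add: wh_comp distrib_left rep_simps mult.assoc r[THEN comp_ext2])
  finally show ?case by blast
qed

text \<open>Completes \<open>cup_factor_1\<close> to several downward strands. It is the
  diagrammatic reason why 1 - y x factors through d.\<close>

lemma cup_factor:
  "\<exists>g. symQP a (Suc b) * (idm (Dns a @ Ups (Suc b)) - XPsQs (Suc b) a * XQsPs a (Suc b))
    = (symQP a (Suc b) :: 'k::field_char_0 mor) * (wh (Dns (a - 1)) cupQP (Ups b) * g)"
proof (induction a)
  case 0
  \<comment> \<open>Without downward strands the bundle crossings are identities and the difference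
    is zero, so the truncated position of the cup does not matter.\<close>
  then show ?case by (intro exI[of _ 0]) simp
next
  case (Suc a)
  let ?n = "Suc b"
  let ?F = "symQP (Suc a) ?n :: 'k mor"
  let ?A = "wh (Dns a) (XPQ1 ?n) [] :: 'k mor"
  obtain g1 where g1: "wh [Dn] (symP ?n) [] * (idm (Dn # Ups ?n) - XPQ1 ?n * XQ1P ?n)
    = wh [Dn] (symP ?n :: 'k mor) [] * (wh [] cupQP (Ups b) * g1)" using cup_factor_1 by blast
  obtain g2 where g2: "symQP a ?n * (idm (Dns a @ Ups ?n) - XPsQs ?n a * XQsPs a ?n)
    = (symQP a ?n :: 'k mor) * (wh (Dns (a - 1)) cupQP (Ups b) * g2)" using Suc by blast
  have FP: "?F * wh (Dns (Suc a)) (symP ?n) [] = ?F"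
    by (rule symQP_absorb_right[OF symP_idem])
  have FQ: "?F * wh [] (symQ a) (Dn # Ups ?n) = ?F"
    using symQP_absorb_left[OF symQ_Suc_right[where 'a = 'k, of a], of ?n] by simp
  \<comment> \<open>The smaller symmetrizer may be inserted below \<open>?A\<close>: its factors
    slide up through the crossings and are absorbed by \<open>?F\<close>. This makes the induction
    hypothesis applicable there.\<close>
  have FA: "?F * (?A * wh [] (symQP a ?n) [Dn]) = ?F * ?A"
  proof -
    note e = wh_exchange[OF Mor_symQ[of a] Mor_XPQ1[of ?n], where V = "[]" and M = "[]" and W = "[]", simplified, symmetric]
    note s = wh_cong[OF symP_XPQ1[of ?n], where V = "Dns a" and W = "[]", unfolded wh_comp, simplified,
      unfolded rep_simps append_Nil2, symmetric]
    have "?A * wh [] (symQP a ?n) [Dn] = wh [] (symQ a) (Dn # Ups ?n) * (wh (Dns (Suc a)) (symP ?n) [] * ?A)"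
      by (simp add: symQP_wh(1) wh_comp e[THEN comp_ext2] s mult.assoc)
    then show ?thesis by (simp only: comp_ext2[OF FQ] comp_ext2[OF FP])
  qed
  have 1: "?F * wh (Dns a) (idm (Dn # Ups ?n) - XPQ1 ?n * XQ1P ?n) []
    = ?F * (wh (Dns a) cupQP (Ups b) * wh (Dns a) g1 [])"
  proof -
    have "?F * wh (Dns a) h [] = ?F * wh (Dns a) (wh [Dn] (symP ?n) [] * h) []" for h
      using FP by (simp add: wh_comp rep_simps flip: mult.assoc)
    from this[of "idm (Dn # Ups ?n) - XPQ1 ?n * XQ1P ?n"] this[of "wh [] cupQP (Ups b) * g1"]
    show ?thesis unfolding g1 by (simp add: wh_comp)
  qed
  have 2: "\<exists>g. ?F * (?A * wh [] (idm (Dns a @ Ups ?n) - XPsQs ?n a * XQsPs a ?n) [Dn])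
    = ?F * (wh (Dns a) cupQP (Ups b) * g)"
  proof (cases a)
    case 0
    then show ?thesis by (intro exI[of _ 0]) simp
  next
    case a: (Suc a')
    let ?c = "wh (Dns a') cupQP (Ups b @ [Dn])"
    have FX: "?F * wh (Dns a') dnX (Ups ?n) = ?F"
      using symQP_absorb_left[of "Suc a" "crossQ (Suc a) a' :: 'k mor" ?n] Q.gsym_gen[where 'a = 'k, of a' "Suc a"]
      by (simp add: symQ_gsym crossQ_wh a)
    have "?F * (?A * wh [] h [Dn]) = ?F * (?A * wh [] (symQP a ?n * h) [Dn])" for h
      using comp_ext2[OF FA[folded mult.assoc, unfolded mult.assoc]] FA
      by (simp add: wh_comp flip: mult.assoc)
    from this[of "idm (Dns a @ Ups ?n) - XPsQs ?n a * XQsPs a ?n"] this[of "wh (Dns (a - 1)) cupQP (Ups b) * g2"]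
    have "?F * (?A * wh [] (idm (Dns a @ Ups ?n) - XPsQs ?n a * XQsPs a ?n) [Dn])
      = ?F * (?A * (?c * wh [] g2 [Dn]))"
      unfolding g2 by (simp add: wh_comp a)
    \<comment> \<open>Moving the cup inwards past the last downward strand creates one downward
      crossing on top, which \<open>?F\<close> absorbs by \<open>FX\<close>.\<close>
    also have "?A * (?c * wh [] g2 [Dn])
      = wh (Dns a') dnX (Ups ?n) * (wh (Dns a) cupQP (Ups b) * (wh (Dns a') (XPQ1 b) [] * wh [] g2 [Dn]))"
      using wh_cong[OF XPQ1_cup[where 'a = 'k, of b], of "Dns a'" "[]"]
      by (simp add: wh_comp a rep_simps) (simp flip: mult.assoc)
    finally show ?thesis unfolding comp_ext2[OF FX] by blast
  qed
  then obtain g3 where g3: "?F * (?A * wh [] (idm (Dns a @ Ups ?n) - XPsQs ?n a * XQsPs a ?n) [Dn])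
    = ?F * (wh (Dns a) cupQP (Ups b) * g3)" by blast
  have u: "?A * idm (Dns a @ Ups ?n @ [Dn]) = ?A"
    by (rule comp_idm_wh[OF Mor_XPQ1]) simp
  \<comment> \<open>Telescoping again, in the form 1 - A B B' A' = (1 - A A') + A (1 - B B')
    A'.\<close>
  have "idm (Dns (Suc a) @ Ups ?n) - XPsQs ?n (Suc a) * XQsPs (Suc a) ?n
    = wh (Dns a) (idm (Dn # Ups ?n) - XPQ1 ?n * XQ1P ?n) []
      + ?A * wh [] (idm (Dns a @ Ups ?n) - XPsQs ?n a * XQsPs a ?n) [Dn] * wh (Dns a) (XQ1P ?n) []"
    unfolding XPsQs_Suc XQsPs_Suc
    by (simp add: wh_diff wh_comp algebra_simps comp_ext2[OF u[simplified]] u[simplified] rep_simps)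
  then have "?F * (idm (Dns (Suc a) @ Ups ?n) - XPsQs ?n (Suc a) * XQsPs (Suc a) ?n)
    = ?F * (wh (Dns a) cupQP (Ups b) * (wh (Dns a) g1 [] + g3 * wh (Dns a) (XQ1P ?n) []))"
    using 1 comp_ext2[OF g3[folded mult.assoc]] g3
    by (simp add: distrib_left) (simp flip: mult.assoc)
  then show ?case by auto
qed

section \<open>Thick caps, cups and crossings\<close>

text \<open>\<open>capS\<close>, \<open>cupS\<close>, \<open>XQPs\<close> and \<open>XPQs\<close>
  are c, d, x and y of the overview. The indices of \<open>capS\<close> and \<open>cupS\<close>
  count the strands on the smaller side.\<close>

definition capS :: "nat \<Rightarrow> nat \<Rightarrow> 'k::field_char_0 mor" where
  "capS m n = symQP m n * wh (Dns m) capQP (Ups n) * symQP (Suc m) (Suc n)"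

definition cupS :: "nat \<Rightarrow> nat \<Rightarrow> 'k::field_char_0 mor" where
  "cupS m n = symQP (Suc m) (Suc n) * wh (Dns m) cupQP (Ups n) * symQP m n"

definition XQPs :: "nat \<Rightarrow> nat \<Rightarrow> 'k::field_char_0 mor" where
  "XQPs m n = symPQ m n * XQsPs m n * symQP m n"

definition XPQs :: "nat \<Rightarrow> nat \<Rightarrow> 'k::field_char_0 mor" where
  "XPQs m n = symQP m n * XPsQs n m * symPQ m n"

lemma vrefl_thick [simp]:
  "vrefl (capS m n) = cupS m n" "vrefl (cupS m n) = capS m n"
  "vrefl (XQPs m n) = XPQs m n" "vrefl (XPQs m n) = XQPs m n"
  by (simp_all add: capS_def cupS_def XQPs_def XPQs_def mult.assoc)

lemma symQP_ext: "symQP m n * (symQP m n * z) = symQP m n * z"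
  by (rule comp_ext2[OF symQP_idem])

lemma symPQ_ext: "symPQ m n * (symPQ m n * z) = symPQ m n * z"
  by (rule comp_ext2[OF symPQ_idem])

lemma capS_symQP [simp]: "capS m n * symQP (Suc m) (Suc n) = capS m n"
  "symQP m n * capS m n = capS m n"
  by (simp_all add: capS_def mult.assoc symQP_idem symQP_ext)

lemma cupS_symQP [simp]: "cupS m n * symQP m n = cupS m n"
  "symQP (Suc m) (Suc n) * cupS m n = cupS m n"
  by (simp_all add: cupS_def mult.assoc symQP_idem symQP_ext)

text \<open>\<open>f\<close> and \<open>e\<close> symmetrize only the strands that the cap leaves
  alone. They slide through the cap to its top and are absorbed there, which provides the hypotheses
  of \<open>sandwich_expand\<close>.\<close>

lemma symQP_inner:
  fixes m n :: nat
  defines "f \<equiv> wh [] (symQ m) (Dn # Ups (Suc n)) :: 'k::field_char_0 mor"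
    and "e \<equiv> wh (Dns m @ [Dn, Up]) (symP n) [] :: 'k mor"
    and "c \<equiv> symQP m n * wh (Dns m) capQP (Ups n) :: 'k mor"
  shows "f * e = e * f" "c * f = c" "c * e = c"
    "symQP (Suc m) (Suc n) * f = symQP (Suc m) (Suc n)" "symQP (Suc m) (Suc n) * e = symQP (Suc m) (Suc n)"
proof -
  show "f * e = e * f"
    unfolding f_def e_def
    by (simp add: wh_exchange[OF Mor_symQ Mor_symP, of "[]" m "[Dn, Up]" n "[]", simplified])
  show "c * f = c"
  proof -
    have "wh (Dns m) capQP (Ups n) * f = wh [] (symQ m) (Ups n) * wh (Dns m) capQP (Ups n)"
      by (simp add: f_def wh_exchange[OF Mor_symQ Mor_capQP, of "[]" m "[]" "Ups n", simplified])
    then show ?thesis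
      by (simp add: c_def mult.assoc comp_ext2[OF symQP_absorb_left[OF symQ_idem]])
  qed
  show "c * e = c"
  proof -
    have "wh (Dns m) capQP (Ups n) * e = wh (Dns m) (symP n) [] * wh (Dns m) capQP (Ups n)"
      by (simp add: e_def wh_exchange[OF Mor_capQP Mor_symP, of "Dns m" "[]" n "[]", simplified])
    then show ?thesis
      by (simp add: c_def mult.assoc comp_ext2[OF symQP_absorb_right[OF symP_idem]])
  qed
  show "symQP (Suc m) (Suc n) * f = symQP (Suc m) (Suc n)"
    using symQP_absorb_left[OF symQ_Suc_right[where 'a = 'k], of m "Suc n"] by (simp add: f_def)
  show "symQP (Suc m) (Suc n) * e = symQP (Suc m) (Suc n)"
    using symQP_absorb_right[OF symP_Suc_left[where 'a = 'k], of "Suc m" n] by (simp add: e_def rep_simps)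
qed

text \<open>The symmetrizer above the cap slides below it and is absorbed by the larger one.\<close>

lemma capS_eq: "capS m n = wh (Dns m) capQP (Ups n) * (symQP (Suc m) (Suc n) :: 'k::field_char_0 mor)"
proof -
  let ?f = "wh [] (symQ m) (Dn # Ups (Suc n)) :: 'k mor"
  let ?e = "wh (Dns m @ [Dn, Up]) (symP n) [] :: 'k mor"
  let ?cap = "wh (Dns m) capQP (Ups n) :: 'k mor"
  have a: "?cap * ?f = wh [] (symQ m) (Ups n) * ?cap"
    by (simp add: wh_exchange[OF Mor_symQ Mor_capQP, of "[]" m "[]" "Ups n", simplified])
  have b: "?cap * ?e = wh (Dns m) (symP n) [] * ?cap"
    by (simp add: wh_exchange[OF Mor_capQP Mor_symP, of "Dns m" "[]" n "[]", simplified])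
  have "symQP m n * ?cap = ?cap * (?e * ?f)"
    by (simp only: symQP_wh(2) mult.assoc comp_ext2[OF b] a)
  moreover have "?f * symQP (Suc m) (Suc n) = symQP (Suc m) (Suc n)"
    using arg_cong[OF symQP_inner(4)[where 'k = 'k, of m n], of vrefl] by simp
  moreover have "?e * symQP (Suc m) (Suc n) = symQP (Suc m) (Suc n)"
    using arg_cong[OF symQP_inner(5)[where 'k = 'k, of m n], of vrefl] by simp
  ultimately show ?thesis by (simp add: capS_def mult.assoc)
qed

lemma cupS_eq: "cupS m n = symQP (Suc m) (Suc n) * wh (Dns m) cupQP (Ups n)"
  using arg_cong[OF capS_eq, of vrefl m n] by simp

text \<open>The four products of the two symmetrizer recursions between a cap side \<open>c\<close>
  and a cup side \<open>u\<close>. Here \<open>f\<close> and \<open>e\<close> are the inner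
  symmetrizers, \<open>d\<close> and \<open>x\<close> the downward and the upward crossing; each
  crossing commutes with the symmetrizer of the other orientation.\<close>

lemma sandwich_expand:
  fixes c :: "'k::field mor"
  assumes "c * f = c" "c * e = c" "f * u = u" "e * u = u" "f * e = e * f" "d * e = e * d" "f * x = x * f"
  shows "c * ((f + scl a (f * d * f)) * (e + scl b (e * x * e))) * u
    = c * u + scl b (c * x * u) + scl a (c * d * u) + scl (a * b) (c * d * x * u)"
proof -
  note ext = assms[THEN comp_ext2]
  have 1: "c * (f * (e * u)) = c * u" by (simp add: assms)
  have 2: "c * (f * (e * (x * (e * u)))) = c * (x * u)"
    by (simp add: assms ext mult.assoc)
  have 3: "c * (f * (d * (f * (e * u)))) = c * (d * u)"
    by (simp add: assms ext mult.assoc)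
  have 4: "c * (f * (d * (f * (e * (x * (e * u)))))) = c * (d * (x * u))"
    by (simp add: assms ext mult.assoc)
  show ?thesis
    by (simp add: distrib_left distrib_right mult.assoc 1 2 3 4 scl_add_right add.assoc)
      (simp add: mult.commute)
qed

text \<open>Both symmetrizers between the cap and the cup are expanded at the joined strands. When
  \<open>m\<close> or \<open>n\<close> is 0, the truncated indices on the right come with
  coefficient 0.\<close>

lemma capS_cupS:
  "capS m n * cupS m n = scl (1 / (of_nat (Suc m) * of_nat (Suc n)))
    (symQP m n + scl (of_nat m * of_nat n) (cupS (m - 1) (n - 1) * capS (m - 1) (n - 1 :: nat) :: 'k::field_char_0 mor))"
proof -
  define f where "f = (wh [] (symQ m) (Dn # Ups (Suc n)) :: 'k mor)"
  define e where "e = (wh (Dns m @ [Dn, Up]) (symP n) [] :: 'k mor)"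
  \<comment> \<open>Without a further strand there is nothing to cross. The value 0 agrees with the
    vanishing coefficient in the recursion and commutes with everything, as does the one chosen for
    \<open>x\<close>.\<close>
  define d where "d = (if m = 0 then 0 else wh (Dns (m - 1)) dnX (Ups (Suc n)) :: 'k mor)"
  define x where "x = (if n = 0 then 0 else wh (Dns (Suc m)) upX (Ups (n - 1)) :: 'k mor)"
  have e': "e = wh (Dns (Suc m) @ [Up]) (symP n) []"
    by (simp add: e_def rep_simps)
  define cap where "cap = (wh (Dns m) capQP (Ups n) :: 'k mor)"
  define cup where "cup = (wh (Dns m) cupQP (Ups n) :: 'k mor)"
  define F where "F = (symQP m n :: 'k mor)"
  note inner = symQP_inner[where 'k = 'k, of m n, folded f_def e_def, folded cap_def F_def]
  have u: "f * (cup * F) = cup * F" "e * (cup * F) = cup * F"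
    using arg_cong[OF inner(2), of vrefl] arg_cong[OF inner(3), of vrefl]
    by (simp_all add: f_def e_def cup_def cap_def F_def)
  have S: "symQP (Suc m) (Suc n) = scl (1 / (of_nat (Suc m) * of_nat (Suc n)))
    ((f + scl (of_nat m) (f * d * f)) * (e + scl (of_nat n) (e * x * e)))"
  proof -
    have "wh [] (symQ (Suc m)) (Ups (Suc n)) = scl (1 / of_nat (Suc m))
      (f + scl (of_nat m) (f * d * f))"
      unfolding symQ_Suc by (simp add: wh_add wh_comp f_def d_def del: of_nat_Suc)
    moreover have "wh (Dns (Suc m)) (symP (Suc n)) [] = scl (1 / of_nat (Suc n))
      (e + scl (of_nat n) (e * x * e))"
      unfolding symP_Suc by (simp add: wh_add wh_comp e' x_def del: of_nat_Suc)
    ultimately show ?thesis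
      by (simp add: symQP_wh(1) mult.commute del: of_nat_Suc)
  qed
  have "capS m n * cupS m n = (F * cap) * symQP (Suc m) (Suc n) * (cup * F)"
    by (simp add: capS_def cupS_def F_def cap_def cup_def mult.assoc symQP_ext)
  also have "\<dots> = scl (1 / (of_nat (Suc m) * of_nat (Suc n)))
    ((F * cap) * ((f + scl (of_nat m) (f * d * f)) * (e + scl (of_nat n) (e * x * e))) * (cup * F))"
    unfolding S by (simp del: of_nat_Suc)
  also have "(F * cap) * ((f + scl (of_nat m) (f * d * f)) * (e + scl (of_nat n) (e * x * e))) * (cup * F)
    = (F * cap) * (cup * F) + scl (of_nat n) ((F * cap) * x * (cup * F))
      + scl (of_nat m) ((F * cap) * d * (cup * F))
      + scl (of_nat m * of_nat n) ((F * cap) * d * x * (cup * F))"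
  proof (rule sandwich_expand[OF inner(2,3) u inner(1)])
    show "d * e = e * d"
    proof (cases m)
      case (Suc m')
      show ?thesis
        using wh_exchange[OF Mor_dnX Mor_symP, of "Dns m'" "[Up]" n "[]"]
        by (simp add: d_def e' Suc rep_simps)
    qed (simp add: d_def)
    show "f * x = x * f"
    proof (cases n)
      case (Suc n')
      show ?thesis
        using wh_exchange[OF Mor_symQ Mor_upX, of "[]" m "[Dn]" "Ups n'"]
        by (simp add: f_def x_def Suc rep_simps)
    qed (simp add: x_def)
  qed
  \<comment> \<open>No crossing: the cap and the cup close to a counterclockwise circle.\<close>
  also have "(F * cap) * (cup * F) = F"
  proof -
    have "cap * cup = idm (Dns m @ Ups n)"
      by (simp add: cap_def cup_def capQP_cupQP flip: wh_comp)
    then show ?thesis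
      by (simp add: mult.assoc comp_ext2 F_def comp_idm_left[OF Mor_symQP] symQP_idem)
  qed
  \<comment> \<open>One crossing: it forms a curl on an upward strand here and on a downward strand
    in the next term.\<close>
  also have "scl (of_nat n) ((F * cap) * x * (cup * F)) = 0"
  proof (cases n)
    case (Suc n')
    have "cap * (x * cup) = 0"
      using wh_cong[OF left_curl_mor[where 'a = 'k], of "Dns m" "Ups n'"]
      by (simp add: cap_def cup_def x_def Suc wh_comp mult.assoc rep_simps)
    from comp_ext3[OF this] show ?thesis by (simp add: mult.assoc)
  qed simp
  also have "scl (of_nat m) ((F * cap) * d * (cup * F)) = 0"
  proof (cases m)
    case (Suc m')
    have "cap * (d * cup) = 0"
      using wh_cong[OF dn_curl[where 'a = 'k], of "Dns m'" "Ups n"]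
      by (simp add: cap_def cup_def d_def Suc wh_comp mult.assoc rep_simps)
    from comp_ext3[OF this] show ?thesis by (simp add: mult.assoc)
  qed simp
  \<comment> \<open>Both crossings: \<open>double_curl\<close> leaves a cup above a cap one strand
    further out on either side.\<close>
  also have "scl (of_nat m * of_nat n) ((F * cap) * d * x * (cup * F))
    = scl (of_nat m * of_nat n) (cupS (m - 1) (n - 1) * capS (m - 1) (n - 1))"
  proof (cases "m = 0 \<or> n = 0")
    case False
    then obtain m' n' where mn: "m = Suc m'" "n = Suc n'" by (metis not0_implies_Suc)
    have "cap * (d * (x * cup)) = wh (Dns m') cupQP (Ups n') * wh (Dns m') capQP (Ups n')"
      using wh_cong[OF double_curl[where 'a = 'k], of "Dns m'" "Ups n'"]
      by (simp add: cap_def cup_def d_def x_def mn wh_comp mult.assoc rep_simps)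
    then have "(F * cap) * d * x * (cup * F)
      = (F * wh (Dns m') cupQP (Ups n')) * (wh (Dns m') capQP (Ups n') * F)"
      by (metis mult.assoc)
    then show ?thesis by (simp add: capS_eq cupS_eq F_def mn)
  qed auto
  finally show ?thesis by (simp add: F_def)
qed

lemma Mor_capS: "capS m n \<in> Mor (Dns (Suc m) @ Ups (Suc n)) (Dns m @ Ups n)"
  unfolding capS_def
  by (rule Mor_cast, (rule Mor_comp' Mor_wh Mor_symQP Mor_capQP | (simp add: rep_simps; fail))+)

lemma Mor_XQPs: "XQPs m n \<in> Mor (Dns m @ Ups n) (Ups n @ Dns m)"
  unfolding XQPs_def
  by (rule Mor_cast, (rule Mor_comp' Mor_symQP Mor_symPQ Mor_XQsPs | (simp add: rep_simps; fail))+)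

lemma capS_XPQs: "capS m n * XPQs (Suc m) (Suc n) = 0"
  by (simp add: capS_eq XPQs_def mult.assoc symQP_ext comp_ext2[OF symQP_XPsQs] symPQ_idem
      comp_ext2[OF capQP_XPsQs])

lemma XQPs_cupS: "XQPs (Suc m) (Suc n) * cupS m n = 0"
  using arg_cong[OF capS_XPQs, of vrefl m n] by simp

lemma XQPs_XPQs: "XQPs m n * XPQs m n = symPQ m n"
  by (simp add: XQPs_def XPQs_def mult.assoc symQP_ext comp_ext2[OF symQP_XPsQs]
      comp_ext2[OF XQsPs_XPsQs] symPQ_idem comp_idm_left[OF Mor_symPQ] symPQ_ext)

lemma thick_absorb [simp]:
  "XQPs m n * symQP m n = XQPs m n" "symPQ m n * XQPs m n = XQPs m n"
  "XPQs m n * symPQ m n = XPQs m n" "symQP m n * XPQs m n = XPQs m n"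
  by (simp_all add: XQPs_def XPQs_def mult.assoc symQP_idem symPQ_idem symQP_ext symPQ_ext)

lemma XPQs_XQPs: "XPQs m n * XQPs m n = symQP m n * (XPsQs n m * XQsPs m n) * symQP m n"
  by (simp add: XQPs_def XPQs_def mult.assoc symPQ_ext symQP_ext
      comp_ext2[OF XQsPs_symQP[symmetric]] comp_ext2[OF symQP_XPsQs[symmetric]] symQP_idem)

lemma XPsQs_0 [simp]: "XPsQs 0 a = idm (Dns a)" "XQsPs a 0 = idm (Dns a)"
proof -
  show *: "XPsQs 0 a = idm (Dns a)" for a
    by (induction a) (simp_all add: XPsQs_Suc rep_simps)
  show "XQsPs a 0 = idm (Dns a)"
    using arg_cong[OF *, of vrefl a] by simp
qed

lemma XPQs_XQPs_0: "m = 0 \<or> n = 0 \<Longrightarrow> XPQs m n * XQPs m n = symQP m n"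
  by (auto simp: XPQs_XQPs comp_idm_left[OF Mor_symQP] comp_idm_right[OF Mor_symQP] symQP_idem
      comp_idm_left[OF Mor_symQP, simplified] comp_idm_right[OF Mor_symQP, simplified] mult.assoc
      comp_idm_right[OF Mor_symQP[of m 0], simplified]comp_idm_right[OF Mor_symQP[of 0 n], simplified]
      comp_idm_left[OF Mor_symQP[of m 0], simplified]comp_idm_left[OF Mor_symQP[of 0 n], simplified])

lemma symQP_minus_XPQs_XQPs:
  "\<exists>g. symQP (Suc m) (Suc n) - XPQs (Suc m) (Suc n) * XQPs (Suc m) (Suc n)
    = cupS m n * (g :: 'k::field_char_0 mor)"
proof -
  let ?F = "symQP (Suc m) (Suc n) :: 'k mor"
  obtain g where g: "?F * (idm (Dns (Suc m) @ Ups (Suc n)) - XPsQs (Suc n) (Suc m) * XQsPs (Suc m) (Suc n))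
    = ?F * (wh (Dns m) cupQP (Ups n) * g)"
    using cup_factor[of "Suc m" n] by auto
  have "?F - XPQs (Suc m) (Suc n) * XQPs (Suc m) (Suc n)
    = ?F * (idm (Dns (Suc m) @ Ups (Suc n)) - XPsQs (Suc n) (Suc m) * XQsPs (Suc m) (Suc n)) * ?F"
    unfolding XPQs_XQPs right_diff_distrib left_diff_distrib comp_idm_right[OF Mor_symQP] symQP_idem
    by (simp add: mult.assoc)
  also have "\<dots> = cupS m n * (g * ?F)"
    unfolding g by (simp add: cupS_eq mult.assoc)
  finally show ?thesis by blast
qed

section \<open>Iterated thick caps and cups\<close>

primrec capSs :: "nat \<Rightarrow> nat \<Rightarrow> nat \<Rightarrow> 'k::field_char_0 mor" where
  "capSs m n 0 = symQP m n"
| "capSs m n (Suc s) = capSs m n s * capS (m + s) (n + s)"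

primrec cupSs :: "nat \<Rightarrow> nat \<Rightarrow> nat \<Rightarrow> 'k::field_char_0 mor" where
  "cupSs m n 0 = symQP m n"
| "cupSs m n (Suc s) = cupS (m + s) (n + s) * cupSs m n s"

lemma vrefl_capSs [simp]: "vrefl (capSs m n s) = cupSs m n s"
  and vrefl_cupSs [simp]: "vrefl (cupSs m n s) = capSs m n s"
  by (induction s) simp_all

lemma Mor_capSs: "capSs m n s \<in> Mor (Dns (m + s) @ Ups (n + s)) (Dns m @ Ups n)"
proof (induction s)
  case (Suc s)
  show ?case unfolding capSs.simps
    by (rule Mor_cast, (rule Mor_comp' Suc Mor_capS | (simp; fail))+)
qed (simp add: Mor_symQP)

lemma capSs_symQP [simp]: "capSs m n s * symQP (m + s) (n + s) = capSs m n s"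
  by (induction s) (simp_all add: symQP_idem mult.assoc)

lemma symQP_cupSs [simp]: "symQP (m + s) (n + s) * cupSs m n s = cupSs m n s"
  by (induction s) (simp_all add: symQP_idem flip: mult.assoc)

lemma cupSs_symQP: "cupSs m n s * symQP m n = cupSs m n s"
  by (induction s) (simp_all add: symQP_idem mult.assoc)

text \<open>By \<open>capS_eq\<close> the symmetrizers between successive caps disappear, leaving
  nested caps above a single symmetrizer.\<close>

lemma capSs_caps:
  "capSs m n s = wh (Dns m) (caps s) (Ups n) * (symQP (m + s) (n + s) :: 'k::field_char_0 mor)"
proof (induction s)
  case 0
  then show ?case by (simp add: comp_idm_left[OF Mor_symQP])
next
  case (Suc s)
  have "capSs m n (Suc s) = wh (Dns m) (caps s) (Ups n) * (symQP (m + s) (n + s) * capS (m + s) (n + s) :: 'k mor)"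
    by (simp add: Suc mult.assoc)
  also have "\<dots> = wh (Dns m) (caps s) (Ups n) * (wh (Dns (m + s)) capQP (Ups (n + s)) * symQP (Suc (m + s)) (Suc (n + s)))"
    by (simp only: capS_symQP(2)) (simp only: capS_eq)
  also have "\<dots> = wh (Dns m) (caps (Suc s)) (Ups n) * symQP (m + Suc s) (n + Suc s)"
    by (simp add: wh_comp wh_def[of "Dns s", symmetric] rep_simps add.commute mult.assoc)
  finally show ?case .
qed

text \<open>The scalar a_s in c d^(s+1) y = a_s d^s y. By \<open>capS_cupS\<close> its numerator
  starts at 1 and grows by 1 with each further d, because the factor (m+s)(n+s) cancels the previous
  denominator.\<close>

definition capcup_coeff :: "nat \<Rightarrow> nat \<Rightarrow> nat \<Rightarrow> 'k::field_char_0" where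
  "capcup_coeff m n s = of_nat (Suc s) / (of_nat (Suc (m + s)) * of_nat (Suc (n + s)))"

lemma capS_cupSs_XPQs:
  "capS (m + s) (n + s) * (cupSs m n (Suc s) * XPQs m n)
    = scl (capcup_coeff m n s) (cupSs m n s * (XPQs m n :: 'k::field_char_0 mor))"
proof (induction s)
  case 0
  \<comment> \<open>The second term of \<open>capS_cupS\<close> ends in c y, which vanishes.\<close>
  have "scl (of_nat m * of_nat n) (cupS (m - 1) (n - 1) * capS (m - 1) (n - 1) * (XPQs m n :: 'k mor)) = 0"
  proof (cases "m = 0 \<or> n = 0")
    case False
    then obtain m' n' where "m = Suc m'" "n = Suc n'" by (metis not0_implies_Suc)
    then show ?thesis by (simp add: mult.assoc capS_XPQs)
  qed auto
  then show ?case
    by (simp add: capcup_coeff_def comp_ext2[OF capS_cupS] distrib_right mult.assoc symQP_ext)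
next
  case (Suc s)
  let ?k = "m + Suc s" and ?l = "n + Suc s"
  let ?c = "1 / (of_nat (Suc ?k) * of_nat (Suc ?l)) :: 'k"
  have "capS ?k ?l * (cupSs m n (Suc (Suc s)) * XPQs m n)
    = capS ?k ?l * cupS ?k ?l * (cupSs m n (Suc s) * (XPQs m n :: 'k mor))"
    by (simp add: mult.assoc)
  also have "\<dots> = scl ?c (symQP ?k ?l * (cupSs m n (Suc s) * XPQs m n)
      + scl (of_nat ?k * of_nat ?l) (cupS (m + s) (n + s) * (capS (m + s) (n + s) * (cupSs m n (Suc s) * XPQs m n))))"
    unfolding capS_cupS by (simp add: distrib_right mult.assoc del: cupSs.simps of_nat_Suc)
  also have "symQP ?k ?l * (cupSs m n (Suc s) * XPQs m n) = cupSs m n (Suc s) * XPQs m n"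
    by (rule comp_ext2[OF symQP_cupSs])
  also have "scl (of_nat ?k * of_nat ?l) (cupS (m + s) (n + s) * (capS (m + s) (n + s) * (cupSs m n (Suc s) * XPQs m n)))
    = scl (of_nat (Suc s)) (cupSs m n (Suc s) * (XPQs m n :: 'k mor))"
    unfolding Suc by (simp add: capcup_coeff_def mult.assoc del: of_nat_Suc)
  also have "scl ?c (cupSs m n (Suc s) * XPQs m n + scl (of_nat (Suc s)) (cupSs m n (Suc s) * XPQs m n))
    = scl (?c * (1 + of_nat (Suc s))) (cupSs m n (Suc s) * (XPQs m n :: 'k mor))"
    by (simp only: scl_add_left scl_add_right scl_scl distrib_left mult_1_right)
  also have "?c * (1 + of_nat (Suc s)) = capcup_coeff m n (Suc s)"
    by (simp add: capcup_coeff_def)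
  finally show ?case .
qed

lemma capSs_cupSs_XPQs:
  "capSs (m + d) (n + d) s * (cupSs m n (d + s) * XPQs m n)
    = scl (\<Prod>i<s. capcup_coeff m n (d + i)) (cupSs m n d * (XPQs m n :: 'k::field_char_0 mor))"
proof (induction s)
  case 0
  then show ?case by (simp add: comp_ext2[OF symQP_cupSs])
next
  case (Suc s)
  have "capSs (m + d) (n + d) (Suc s) * (cupSs m n (d + Suc s) * (XPQs m n :: 'k mor))
    = capSs (m + d) (n + d) s * (capS (m + (d + s)) (n + (d + s)) * (cupSs m n (Suc (d + s)) * XPQs m n))"
    by (simp add: mult.assoc add.assoc)
  also have "\<dots> = scl (capcup_coeff m n (d + s)) (capSs (m + d) (n + d) s * (cupSs m n (d + s) * XPQs m n))"
    unfolding capS_cupSs_XPQs by simp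
  finally show ?case by (simp add: Suc mult.commute)
qed

definition iota_coeff :: "nat \<Rightarrow> nat \<Rightarrow> nat \<Rightarrow> 'k::field_char_0" where
  "iota_coeff m n s = of_nat (((n + s) choose s) * ((m + s) choose s) * fact s)"

lemma choose_Suc_real: "of_nat (Suc (n + s) choose Suc s) * of_nat (Suc s)
    = of_nat (Suc (n + s)) * (of_nat ((n + s) choose s) :: 'k::field_char_0)"
  using Suc_times_binomial_eq[of "n + s" s] by (metis of_nat_mult mult.commute)

text \<open>The product equals s! m! n! / ((m+s)! (n+s)!), the inverse of the two binomials times
  s!, where \<open>m\<close> and \<open>n\<close> count the strands left after \<open>s\<close>
  caps.\<close>

lemma iota_coeff_prod: "iota_coeff m n s * (\<Prod>i<s. capcup_coeff m n i) = (1 :: 'k::field_char_0)"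
proof (induction s)
  case 0
  then show ?case by (simp add: iota_coeff_def)
next
  case (Suc s)
  have "iota_coeff m n (Suc s) * of_nat (Suc s)
    = iota_coeff m n s * (of_nat (Suc (m + s)) * of_nat (Suc (n + s)) :: 'k)"
  proof -
    let ?A = "of_nat (Suc (n + s) choose Suc s) :: 'k" and ?B = "of_nat (Suc (m + s) choose Suc s) :: 'k"
      and ?S = "of_nat (Suc s) :: 'k" and ?f = "of_nat (fact s) :: 'k"
    have "iota_coeff m n (Suc s) * ?S = (?A * ?S) * (?B * ?S) * ?f"
      by (simp only: iota_coeff_def fact_Suc of_nat_mult of_nat_id add_Suc_right mult_ac)
    then show ?thesis
      unfolding choose_Suc_real by (simp only: iota_coeff_def of_nat_mult mult_ac)
  qed
  then have "iota_coeff m n (Suc s) * capcup_coeff m n s = (iota_coeff m n s :: 'k)"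
    by (simp add: capcup_coeff_def field_simps del: of_nat_Suc)
  then show ?case using Suc by (simp add: mult.assoc[symmetric] mult.commute[of _ "capcup_coeff m n s"])
qed

section \<open>Orthonormality and completeness\<close>

definition rhoS :: "nat \<Rightarrow> nat \<Rightarrow> nat \<Rightarrow> 'k::field_char_0 mor" where
  "rhoS m n s = XQPs (m - s) (n - s) * capSs (m - s) (n - s) s"

definition iotaS :: "nat \<Rightarrow> nat \<Rightarrow> nat \<Rightarrow> 'k::field_char_0 mor" where
  "iotaS m n s = scl (of_nat ((n choose s) * (m choose s) * fact s))
    (cupSs (m - s) (n - s) s * XPQs (m - s) (n - s))"

lemma rhoS_absorb:
  "s \<le> m \<Longrightarrow> s \<le> n \<Longrightarrow> rhoS m n s * symQP m n = rhoS m n s"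
  "symPQ (m - s) (n - s) * rhoS m n s = rhoS m n s"
  using capSs_symQP[where 'a = 'a, of "m - s" "n - s" s]
  by (simp_all add: rhoS_def mult.assoc comp_ext2[OF thick_absorb(2)])

lemma iotaS_absorb:
  "s \<le> m \<Longrightarrow> s \<le> n \<Longrightarrow> symQP m n * iotaS m n s = iotaS m n s"
  "iotaS m n s * symPQ (m - s) (n - s) = iotaS m n s"
  using comp_ext2[OF symQP_cupSs[where 'a = 'a, of "m - s" s "n - s"]]
  by (simp_all add: iotaS_def mult.assoc)

text \<open>The \<open>s\<close> caps consume \<open>s\<close> of the \<open>t\<close> cups, and x d
  = 0 kills the rest. The scalar of \<open>iotaS\<close> is left out so that the reflected statement
  covers the opposite inequality.\<close>

lemma rhoS_iotaS_less:
  assumes "s < t" "t \<le> m" "t \<le> n"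
  shows "rhoS m n s * (cupSs (m - t) (n - t) t * XPQs (m - t) (n - t)) = (0 :: 'k::field_char_0 mor)"
proof -
  from less_imp_Suc_add[OF assms(1)] obtain d where t: "t = Suc d + s" by auto
  define m' n' where "m' = m - t" and "n' = n - t"
  have m: "m - s = m' + Suc d" "n - s = n' + Suc d" "m - t = m'" "n - t = n'"
    using assms by (auto simp: m'_def n'_def t)
  show ?thesis
    unfolding rhoS_def m unfolding t mult.assoc capSs_cupSs_XPQs
    by (simp add: mult.assoc comp_ext2[OF XQPs_cupS])
qed

lemma rhoS_iotaS_same:
  assumes "t \<le> m" "t \<le> n"
  shows "rhoS m n t * iotaS m n t = (symPQ (m - t) (n - t) :: 'k::field_char_0 mor)"
proof -
  define m' n' where "m' = m - t" and "n' = n - t"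
  have m: "m = m' + t" "n = n' + t" "m - t = m'" "n - t = n'"
    using assms by (auto simp: m'_def n'_def)
  have "XQPs m' n' * (capSs m' n' t * (cupSs m' n' t * XPQs m' n'))
    = scl (\<Prod>i<t. capcup_coeff m' n' i) (symPQ m' n' :: 'k mor)"
    using capSs_cupSs_XPQs[of m' 0 n' t, where 'k = 'k] by (simp add: XQPs_XPQs)
  then have "rhoS m n t * iotaS m n t = scl (iota_coeff m' n' t * (\<Prod>i<t. capcup_coeff m' n' i)) (symPQ m' n' :: 'k mor)"
    unfolding rhoS_def iotaS_def m(3,4) unfolding m(1,2) iota_coeff_def by (simp add: mult.assoc)
  then show ?thesis by (simp add: iota_coeff_prod m)
qed

lemma rhoS_iotaS:
  assumes "s \<le> min m n" "t \<le> min m n"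
  shows "rhoS m n s * iotaS m n t = (if s = t then symPQ (m - t) (n - t) else 0 :: 'k::field_char_0 mor)"
proof -
  consider "s = t" | "s < t" | "t < s" by linarith
  then show ?thesis
  proof cases
    case 1
    then show ?thesis using assms by (simp add: rhoS_iotaS_same)
  next
    case 2
    then show ?thesis using assms rhoS_iotaS_less[of s t m n, where 'k = 'k] by (simp add: iotaS_def)
  next
    case 3
    then have "rhoS m n t * (cupSs (m - s) (n - s) s * XPQs (m - s) (n - s)) = (0 :: 'k mor)"
      using assms by (intro rhoS_iotaS_less) auto
    from arg_cong[OF this, of vrefl] 3 show ?thesis
      by (simp add: rhoS_def iotaS_def mult.assoc)
  qed
qed

lemma sum_iotaS_rhoS: "(\<Sum>s\<le>min m n. iotaS m n s * rhoS m n s) = (symQP m n :: 'k::field_char_0 mor)"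
proof (induction "min m n" arbitrary: m n)
  case 0
  then have "m = 0 \<or> n = 0" by linarith
  then show ?case using XPQs_XQPs_0[of m n, where 'a = 'k] 
    by (auto simp: iotaS_def rhoS_def mult.assoc symQP_idem comp_ext2[OF thick_absorb(4)])
next
  case (Suc r)
  then obtain m' n' where mn: "m = Suc m'" "n = Suc n'" "r = min m' n'"
    by (metis Suc_inject min_Suc_Suc min_0L min_0R not0_implies_Suc nat.distinct(1))
  let ?Z = "symQP m n - (\<Sum>s\<le>min m n. iotaS m n s * rhoS m n s) :: 'k mor"
  \<comment> \<open>Orthonormality gives that \<open>?Z\<close> kills \<open>iotaS m n t\<close>.
    The scalar can be divided out, since its binomials are positive for these \<open>t\<close> and
    the characteristic is zero.\<close>
  have Z: "?Z * (cupSs (m - t) (n - t) t * XPQs (m - t) (n - t)) = 0" if t: "t \<le> min m n" for t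
  proof -
    let ?v = "cupSs (m - t) (n - t) t * XPQs (m - t) (n - t) :: 'k mor"
    have "?Z * iotaS m n t = iotaS m n t - (\<Sum>s\<le>min m n. iotaS m n s * (rhoS m n s * iotaS m n t))"
      using t by (simp add: left_diff_distrib iotaS_absorb sum_distrib_right mult.assoc)
    also have "(\<Sum>s\<le>min m n. iotaS m n s * (rhoS m n s * iotaS m n t))
      = (\<Sum>s\<le>min m n. if s = t then iotaS m n t else (0 :: 'k mor))"
      using t by (intro sum.cong) (auto simp: rhoS_iotaS iotaS_absorb)
    also have "\<dots> = iotaS m n t" using t by simp
    finally have "scl (of_nat ((n choose t) * (m choose t) * fact t)) (?Z * ?v) = 0"
      by (simp add: iotaS_def)
    moreover have "of_nat ((n choose t) * (m choose t) * fact t) \<noteq> (0 :: 'k)"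
      using t by (auto simp: binomial_eq_0_iff)
    ultimately show ?thesis
      by (metis scl_scl scl_one scl_zero_right left_inverse)
  qed
  \<comment> \<open>The induction hypothesis decomposes the identity below
    \<open>cupS m' n'\<close>, and a cup after the \<open>s\<close>-th inclusion is a multiple of
    the \<open>Suc s\<close>-th inclusion of the larger object.\<close>
  have Zcup: "?Z * cupS m' n' = 0"
  proof -
    have "?Z * cupS m' n' = ?Z * cupS m' n' * (\<Sum>s\<le>min m' n'. iotaS m' n' s * rhoS m' n' s)"
      using Suc.hyps(1)[OF mn(3)] by (simp add: mult.assoc)
    also have "\<dots> = (\<Sum>s\<le>min m' n'. ?Z * cupS m' n' * (iotaS m' n' s * rhoS m' n' s))"
      by (rule sum_distrib_left)
    also have "\<dots> = 0"
    proof (rule sum.neutral, rule ballI)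
      fix s assume "s \<in> {..min m' n'}"
      then have s: "s \<le> m'" "s \<le> n'" by auto
      then have "cupS m' n' * cupSs (m' - s) (n' - s) s = (cupSs (m - Suc s) (n - Suc s) (Suc s) :: 'k mor)"
        by (simp add: mn)
      then have "cupS m' n' * iotaS m' n' s = scl (of_nat ((n' choose s) * (m' choose s) * fact s))
        (cupSs (m - Suc s) (n - Suc s) (Suc s) * (XPQs (m - Suc s) (n - Suc s) :: 'k mor))"
        by (simp add: iotaS_def mn del: cupSs.simps flip: mult.assoc)
      then have "?Z * (cupS m' n' * iotaS m' n' s) = 0"
        using Z[of "Suc s"] s by (simp add: mn del: cupSs.simps)
      from comp_ext3[OF this] show "?Z * cupS m' n' * (iotaS m' n' s * rhoS m' n' s) = 0"
        by (simp add: mult.assoc)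
    qed
    finally show ?thesis .
  qed
  obtain g where g: "symQP m n - XPQs m n * XQPs m n = cupS m' n' * (g :: 'k mor)"
    using symQP_minus_XPQs_XQPs unfolding mn by blast
  have Z0: "?Z * XPQs m n = 0"
    using Z[of 0] by (simp only: cupSs.simps diff_zero thick_absorb(4) le0 simp_thms)
  have "?Z = ?Z * symQP m n"
    by (simp add: left_diff_distrib symQP_idem sum_distrib_right mult.assoc rhoS_absorb)
  moreover have "symQP m n = XPQs m n * XQPs m n + cupS m' n' * g"
    using g by (simp add: algebra_simps)
  moreover have "?Z * (XPQs m n * XQPs m n + cupS m' n' * g) = 0"
    unfolding distrib_left comp_ext2[OF Z0] comp_ext2[OF Zcup] by simp
  ultimately have "?Z = 0" by metis
  then show ?case by simp
qed

section \<open>Matrices and isomorphisms in the Karoubi envelope\<close>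

declare One_nat_def [simp del]  \<comment> \<open>keeps \<open>single\<close> foldable\<close>

lemma single_mult: "single f * single g = single (f * g)"
  by (rule eq_matI) (auto simp: scalar_prod_def One_nat_def)

lemma kron_single: "kron (single f) (single g) = single (f \<boxtimes> g)"
  by (rule eq_matI) (auto simp: kron_def)

lemma QQ_PP: "QQ m \<otimes>\<^sub>H PP n = ([Dns m @ Ups n], single (symQP m n))"
  by (simp add: htens_def QQ_def PP_def atens_def kron_single symQP_def)

lemma PP_QQ: "PP n \<otimes>\<^sub>H QQ m = ([Ups n @ Dns m], single (symPQ m n))"
  by (simp add: htens_def QQ_def PP_def atens_def kron_single symPQ_def)

lemma single_AMor: "single f \<in> AMor [V] [W] \<longleftrightarrow> f \<in> Mor V W"
  by (simp add: AMor_def One_nat_def)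

lemma single_HMor:
  "f \<in> Mor V W \<Longrightarrow> p * f * e = f \<Longrightarrow> single f \<in> HMor ([V], single e) ([W], single p)"
  by (simp add: HMor_def single_AMor single_mult)

lemma vrefl_caps [simp]: "vrefl (caps s) = cups s"
  by (induction s) simp_all

lemma symQP_capSs: "symQP m n * capSs m n s = capSs m n s"
  using arg_cong[OF cupSs_symQP, of vrefl m n s] by simp

text \<open>\<open>rhoS\<close> has symmetrizers at every stage, \<open>rho\<close> only at its two
  ends; the intermediate ones are absorbed.\<close>

lemma rhoS_eq:
  assumes "s \<le> m" "s \<le> n"
  shows "rhoS m n s = symPQ (m - s) (n - s)
    * (XQsPs (m - s) (n - s) * wh (Dns (m - s)) (caps s) (Ups (n - s))) * symQP m n"
  using assms by (simp add: rhoS_def XQPs_def mult.assoc symQP_capSs) (simp add: capSs_caps)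

lemma iotaS_vrefl:
  "iotaS m n s = scl (of_nat ((n choose s) * (m choose s) * fact s)) (vrefl (rhoS m n s))"
  by (simp add: iotaS_def rhoS_def)

lemma rho_single: "s \<le> m \<Longrightarrow> s \<le> n \<Longrightarrow> rho m n s = single (rhoS m n s)"
  by (simp add: rho_def QQ_PP PP_QQ single_mult rhoS_eq wh_def mult.assoc)

lemma iota_single: "s \<le> m \<Longrightarrow> s \<le> n \<Longrightarrow> iota m n s = single (iotaS m n s)"
  by (rule eq_matI)
    (auto simp: iota_def QQ_PP PP_QQ single_mult iotaS_vrefl rhoS_eq mult.assoc simp flip: wh_def)

lemma Mor_rhoS:
  assumes "s \<le> m" "s \<le> n"
  shows "rhoS m n s \<in> Mor (Dns m @ Ups n) (Ups (n - s) @ Dns (m - s))"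
  using Mor_comp[OF Mor_XQPs Mor_capSs, of "m - s" "n - s" s] assms by (simp add: rhoS_def)

lemma Mor_iotaS:
  assumes "s \<le> m" "s \<le> n"
  shows "iotaS m n s \<in> Mor (Ups (n - s) @ Dns (m - s)) (Dns m @ Ups n)"
  unfolding iotaS_vrefl by (intro Mor_scl Mor_vrefl Mor_rhoS assms)

lemma diag_block_mat_single:
  "diag_block_mat (map (\<lambda>i. single (p i)) [0..<k]) = mat k k (\<lambda>(i, j). if i = j then p i else 0)"
proof (induction k)
  case (Suc k)
  show ?case
    unfolding upt_Suc_append[OF le0] map_append list.map diag_block_mat_last Let_def Suc
    by (rule eq_matI) (auto simp: less_Suc_eq)
qed auto

text \<open>The isomorphism is the column of the \<open>r i\<close>, its inverse the row of the
  \<open>q i\<close>. Idempotency of \<open>e\<close> and of the block matrix is deduced from the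
  two composites.\<close>

lemma hiso_hdsum:
  fixes p :: "nat \<Rightarrow> 'k::field_char_0 mor"
  assumes e: "e \<in> Mor V V" and p: "\<And>i. i < k \<Longrightarrow> p i \<in> Mor (W i) (W i)"
    and r: "\<And>i. i < k \<Longrightarrow> r i \<in> Mor V (W i)" "\<And>i. i < k \<Longrightarrow> r i * e = r i"
    and q: "\<And>i. i < k \<Longrightarrow> q i \<in> Mor (W i) V" "\<And>i. i < k \<Longrightarrow> e * q i = q i"
    and rq: "\<And>i j. i < k \<Longrightarrow> j < k \<Longrightarrow> r i * q j = (if i = j then p i else 0)"
    and qr: "(\<Sum>i<k. q i * r i) = e"
  shows "([V], single e) \<cong>\<^sub>H hdsum (map (\<lambda>i. ([W i], single (p i))) [0..<k])"
proof -
  define f where "f = mat k 1 (\<lambda>(i, j). r i)"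
  define g where "g = mat 1 k (\<lambda>(i, j). q j)"
  define D where "D = mat k k (\<lambda>(i, j). if i = j then p i else 0)"
  have [simp]: "f \<in> carrier_mat k 1" "g \<in> carrier_mat 1 k" "single e \<in> carrier_mat 1 1"
    by (simp_all add: f_def g_def)
  have ds: "hdsum (map (\<lambda>i. ([W i], single (p i))) [0..<k]) = (map W [0..<k], D)"
    by (simp add: hdsum_def D_def diag_block_mat_single o_def concat_map_singleton)
  have ee: "e * e = e"
    unfolding qr[symmetric] sum_distrib_right by (simp add: qr mult.assoc r)
  have gf: "g * f = single e"
    by (rule eq_matI) (auto simp: f_def g_def scalar_prod_def qr[symmetric] atLeast0LessThan One_nat_def)
  have fg: "f * g = D"
    by (rule eq_matI) (auto simp: f_def g_def D_def scalar_prod_def rq One_nat_def)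
  have fe: "f * single e = f"
    by (rule eq_matI) (auto simp: f_def scalar_prod_def r One_nat_def)
  have eg: "single e * g = g"
    by (rule eq_matI) (auto simp: g_def scalar_prod_def q One_nat_def)
  have Df: "D * f = f"
    unfolding fg[symmetric] by (subst assoc_mult_mat[of _ k 1 _ k _ 1]) (auto simp: gf fe)
  have gD: "g * D = g"
    unfolding fg[symmetric] by (subst assoc_mult_mat[symmetric, of _ 1 k _ 1 _ k]) (auto simp: gf eg)
  have DD: "D * D = D"
  proof -
    have "D \<in> carrier_mat k k" by (simp add: D_def)
    then have "D * (f * g) = D * f * g"
      by (intro assoc_mult_mat[symmetric, of _ k k _ 1 _ k]) auto
    then show ?thesis by (simp add: Df fg)
  qed
  have "([V], single e) \<in> HOb"
    by (simp add: HOb_def single_AMor e single_mult ee)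
  moreover have "(map W [0..<k], D) \<in> HOb"
    using DD by (auto simp: HOb_def AMor_def D_def p Mor_zero)
  moreover have "f \<in> HMor ([V], single e) (map W [0..<k], D)"
  proof -
    have "f $$ (i, 0) \<in> Mor V (W i)" if "i < k" for i
      using that by (simp add: f_def r)
    then show ?thesis by (simp add: HMor_def AMor_def Df fe) (simp flip: One_nat_def)
  qed
  moreover have "g \<in> HMor (map W [0..<k], D) ([V], single e)"
  proof -
    have "g $$ (0, i) \<in> Mor (W i) V" if "i < k" for i
      using that by (simp add: g_def q)
    then show ?thesis by (simp add: HMor_def AMor_def eg gD) (simp flip: One_nat_def)
  qed
  ultimately show ?thesis
    unfolding ds hiso_def using gf fg by auto
qed

theorem proposition4p6:
  fixes m n :: nat
    and \<rho> \<iota> :: "nat \<Rightarrow> 'k::field_char_0 mor mat"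
    and QP :: "'k hobj" and PQ :: "nat \<Rightarrow> 'k hobj"
  assumes "n \<ge> 1" and "m \<ge> 1"
  defines "\<rho> \<equiv> rho m n" and "\<iota> \<equiv> iota m n"
    and "QP \<equiv> QQ m \<otimes>\<^sub>H PP n"
    and "PQ \<equiv> (\<lambda>s. PP (n - s) \<otimes>\<^sub>H QQ (m - s))"
  shows "(\<forall>s \<le> min m n. \<rho> s \<in> HMor QP (PQ s) \<and> \<iota> s \<in> HMor (PQ s) QP)
    \<and> (\<forall>s \<le> min m n. \<forall>t \<le> min m n.
         \<rho> s * \<iota> t = (if s = t then hid (PQ t) else hzero (PQ t) (PQ s)))
    \<and> hid QP = hsum QP QP {0..min m n} (\<lambda>s. \<iota> s * \<rho> s)
    \<and> QP \<cong>\<^sub>H hdsum (map PQ [0..<Suc (min m n)])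
    \<and> QP \<cong>\<^sub>H hdsum [PP n \<otimes>\<^sub>H QQ m, QQ (m - 1) \<otimes>\<^sub>H PP (n - 1)]"
proof (intro conjI allI impI)
  have QP: "QP = ([Dns m @ Ups n], single (symQP m n))"
    by (simp add: QP_def QQ_PP)
  have PQ: "PQ s = ([Ups (n - s) @ Dns (m - s)], single (symPQ (m - s) (n - s)))" for s
    by (simp add: PQ_def PP_QQ)
  have \<rho>: "\<rho> s = single (rhoS m n s)" and \<iota>: "\<iota> s = single (iotaS m n s)" if "s \<le> min m n" for s
    using that by (simp_all add: \<rho>_def \<iota>_def rho_single iota_single)
  fix s assume s: "s \<le> min m n"
  then have sm: "s \<le> m" "s \<le> n" by auto
  show "\<rho> s \<in> HMor QP (PQ s)"
    unfolding \<rho>[OF s] QP PQ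
    by (rule single_HMor) (use sm in \<open>simp_all add: Mor_rhoS rhoS_absorb mult.assoc\<close>)
  show "\<iota> s \<in> HMor (PQ s) QP"
    unfolding \<iota>[OF s] QP PQ
    by (rule single_HMor) (use sm in \<open>simp_all add: Mor_iotaS iotaS_absorb mult.assoc\<close>)
  fix t assume t: "t \<le> min m n"
  show "\<rho> s * \<iota> t = (if s = t then hid (PQ t) else hzero (PQ t) (PQ s))"
    unfolding \<rho>[OF s] \<iota>[OF t] PQ single_mult rhoS_iotaS[OF s t]
    by (auto simp: hzero_def)
next
  have "hsum QP QP {0..min m n} (\<lambda>s. \<iota> s * \<rho> s) = single (\<Sum>s\<le>min m n. iotaS m n s * rhoS m n s)"
    by (rule eq_matI)
      (auto simp: hsum_def QP_def QQ_PP \<rho>_def \<iota>_def rho_single iota_single single_mult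
        atLeast0AtMost intro!: sum.cong)
  then show "hid QP = hsum QP QP {0..min m n} (\<lambda>s. \<iota> s * \<rho> s)"
    by (simp add: sum_iotaS_rhoS QP_def QQ_PP)
next
  show "QP \<cong>\<^sub>H hdsum (map PQ [0..<Suc (min m n)])"
    unfolding QP_def PQ_def QQ_PP PP_QQ
  proof (rule hiso_hdsum[where r = "rhoS m n" and q = "iotaS m n"])
    show "(\<Sum>i<Suc (min m n). iotaS m n i * rhoS m n i) = (symQP m n :: 'k mor)"
      unfolding lessThan_Suc_atMost by (rule sum_iotaS_rhoS)
  qed (auto simp: Mor_symQP Mor_symPQ Mor_rhoS Mor_iotaS rhoS_absorb iotaS_absorb rhoS_iotaS less_Suc_eq_le)
next
  obtain m' n' where mn: "m = Suc m'" "n = Suc n'"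
    using assms(1,2) by (metis One_nat_def Suc_le_D)
  let ?I = "{..min m' n'}"
  \<comment> \<open>The complement of summand 0 has the same summands as the smaller object, shifted
    by one. \<open>?r\<close> projects onto index \<open>Suc s\<close> and reinserts by the
    \<open>s\<close>-th inclusion of the smaller object; \<open>?q\<close> goes back.\<close>
  let ?r = "\<Sum>s\<in>?I. iotaS m' n' s * rhoS m n (Suc s) :: 'k mor"
  let ?q = "\<Sum>s\<in>?I. iotaS m n (Suc s) * rhoS m' n' s :: 'k mor"
  have d: "m - Suc s = m' - s" "n - Suc s = n' - s" for s by (simp_all add: mn)
  \<comment> \<open>Orthonormality of the middle factors reduces the double sum to its diagonal. It
    serves both composites of \<open>?r\<close> and \<open>?q\<close>.\<close>
  have sums: "(\<Sum>s\<in>?I. a s * b s) * (\<Sum>s\<in>?I. c s * h s) = (\<Sum>s\<in>?I. a s * h s)"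
    if bc: "\<And>s t. s \<in> ?I \<Longrightarrow> t \<in> ?I \<Longrightarrow> b s * c t = (if s = t then symPQ (m' - t) (n' - t) else 0)"
      and h: "\<And>s. s \<in> ?I \<Longrightarrow> symPQ (m' - s) (n' - s) * h s = h s"
    for a b c h :: "nat \<Rightarrow> 'k mor"
  proof -
    have "(\<Sum>s\<in>?I. a s * b s) * (\<Sum>s\<in>?I. c s * h s) = (\<Sum>s\<in>?I. \<Sum>t\<in>?I. a s * (b s * c t * h t))"
      by (simp add: sum_product mult.assoc)
    also have "\<dots> = (\<Sum>s\<in>?I. \<Sum>t\<in>?I. if s = t then a s * h s else 0)"
      by (rule sum.cong[OF HOL.refl], rule sum.cong[OF HOL.refl]) (simp add: bc h)
    finally show ?thesis by simp
  qed
  have rq: "?r * ?q = symQP m' n'"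
    by (subst sums) (auto simp: mn rhoS_iotaS rhoS_absorb sum_iotaS_rhoS)
  have qr: "?q * ?r = (\<Sum>s\<in>?I. iotaS m n (Suc s) * rhoS m n (Suc s))"
  proof (rule sums)
    fix s t assume "s \<in> ?I" "t \<in> ?I"
    then show "rhoS m' n' s * iotaS m' n' t = (if s = t then symPQ (m' - t) (n' - t) else 0 :: 'k mor)"
      by (simp add: rhoS_iotaS)
  next
    fix s assume "s \<in> ?I"
    show "symPQ (m' - s) (n' - s) * rhoS m n (Suc s) = (rhoS m n (Suc s) :: 'k mor)"
      using rhoS_absorb(2)[of m "Suc s" n] unfolding d .
  qed
  have list: "[PP n \<otimes>\<^sub>H QQ m, QQ (m - 1) \<otimes>\<^sub>H PP (n - 1)]
    = map (\<lambda>i. ([if i = 0 then Ups n @ Dns m else Dns m' @ Ups n'],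
        single (if i = 0 then symPQ m n else symQP m' n' :: 'k mor))) [0..<2]"
    by (simp add: PP_QQ QQ_PP mn numeral_2_eq_2)
  show "QP \<cong>\<^sub>H hdsum [PP n \<otimes>\<^sub>H QQ m, QQ (m - 1) \<otimes>\<^sub>H PP (n - 1)]"
    unfolding QP_def QQ_PP[of m n] list
  proof (rule hiso_hdsum[where r = "\<lambda>i. if i = 0 then rhoS m n 0 else ?r"
        and q = "\<lambda>i. if i = 0 then iotaS m n 0 else ?q"])
    have "(\<Sum>s\<le>min m n. iotaS m n s * rhoS m n s)
      = iotaS m n 0 * rhoS m n 0 + (\<Sum>s\<in>?I. iotaS m n (Suc s) * (rhoS m n (Suc s) :: 'k mor))"
      unfolding mn min_Suc_Suc by (rule sum.atMost_Suc_shift)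
    then show "(\<Sum>i<2::nat. (if i = 0 then iotaS m n 0 else ?q) * (if i = 0 then rhoS m n 0 else ?r)) = symQP m n"
      by (simp add: numeral_2_eq_2 qr sum_iotaS_rhoS)
  next
    fix i j :: nat assume ij: "i < 2" "j < 2"
    \<comment> \<open>\<open>?q\<close> involves only the inclusions of positive index, which are
      orthogonal to index 0; likewise \<open>?r\<close> involves only projections of positive
      index.\<close>
    have "rhoS m n 0 * ?q = 0"
      by (auto simp: sum_distrib_left rhoS_iotaS[THEN comp_ext2] mn intro!: sum.neutral)
    moreover have "?r * iotaS m n 0 = 0"
      by (auto simp: sum_distrib_right mult.assoc rhoS_iotaS mn intro!: sum.neutral)
    ultimately show "(if i = 0 then rhoS m n 0 else ?r) * (if j = 0 then iotaS m n 0 else ?q)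
      = (if i = j then if i = 0 then symPQ m n else symQP m' n' else 0)"
      using ij by (auto simp: rhoS_iotaS rq less_2_cases_iff)
  next
    fix i :: nat
    have "?r \<in> Mor (Dns m @ Ups n) (Dns m' @ Ups n')"
    proof (rule Mor_sum, rule Mor_comp)
      fix s assume "s \<in> ?I"
      then show "rhoS m n (Suc s) \<in> Mor (Dns m @ Ups n) (Ups (n' - s) @ Dns (m' - s))"
        using Mor_rhoS[of "Suc s" m n] by (simp add: mn)
    qed (simp add: Mor_iotaS)
    then show "(if i = 0 then rhoS m n 0 else ?r)
        \<in> Mor (Dns m @ Ups n) (if i = 0 then Ups n @ Dns m else Dns m' @ Ups n')"
      using Mor_rhoS[where 'a = 'k, of 0 m n] by simp
    have "?q \<in> Mor (Dns m' @ Ups n') (Dns m @ Ups n)"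
    proof (rule Mor_sum, rule Mor_comp)
      fix s assume "s \<in> ?I"
      then show "iotaS m n (Suc s) \<in> Mor (Ups (n' - s) @ Dns (m' - s)) (Dns m @ Ups n)"
        using Mor_iotaS[of "Suc s" m n] by (simp add: mn)
    qed (simp add: Mor_rhoS)
    then show "(if i = 0 then iotaS m n 0 else ?q)
        \<in> Mor (if i = 0 then Ups n @ Dns m else Dns m' @ Ups n') (Dns m @ Ups n)"
      using Mor_iotaS[where 'a = 'k, of 0 m n] by simp
    show "(if i = 0 then rhoS m n 0 else ?r) * symQP m n = (if i = 0 then rhoS m n 0 else ?r)"
      by (auto simp: rhoS_absorb mn sum_distrib_right mult.assoc intro!: sum.cong)
    show "symQP m n * (if i = 0 then iotaS m n 0 else ?q) = (if i = 0 then iotaS m n 0 else ?q)"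
      by (auto simp: iotaS_absorb iotaS_absorb(1)[THEN comp_ext2] mn sum_distrib_left intro!: sum.cong)
  qed (auto simp: Mor_symQP Mor_symPQ)
qed

end
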